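(* Let $\Phi:\mathbb D\to\mathbb D$ be a continuous map. The following conditions are equivalent: (i) $\Phi\in\mathcal P_{\mathrm c}$. (ii) $\Phi$ is a $\rho$-uniform homeomorphism of $\mathbb D$, and $h_\Phi\in\operatorname{BiLip}(\mathbb T)$. (iii) $\Phi$ is a $\rho$-uniform homeomorphism of $\mathbb D$, and $\delta(\Phi(z))\asymp\delta(z)$ for $z\in\mathbb D$.
   Context: $\mathbb D=\{z\in\mathbb C:|z|<1\}$, $\mathbb T=\partial\mathbb D$, $\rho(z,w)=\left|\frac{z-w}{1-\overline z w}\right|$ is the pseudohyperbolic metric, and $\delta(z)=1-|z|$. The notation $A(z)\asymp B(z)$ means that there are constants $0<c\le C<\infty$, independent of $z$ (possibly depending on the map), with $cB\le A\le CB$. Sequences are indexed families $\Lambda=(\lambda_j)$ (finite or countably infinite) of points of $\mathbb D$; the image $\Phi(\Lambda)=(\Phi(\lambda_j))$ retains repeated terms. $\mathcal C$ denotes the class of Carleson (interpolating) sequences: $\Lambda=(\lambda_j)\in\mathcal C$ if every bounded scalar sequence $(a_j)$ is of the form $a_j=f(\lambda_j)$ for some $f\in H^\infty(\mathbb D)$. Finite sequences of distinct points belong to $\mathcal C$; a sequence with a repeated term does not. $\mathcal C_{\leftrightarrow}^{\mathrm c}$ is the class of continuous maps $\Phi:\mathbb D\to\mathbb D$ such that for every indexed sequence $\Lambda\subset\mathbb D$, $\Lambda\in\mathcal C\Leftrightarrow\Phi(\Lambda)\in\mathcal C$. $\mathcal P_{\mathrm c}=\{\Phi\in\mathcal C_{\leftrightarrow}^{\mathrm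 c}:1-|\Phi(z)|^2\asymp1-|z|^2\text{ for }z\in\mathbb D\}$. A homeomorphism $F$ of $\mathbb D$ onto itself is a $\rho$-uniform homeomorphism if both $F$ and $F^{-1}$ are uniformly continuous with respect to $\rho$. Every such $F$ extends uniquely to a homeomorphism of $\overline{\mathbb D}$; its restriction to $\mathbb T$ is the boundary map $h_F$. $\operatorname{BiLip}(\mathbb T)$ is the group of circle homeomorphisms $h$ (of either orientation) for which there is $L\ge1$ with $L^{-1}d_{\mathbb T}(\zeta,\eta)\le d_{\mathbb T}(h(\zeta),h(\eta))\le L\,d_{\mathbb T}(\zeta,\eta)$ for all $\zeta,\eta\in\mathbb T$, where $d_{\mathbb T}$ is the normalized arclength distance along the shorter arc, with values in $[0,1/2]$. *)

theory Defs
  imports "HOL-Complex_Analysis.Complex_Analysis" "HOL-Library.FuncSet"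
begin

abbreviation unit_disc :: "complex set" where
  "unit_disc \<equiv> ball 0 1"

abbreviation unit_circle :: "complex set" where
  "unit_circle \<equiv> sphere 0 1"

definition pseudohyp :: "complex \<Rightarrow> complex \<Rightarrow> real" where
  "pseudohyp z w = norm ((z - w) / (1 - cnj z * w))"

definition bdry_dist :: "complex \<Rightarrow> real" where
  "bdry_dist z = 1 - norm z"

definition comparable_on :: "'a set \<Rightarrow> ('a \<Rightarrow> real) \<Rightarrow> ('a \<Rightarrow> real) \<Rightarrow> bool" where
  "comparable_on S A B \<longleftrightarrow>
     (\<exists>c C. 0 < c \<and> c \<le> C \<and> (\<forall>z\<in>S. c * B z \<le> A z \<and> A z \<le> C * B z))"

definition H_infinity :: "(complex \<Rightarrow> complex) set" where
  "H_infinity = {f. f holomorphic_on unit_disc \<and> bounded (f ` unit_disc)}"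

text \<open>
  A sequence, finite or countably infinite and possibly with repeated terms, is a family
  \<open>\<lambda>\<close> together with its index set \<open>I\<close>, a set of natural numbers; the values of \<open>\<lambda>\<close> outside
  \<open>I\<close> play no role. Similarly, self-maps of the disc are total functions of which only the
  values on the disc matter.
\<close>

definition carleson_seq :: "nat set \<Rightarrow> (nat \<Rightarrow> complex) \<Rightarrow> bool" where
  "carleson_seq I l \<longleftrightarrow> l \<in> I \<rightarrow> unit_disc \<and>
     (\<forall>a :: nat \<Rightarrow> complex. bounded (a ` I) \<longrightarrow> (\<exists>f\<in>H_infinity. \<forall>j\<in>I. a j = f (l j)))"

definition carleson_equiv_maps :: "(complex \<Rightarrow> complex) set" where
  "carleson_equiv_maps =
     {\<Phi>. continuous_on unit_disc \<Phi> \<and> \<Phi> \<in> unit_disc \<rightarrow> unit_disc \<and>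
        (\<forall>I l. l \<in> I \<rightarrow> unit_disc \<longrightarrow> (carleson_seq I l \<longleftrightarrow> carleson_seq I (\<Phi> \<circ> l)))}"

definition comparable_carleson_equiv_maps :: "(complex \<Rightarrow> complex) set" where
  "comparable_carleson_equiv_maps =
     {\<Phi> \<in> carleson_equiv_maps.
        comparable_on unit_disc (\<lambda>z. 1 - (norm (\<Phi> z))\<^sup>2) (\<lambda>z. 1 - (norm z)\<^sup>2)}"

definition pseudohyp_unif_cont :: "(complex \<Rightarrow> complex) \<Rightarrow> bool" where
  "pseudohyp_unif_cont F \<longleftrightarrow>
     (\<forall>e>0. \<exists>d>0. \<forall>z\<in>unit_disc. \<forall>w\<in>unit_disc.
        pseudohyp z w < d \<longrightarrow> pseudohyp (F z) (F w) < e)"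

definition pseudohyp_unif_homeo :: "(complex \<Rightarrow> complex) \<Rightarrow> bool" where
  "pseudohyp_unif_homeo F \<longleftrightarrow>
     (\<exists>G. homeomorphism unit_disc unit_disc F G \<and> pseudohyp_unif_cont F \<and> pseudohyp_unif_cont G)"

text \<open>
  The homeomorphic extension to the closed disc is unique as a function on the closed disc, so
  it is normalised to be \<open>undefined\<close> elsewhere. It is only meaningful for maps that have
  such an extension, in particular for those satisfying \<^const>\<open>pseudohyp_unif_homeo\<close>.
\<close>

definition closed_disc_extension :: "(complex \<Rightarrow> complex) \<Rightarrow> complex \<Rightarrow> complex" where
  "closed_disc_extension F =
     (THE H. H \<in> extensional (cball 0 1) \<and>
        (\<exists>K. homeomorphism (cball 0 1) (cball 0 1) H K) \<and> (\<forall>z\<in>unit_disc. H z = F z))"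

definition boundary_map :: "(complex \<Rightarrow> complex) \<Rightarrow> complex \<Rightarrow> complex" where
  "boundary_map F = restrict (closed_disc_extension F) unit_circle"

text \<open>
  Since \<^const>\<open>Arg\<close> takes values in the interval from \<open>-\<pi>\<close> (excluded) to \<open>\<pi>\<close>, the number
  \<open>\<bar>Arg (\<eta> / \<zeta>)\<bar>\<close> is the length of the shorter arc between the points \<open>\<zeta>\<close> and \<open>\<eta>\<close> of
  the circle; the total length of the circle is normalised to \<open>1\<close>.
\<close>

definition circle_dist :: "complex \<Rightarrow> complex \<Rightarrow> real" where
  "circle_dist \<zeta> \<eta> = \<bar>Arg (\<eta> / \<zeta>)\<bar> / (2 * pi)"

definition BiLip_circle :: "(complex \<Rightarrow> complex) set" where
  "BiLip_circle =
     {h. (\<exists>k. homeomorphism unit_circle unit_circle h k) \<and>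
        (\<exists>L\<ge>1. \<forall>\<zeta>\<in>unit_circle. \<forall>\<eta>\<in>unit_circle.
           inverse L * circle_dist \<zeta> \<eta> \<le> circle_dist (h \<zeta>) (h \<eta>) \<and>
           circle_dist (h \<zeta>) (h \<eta>) \<le> L * circle_dist \<zeta> \<eta>)}"

end

theory Submission
  imports Defs
begin

text \<open>
Two facts carry the equivalence. The first is Carleson's theorem: a sequence is interpolating
precisely if the products \<open>\<Prod>k\<noteq>j. \<rho>(l j, l k)\<close> are bounded below uniformly in \<open>j\<close>, that is, if
the points are separated for \<open>\<rho>\<close> and the sums \<open>\<Sum>k\<noteq>j. 1 - \<rho>(l j, l k)\<^sup>2\<close> are bounded
(\<open>carleson_seq_iff_uniformly_separated\<close>, \<open>uniformly_separated_imp_sum_bounded\<close>,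
\<open>sum_bounded_imp_uniformly_separated\<close>).
The second is a Hoelder estimate: if \<open>F\<close> maps points at small \<open>\<rho>\<close>-distance to points at
\<open>\<rho>\<close>-distance at most 1/2, and \<open>\<delta>(F z) \<le> C \<delta>(z)\<^sup>\<alpha>\<close>, then
\<open>\<bar>F z - F w\<bar> \<le> K \<bar>1 - cnj z w\<bar>\<^sup>\<alpha>\<close> with \<open>K\<close> depending only on the constants
(\<open>holder_estimate\<close>). The quantity \<open>\<bar>1 - cnj z w\<bar>\<close> is comparable to
\<open>\<bar>z - w\<bar> + \<delta>(z) + \<delta>(w)\<close>.

Boundary behaviour. For a \<open>\<rho>\<close>-uniform homeomorphism \<open>F\<close> some exponent \<open>\<alpha>\<close> is always
available for \<open>F\<close> and for its inverse, because \<open>\<delta>\<close> changes at most by a bounded factor under a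
step of bounded size and a point \<open>z\<close> is reached from 0 in about \<open>log (1 / \<delta>(z))\<close> steps
(\<open>bdry_dist_growth\<close>). Hence both maps extend continuously to the closed disc. If \<open>\<delta>(F z)\<close> and
\<open>\<delta>(z)\<close> are comparable, then \<open>\<alpha> = 1\<close> is admissible in both directions, and letting \<open>z\<close> and \<open>w\<close>
tend to the circle makes the boundary map bi-Lipschitz. Conversely, let the boundary map \<open>h\<close> be
Lipschitz and fix \<open>w\<close>. Composition with Moebius maps that move \<open>w\<close> and \<open>F w\<close> to 0 leaves the step
sizes unchanged, so the Hoelder estimate for the inverse of the normalised map shows that two boundary
points which look far apart from \<open>w\<close> have images that look far apart from \<open>F w\<close>. Such points
exist at Euclidean distance at most \<open>2 \<delta>(w)\<close>, their images are at distance at most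
\<open>2 L \<delta>(w)\<close>, and points that look far apart from \<open>F w\<close> are at distance at least a multiple of
\<open>\<delta>(F w)\<close>. So \<open>\<delta>(F w) \<le> C \<delta>(w)\<close>, and the same argument applies to the inverse
(\<open>bdry_dist_le_of_boundary_lipschitz\<close>, \<open>BiLip_boundary_iff_comparable\<close>).

Interpolating sequences. If \<open>F\<close> is a \<open>\<rho>\<close>-uniform homeomorphism and \<open>\<delta>(F z)\<close> is comparable to
\<open>\<delta>(z)\<close>, the estimate with \<open>\<alpha> = 1\<close> for the inverse gives \<open>1 - \<rho>(F z, F w)\<^sup>2 \<le> C (1 - \<rho>(z, w)\<^sup>2)\<close>,
so separation and the bound on the sums survive under \<open>F\<close>, and likewise under its inverse.
Conversely, a continuous map that preserves and reflects interpolating sequences is injective, as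
is seen on two-point sequences; with \<open>\<delta>(F z) \<le> C \<delta>(z)\<close> it is proper, hence a homeomorphism by
invariance of domain. If it were not \<open>\<rho>\<close>-uniformly continuous, there would be pairs of points that
approach each other while their images stay apart. By continuity such pairs tend to the circle,
and a sparse subsequence of the image pairs is interpolating although the pairs themselves are not
even separated (\<open>pseudohyp_unif_cont_of_carleson\<close>); the same holds for the inverse.
\<close>

section \<open>The pseudohyperbolic metric and Moebius transformations\<close>

lemma one_minus_cnj_mult_nonzero:
  assumes "norm a < 1" "norm z \<le> 1"
  shows "1 - cnj a * z \<noteq> 0"
proof
  assume "1 - cnj a * z = 0"
  then have "norm (cnj a * z) = 1" by (metis norm_one right_minus_eq)
  moreover have "norm (cnj a * z) \<le> norm a * 1"
    using assms by (simp add: norm_mult mult_left_le)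
  ultimately show False using assms by simp
qed

lemma bdry_dist_vs_sq:
  assumes "norm z \<le> 1"
  shows "bdry_dist z \<le> 1 - (norm z)\<^sup>2" "1 - (norm z)\<^sup>2 \<le> 2 * bdry_dist z"
proof -
  show "bdry_dist z \<le> 1 - (norm z)\<^sup>2"
    using assms by (simp add: bdry_dist_def power2_eq_square mult_left_le)
  have "0 \<le> (1 - norm z)\<^sup>2" by simp
  then show "1 - (norm z)\<^sup>2 \<le> 2 * bdry_dist z" by (simp add: bdry_dist_def power2_eq_square algebra_simps)
qed

lemma bdry_dist_le_norm_one_minus:
  assumes "norm z \<le> 1" "norm w \<le> 1"
  shows "bdry_dist z \<le> norm (1 - cnj z * w)" "bdry_dist w \<le> norm (1 - cnj z * w)"
proof -
  have "1 - norm z * norm w \<le> norm (1 - cnj z * w)"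
    using norm_triangle_ineq2[of 1 "cnj z * w"] by (simp add: norm_mult)
  moreover have "norm z * norm w \<le> norm z" "norm z * norm w \<le> norm w"
    using assms by (auto simp: mult_left_le mult_left_le_one_le)
  ultimately show "bdry_dist z \<le> norm (1 - cnj z * w)" "bdry_dist w \<le> norm (1 - cnj z * w)"
    by (auto simp: bdry_dist_def)
qed

text \<open>
As \<open>\<delta>(z)\<close>, \<open>\<delta>(w)\<close> and \<open>\<bar>z - w\<bar>\<close> are lower bounds, \<open>\<bar>1 - cnj z w\<bar>\<close> is comparable to their sum on
the disc, a form in which it can be estimated along paths.
\<close>

lemma norm_one_minus_le:
  assumes "norm z \<le> 1"
  shows "norm (1 - cnj z * w) \<le> 2 * bdry_dist z + norm (z - w)"
proof -
  have eq: "1 - cnj z * w = of_real (1 - (norm z)\<^sup>2) + cnj z * (z - w)"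
    by (simp add: algebra_simps complex_norm_square del: of_real_power)
  have "norm (1 - cnj z * w) \<le> norm (complex_of_real (1 - (norm z)\<^sup>2)) + norm (cnj z * (z - w))"
    unfolding eq by (rule norm_triangle_ineq)
  also have "norm (complex_of_real (1 - (norm z)\<^sup>2)) = 1 - (norm z)\<^sup>2"
    using assms by (simp only: norm_of_real) (simp add: power_le_one)
  also have "1 - (norm z)\<^sup>2 \<le> 2 * bdry_dist z"
    unfolding bdry_dist_def using zero_le_power2[of "1 - norm z"]
    by (simp add: power2_eq_square algebra_simps)
  also have "norm (cnj z * (z - w)) \<le> norm (z - w)"
    using assms by (simp add: norm_mult mult_left_le_one_le)
  finally show ?thesis by simp
qed

lemma norm_one_minus_sq:
  "(norm (1 - cnj z * w))\<^sup>2 = (norm (z - w))\<^sup>2 + (1 - (norm z)\<^sup>2) * (1 - (norm w)\<^sup>2)"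
proof -
  have "complex_of_real ((norm (1 - cnj z * w))\<^sup>2) =
        complex_of_real ((norm (z - w))\<^sup>2 + (1 - (norm z)\<^sup>2) * (1 - (norm w)\<^sup>2))"
    by (simp add: complex_norm_square algebra_simps del: of_real_power)
  then show ?thesis using of_real_eq_iff by blast
qed

lemma norm_diff_le_norm_one_minus:
  assumes "norm z \<le> 1" "norm w \<le> 1"
  shows "norm (z - w) \<le> norm (1 - cnj z * w)"
proof (rule power2_le_imp_le)
  show "(norm (z - w))\<^sup>2 \<le> (norm (1 - cnj z * w))\<^sup>2"
    unfolding norm_one_minus_sq using assms by (simp add: power_le_one)
qed simp

lemma pseudohyp_commute: "pseudohyp z w = pseudohyp w z"
proof -
  have "norm (1 - cnj z * w) = norm (cnj (1 - cnj z * w))" by (simp only: complex_mod_cnj)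
  then have "norm (1 - cnj z * w) = norm (1 - cnj w * z)" by (simp add: mult.commute)
  then show ?thesis by (simp add: pseudohyp_def norm_divide norm_minus_commute)
qed

lemma pseudohyp_nonneg [simp]: "0 \<le> pseudohyp z w"
  by (simp add: pseudohyp_def)

lemma norm_diff_eq_pseudohyp:
  assumes "norm z < 1" "norm w < 1"
  shows "norm (z - w) = pseudohyp z w * norm (1 - cnj z * w)"
  using one_minus_cnj_mult_nonzero[of z w] assms by (simp add: pseudohyp_def norm_divide)

lemma one_minus_pseudohyp_sq:
  assumes "norm z < 1" "norm w < 1"
  shows "1 - (pseudohyp z w)\<^sup>2 =
         (1 - (norm z)\<^sup>2) * (1 - (norm w)\<^sup>2) / (norm (1 - cnj z * w))\<^sup>2"
proof -
  have "(norm (1 - cnj z * w))\<^sup>2 \<noteq> 0" using one_minus_cnj_mult_nonzero[of z w] assms by simp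
  then have "1 - (pseudohyp z w)\<^sup>2 =
      ((norm (1 - cnj z * w))\<^sup>2 - (norm (z - w))\<^sup>2) / (norm (1 - cnj z * w))\<^sup>2"
    unfolding pseudohyp_def norm_divide power_divide by (simp add: diff_divide_distrib[of "_ ^ 2"])
  then show ?thesis by (simp only: norm_one_minus_sq add_diff_cancel_left')
qed

lemma pseudohyp_lt_1:
  assumes "norm z < 1" "norm w < 1"
  shows "pseudohyp z w < 1"
proof -
  have "(norm z)\<^sup>2 < 1" "(norm w)\<^sup>2 < 1" using assms by (simp_all add: power_less_one_iff)
  moreover have "norm (1 - cnj z * w) > 0" using one_minus_cnj_mult_nonzero[of z w] assms by simp
  ultimately have "0 < 1 - (pseudohyp z w)\<^sup>2" by (simp add: one_minus_pseudohyp_sq assms)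
  then have "(pseudohyp z w)\<^sup>2 < 1\<^sup>2" by simp
  then show ?thesis using power2_less_imp_less by fastforce
qed

lemma pseudohyp_eq_0_iff:
  assumes "norm z < 1" "norm w < 1"
  shows "pseudohyp z w = 0 \<longleftrightarrow> z = w"
  using one_minus_cnj_mult_nonzero[of z w] assms by (simp add: pseudohyp_def)

text \<open>
Points at bounded \<open>\<rho>\<close>-distance have comparable distance to the circle, and their Euclidean distance
is controlled by it: inserting \<open>\<bar>1 - cnj z w\<bar> \<le> 2 \<delta>(z) + \<bar>z - w\<bar>\<close> into the definition of \<open>\<rho>\<close>
lets the term \<open>\<bar>z - w\<bar>\<close> be absorbed.
\<close>

lemma pseudohyp_half_imp:
  assumes "norm z < 1" "norm w < 1" "pseudohyp z w \<le> 1/2"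
  shows "norm (z - w) \<le> 2 * bdry_dist z" "bdry_dist w \<le> 3 * bdry_dist z"
proof -
  have "norm (z - w) \<le> 1/2 * norm (1 - cnj z * w)"
    unfolding norm_diff_eq_pseudohyp[OF assms(1,2)] using assms(3) by (intro mult_right_mono) auto
  also have "\<dots> \<le> 1/2 * (2 * bdry_dist z + norm (z - w))"
    using norm_one_minus_le[of z w] assms(1) by simp
  finally show *: "norm (z - w) \<le> 2 * bdry_dist z" by simp
  have "norm z - norm w \<le> norm (z - w)" by (rule norm_triangle_ineq2)
  with * show "bdry_dist w \<le> 3 * bdry_dist z" by (simp add: bdry_dist_def)
qed

lemma norm_Moebius_function_0: "norm (Moebius_function 0 a z) = pseudohyp a z"
  by (simp add: Moebius_function_simple pseudohyp_def norm_divide norm_minus_commute)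

lemma Moebius_function_diff:
  assumes "norm a < 1" "norm u \<le> 1" "norm v \<le> 1"
  shows "Moebius_function 0 a u - Moebius_function 0 a v =
         of_real (1 - (norm a)\<^sup>2) * (u - v) / ((1 - cnj a * u) * (1 - cnj a * v))"
proof -
  have "1 - cnj a * u \<noteq> 0" "1 - cnj a * v \<noteq> 0" using one_minus_cnj_mult_nonzero assms by auto
  then have "Moebius_function 0 a u - Moebius_function 0 a v =
     (((u - a) * (1 - cnj a * v)) - ((v - a) * (1 - cnj a * u))) / ((1 - cnj a * u) * (1 - cnj a * v))"
    by (simp add: Moebius_function_simple diff_frac_eq)
  also have "((u - a) * (1 - cnj a * v)) - ((v - a) * (1 - cnj a * u)) =
      of_real (1 - (norm a)\<^sup>2) * (u - v)"
    by (simp add: complex_norm_square algebra_simps del: of_real_power)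
  finally show ?thesis .
qed

lemma norm_one_minus_Moebius_function:
  assumes "norm a < 1" "norm u \<le> 1" "norm v \<le> 1"
  shows "norm (1 - cnj (Moebius_function 0 a u) * Moebius_function 0 a v) =
         (1 - (norm a)\<^sup>2) * norm (1 - cnj u * v) / (norm (1 - cnj a * u) * norm (1 - cnj a * v))"
proof -
  have nz: "1 - cnj a * u \<noteq> 0" "1 - cnj a * v \<noteq> 0" using one_minus_cnj_mult_nonzero assms by auto
  then have nz': "1 - a * cnj u \<noteq> 0" by (metis complex_cnj_cnj complex_cnj_diff complex_cnj_mult complex_cnj_one complex_cnj_zero)
  have "1 - cnj (Moebius_function 0 a u) * Moebius_function 0 a v =
     ((1 - a * cnj u) * (1 - cnj a * v) - (cnj u - cnj a) * (v - a)) / ((1 - a * cnj u) * (1 - cnj a * v))"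
    using nz nz' by (simp add: Moebius_function_simple divide_simps)
  also have "(1 - a * cnj u) * (1 - cnj a * v) - (cnj u - cnj a) * (v - a) =
     of_real (1 - (norm a)\<^sup>2) * (1 - cnj u * v)"
    by (simp add: complex_norm_square algebra_simps del: of_real_power)
  finally have eq: "1 - cnj (Moebius_function 0 a u) * Moebius_function 0 a v =
     of_real (1 - (norm a)\<^sup>2) * (1 - cnj u * v) / ((1 - a * cnj u) * (1 - cnj a * v))" .
  have "norm (1 - a * cnj u) = norm (cnj (1 - a * cnj u))" by (simp only: complex_mod_cnj)
  then have n1: "norm (1 - a * cnj u) = norm (1 - cnj a * u)" by simp
  have "norm (complex_of_real (1 - (norm a)\<^sup>2)) = 1 - (norm a)\<^sup>2"
    using assms by (simp only: norm_of_real) (simp add: power_le_one)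
  then show ?thesis unfolding eq by (simp add: norm_mult norm_divide n1 del: of_real_diff)
qed

lemma pseudohyp_Moebius_function:
  assumes "norm a < 1" "norm u < 1" "norm v < 1"
  shows "pseudohyp (Moebius_function 0 a u) (Moebius_function 0 a v) = pseudohyp u v"
proof -
  have nz: "norm (1 - cnj a * u) > 0" "norm (1 - cnj a * v) > 0" "norm (1 - cnj u * v) > 0"
    using one_minus_cnj_mult_nonzero assms by auto
  have a2: "(norm a)\<^sup>2 < 1" using assms by (simp add: power_less_one_iff)
  have "norm (complex_of_real (1 - (norm a)\<^sup>2)) = 1 - (norm a)\<^sup>2"
    using assms by (simp only: norm_of_real) (simp add: power_le_one)
  then have "norm (Moebius_function 0 a u - Moebius_function 0 a v) =
        (1 - (norm a)\<^sup>2) * norm (u - v) / (norm (1 - cnj a * u) * norm (1 - cnj a * v))"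
    unfolding Moebius_function_diff[OF assms(1) less_imp_le[OF assms(2)] less_imp_le[OF assms(3)]]
    by (simp only: norm_mult norm_divide)
  then show ?thesis
    using assms nz a2 by (simp add: pseudohyp_def norm_divide norm_one_minus_Moebius_function)
qed

lemma Moebius_function_inverse:
  assumes "norm a < 1" "norm z < 1"
  shows "Moebius_function 0 a (Moebius_function 0 (-a) z) = z"
    and "Moebius_function 0 (-a) (Moebius_function 0 a z) = z"
  using assms by (simp_all add: Moebius_function_compose)

lemma continuous_on_Moebius_function:
  "norm a < 1 \<Longrightarrow> continuous_on (cball 0 1) (Moebius_function 0 a)"
  unfolding Moebius_function_simple[abs_def]
  using one_minus_cnj_mult_nonzero[of a] by (intro continuous_intros) (auto simp: mem_cball_0)

section \<open>Interpolating sequences are the uniformly separated ones\<close>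

lemma sum_one_minus_sq_le_ln_prod:
  fixes r :: "'a \<Rightarrow> real"
  assumes "finite A" "\<And>k. k \<in> A \<Longrightarrow> 0 \<le> r k" "0 < d" "d \<le> (\<Prod>k\<in>A. r k)"
  shows "(\<Sum>k\<in>A. 1 - (r k)\<^sup>2) \<le> - 2 * ln d"
proof -
  have pos: "r k > 0" if "k \<in> A" for k
  proof -
    have "(\<Prod>k\<in>A. r k) \<noteq> 0" using assms by linarith
    then have "r k \<noteq> 0" using assms(1) that by auto
    then show "r k > 0" using assms(2)[OF that] by linarith
  qed
  have "(\<Sum>k\<in>A. 1 - (r k)\<^sup>2) \<le> (\<Sum>k\<in>A. - 2 * ln (r k))"
  proof (rule sum_mono)
    fix k assume "k \<in> A"
    then have "ln ((r k)\<^sup>2) \<le> (r k)\<^sup>2 - 1" by (intro ln_le_minus_one zero_less_power pos)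
    then show "1 - (r k)\<^sup>2 \<le> - 2 * ln (r k)" using pos[OF \<open>k \<in> A\<close>] by (simp add: ln_realpow)
  qed
  also have "\<dots> = - 2 * ln (\<Prod>k\<in>A. r k)"
    using pos assms(1) by (subst ln_prod) (auto simp: sum_distrib_left sum_negf dest: pos)
  also have "\<dots> \<le> - 2 * ln d" using assms by simp
  finally show ?thesis .
qed

text \<open>
A discrete form of \<open>\<integral>\<^sub>0\<^sup>\<infinity> e\<^sup>-\<^sup>t dt = 1\<close>: listing the indices by decreasing \<open>m\<close>, with partial sums
\<open>s\<close> of the weights, each term \<open>w e\<^sup>-\<^sup>s\<close> is at most the decrement of \<open>e\<^sup>-\<^sup>s\<close> across its step.
\<close>

lemma sum_weights_exp_le:
  fixes w m :: "'a \<Rightarrow> real"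
  assumes "finite A" "\<And>k. k \<in> A \<Longrightarrow> 0 \<le> w k"
  shows "(\<Sum>j\<in>A. w j * exp (- (\<Sum>k | k \<in> A \<and> m j \<le> m k. w k))) \<le> 1 - exp (- (\<Sum>k\<in>A. w k))"
  using assms
proof (induction rule: finite_ranking_induct[where f = "\<lambda>k. - m k"])
  case empty
  then show ?case by simp
next
  case (insert x A)
  show ?case
  proof (cases "x \<in> A")
    case True
    then show ?thesis using insert by (simp add: insert_absorb)
  next
    case False
    let ?s = "\<Sum>k\<in>A. w k"
    have x: "{k. k \<in> insert x A \<and> m x \<le> m k} = insert x A" using insert.hyps by auto
    have "(\<Sum>j\<in>A. w j * exp (- (\<Sum>k | k \<in> insert x A \<and> m j \<le> m k. w k)))
        \<le> (\<Sum>j\<in>A. w j * exp (- (\<Sum>k | k \<in> A \<and> m j \<le> m k. w k)))"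
    proof (intro sum_mono mult_left_mono)
      fix j assume "j \<in> A"
      have "(\<Sum>k | k \<in> A \<and> m j \<le> m k. w k) \<le> (\<Sum>k | k \<in> insert x A \<and> m j \<le> m k. w k)"
        using insert by (intro sum_mono2) auto
      then show "exp (- (\<Sum>k | k \<in> insert x A \<and> m j \<le> m k. w k))
           \<le> exp (- (\<Sum>k | k \<in> A \<and> m j \<le> m k. w k))" by simp
    qed (use insert in auto)
    also have "\<dots> \<le> 1 - exp (- ?s)" using insert by auto
    finally have A: "(\<Sum>j\<in>A. w j * exp (- (\<Sum>k | k \<in> insert x A \<and> m j \<le> m k. w k)))
        \<le> 1 - exp (- ?s)" .
    have "w x \<le> exp (w x) - 1" using exp_ge_add_one_self[of "w x"] by linarith
    then have "w x * exp (- (w x + ?s)) \<le> (exp (w x) - 1) * exp (- (w x + ?s))"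
      by (intro mult_right_mono) auto
    also have "\<dots> = exp (- ?s) - exp (- (w x + ?s))"
      by (simp add: algebra_simps flip: exp_add)
    finally show ?thesis using A insert(1) False
      by (simp add: x del: insert_iff)
  qed
qed

lemma Re_Poisson:
  assumes "norm a < 1" "norm z < 1"
  shows "Re ((1 + cnj a * z) / (1 - cnj a * z)) = (1 - (norm a)\<^sup>2 * (norm z)\<^sup>2) / (norm (1 - cnj a * z))\<^sup>2"
proof -
  define u where "u = cnj a * z"
  have "(norm a)\<^sup>2 * (norm z)\<^sup>2 = (norm u)\<^sup>2" by (simp add: u_def norm_mult power_mult_distrib)
  moreover have "Re ((1 + u) / (1 - u)) = (1 - (norm u)\<^sup>2) / (norm (1 - u))\<^sup>2"
    unfolding Re_divide cmod_power2 by (simp add: power2_eq_square algebra_simps)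
  ultimately show ?thesis by (simp add: u_def)
qed

text \<open>
The explicit formula of P. Jones. The Blaschke factors in \<open>B j\<close> make \<open>F j\<close> vanish at the other
nodes; the exponential \<open>E j\<close> contains the Poisson kernels of the nodes that are at least as close to
the circle as \<open>l j\<close>. Its size at \<open>z\<close> is at most \<open>exp (- s j)\<close> up to a constant, where the \<open>s j\<close> are
the partial sums of the squared factors \<open>w j\<close>, so \<open>sum_weights_exp_le\<close> bounds
\<open>\<Sum>j. \<bar>F j z\<bar>\<close> independently of the number of nodes.
\<close>

lemma finite_interpolation:
  fixes l a :: "nat \<Rightarrow> complex"
  assumes A: "finite A" and l: "\<And>j. j \<in> A \<Longrightarrow> norm (l j) < 1" and d: "0 < d"
    and sep: "\<And>j. j \<in> A \<Longrightarrow> d \<le> (\<Prod>k\<in>A - {j}. pseudohyp (l j) (l k))"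
    and a: "\<And>j. j \<in> A \<Longrightarrow> norm (a j) \<le> 1"
  obtains f where "f holomorphic_on unit_disc" "\<And>z. norm z < 1 \<Longrightarrow> norm (f z) \<le> exp 2 / d ^ 5"
    "\<And>j. j \<in> A \<Longrightarrow> f (l j) = a j"
proof -
  define B where "B j z = (\<Prod>k\<in>A - {j}. Moebius_function 0 (l k) z)" for j z
  define P where "P k z = (1 + cnj (l k) * z) / (1 - cnj (l k) * z)" for k z
  define S where "S j = {k. k \<in> A \<and> norm (l j) \<le> norm (l k)}" for j
  define \<delta> where "\<delta> k = 1 - (norm (l k))\<^sup>2" for k
  define E where "E j z = exp (- (\<Sum>k\<in>S j. of_real (\<delta> k) * (P k z - P k (l j))))" for j z
  define w where "w k z = (\<delta> k / norm (1 - cnj (l k) * z))\<^sup>2" for k z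
  define F where "F j z = B j z / B j (l j) * (of_real (\<delta> j) / (1 - cnj (l j) * z))\<^sup>2 * E j z" for j z
  have nz: "1 - cnj (l k) * z \<noteq> 0" if "k \<in> A" "norm z < 1" for k z
    using one_minus_cnj_mult_nonzero[of "l k" z] l that by auto
  have \<delta>: "0 < \<delta> k" "\<delta> k \<le> 1" if "k \<in> A" for k
    using l[OF that] by (auto simp: \<delta>_def power_less_one_iff)
  have SA: "S j \<subseteq> A" "finite (S j)" for j using A by (auto simp: S_def)
  have holF: "F j holomorphic_on unit_disc" if "j \<in> A" for j
  proof -
    have "B j holomorphic_on unit_disc" unfolding B_def[abs_def]
      using l by (intro holomorphic_on_prod Moebius_function_holomorphic) auto
    moreover have "P k holomorphic_on unit_disc" if "k \<in> A" for k
      unfolding P_def[abs_def] using nz that by (intro holomorphic_intros) auto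
    then have "E j holomorphic_on unit_disc" unfolding E_def[abs_def]
      using SA by (intro holomorphic_intros) auto
    moreover have "(\<lambda>z. (of_real (\<delta> j) / (1 - cnj (l j) * z))\<^sup>2) holomorphic_on unit_disc"
      using nz that by (intro holomorphic_intros) auto
    ultimately have "(\<lambda>z. (1 / B j (l j)) * (B j z * (of_real (\<delta> j) / (1 - cnj (l j) * z))\<^sup>2 * E j z))
        holomorphic_on unit_disc"
      by (intro holomorphic_on_mult holomorphic_on_const)
    then show ?thesis by (simp add: F_def[abs_def])
  qed
  have normB: "norm (B j (l j)) \<ge> d" if "j \<in> A" for j
    using sep[OF that]
    by (simp add: B_def prod_norm[symmetric] norm_Moebius_function_0 pseudohyp_commute)
  have F_off: "F j (l i) = 0" if "i \<in> A" "j \<in> A" "i \<noteq> j" for i j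
  proof -
    have "B j (l i) = 0" using that A
      by (auto simp: B_def Moebius_function_eq_zero intro!: prod_zero bexI[of _ i])
    then show ?thesis by (simp add: F_def)
  qed
  have F_diag: "F j (l j) = 1" if "j \<in> A" for j
  proof -
    have "B j (l j) \<noteq> 0" using normB[OF that] d by auto
    moreover have "of_real (\<delta> j) = 1 - cnj (l j) * l j"
      by (simp add: \<delta>_def complex_norm_square mult.commute del: of_real_power)
    moreover have "E j (l j) = 1" by (simp add: E_def)
    ultimately show ?thesis using nz[OF that l[OF that]] by (simp add: F_def)
  qed
  have ReP: "Re (P k z) = (1 - (norm (l k))\<^sup>2 * (norm z)\<^sup>2) / (norm (1 - cnj (l k) * z))\<^sup>2"
    if "k \<in> A" "norm z < 1" for k z
    unfolding P_def using l that by (simp add: Re_Poisson)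
  \<comment> \<open>At \<open>l j\<close> itself the exponent is bounded: as the nodes in \<open>S j\<close> are at least as close
    to the circle as \<open>l j\<close>, each Poisson term is at most \<open>2 (1 - \<rho>\<^sup>2)\<close>, which is 2 for \<open>k = j\<close>.\<close>
  have at_node: "(\<Sum>k\<in>S j. \<delta> k * Re (P k (l j))) \<le> 2 - 4 * ln d" if j: "j \<in> A" for j
  proof -
    have "(\<Sum>k\<in>S j. \<delta> k * Re (P k (l j))) \<le> (\<Sum>k\<in>S j. 2 * (1 - (pseudohyp (l j) (l k))\<^sup>2))"
    proof (rule sum_mono)
      fix k assume k: "k \<in> S j"
      then have kA: "k \<in> A" and le: "norm (l j) \<le> norm (l k)" by (auto simp: S_def)
      have lj1: "(norm (l j))\<^sup>2 \<le> 1" using l[OF j] by (simp add: power_le_one)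
      have "(norm (l j))\<^sup>2 * (norm (l j))\<^sup>2 \<le> (norm (l k))\<^sup>2 * (norm (l j))\<^sup>2"
        using le by (intro mult_right_mono power_mono) auto
      moreover have "1 - x * x \<le> 2 * (1 - x)" for x :: real
        using zero_le_square[of "1 - x"] by (simp add: algebra_simps)
      ultimately have "1 - (norm (l k))\<^sup>2 * (norm (l j))\<^sup>2 \<le> 2 * \<delta> j"
        unfolding \<delta>_def using order_trans by (smt (verit))
      then have "\<delta> k * Re (P k (l j)) \<le> \<delta> k * (2 * \<delta> j / (norm (1 - cnj (l k) * l j))\<^sup>2)"
        unfolding ReP[OF kA l[OF j]] using \<delta>[OF kA]
        by (intro mult_left_mono divide_right_mono) auto
      also have "\<dots> = 2 * (1 - (pseudohyp (l k) (l j))\<^sup>2)"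
        by (subst one_minus_pseudohyp_sq) (use l j kA in \<open>auto simp: \<delta>_def\<close>)
      finally show "\<delta> k * Re (P k (l j)) \<le> 2 * (1 - (pseudohyp (l j) (l k))\<^sup>2)"
        by (simp only: pseudohyp_commute)
    qed
    also have "\<dots> \<le> (\<Sum>k\<in>A. 2 * (1 - (pseudohyp (l j) (l k))\<^sup>2))"
    proof (rule sum_mono2)
      fix k assume "k \<in> A - S j"
      then have "pseudohyp (l j) (l k) \<le> 1" using pseudohyp_lt_1[of "l j" "l k"] l j by auto
      then show "0 \<le> 2 * (1 - (pseudohyp (l j) (l k))\<^sup>2)" by (simp add: power_le_one)
    qed (use A SA in auto)
    also have "\<dots> = 2 * (1 + (\<Sum>k\<in>A - {j}. 1 - (pseudohyp (l j) (l k))\<^sup>2))"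
      using A j by (simp add: sum.remove pseudohyp_eq_0_iff l sum_distrib_left del: sum_subtractf)
    also have "(\<Sum>k\<in>A - {j}. 1 - (pseudohyp (l j) (l k))\<^sup>2) \<le> - 2 * ln d"
      using A d sep[OF j] by (intro sum_one_minus_sq_le_ln_prod) auto
    finally show ?thesis by simp
  qed
  have normF: "norm (F j z) \<le> exp 2 / d ^ 5 * (w j z * exp (- (\<Sum>k | k \<in> A \<and> norm (l j) \<le> norm (l k). w k z)))"
    if j: "j \<in> A" and z: "norm z < 1" for j z
  proof -
    have "norm (B j z) \<le> 1" unfolding B_def prod_norm[symmetric]
      using z l Moebius_function_norm_lt_1 by (intro prod_le_1) (auto intro: less_imp_le)
    then have 1: "norm (B j z / B j (l j)) \<le> 1 / d"
      using normB[OF j] d by (auto simp: norm_divide intro!: frac_le)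
    have "norm (E j z) = exp (- (\<Sum>k\<in>S j. \<delta> k * Re (P k z)) + (\<Sum>k\<in>S j. \<delta> k * Re (P k (l j))))"
      by (simp add: E_def algebra_simps sum_subtractf)
    also have "\<dots> \<le> exp (- (\<Sum>k\<in>S j. w k z) + (2 - 4 * ln d))"
    proof -
      have "(\<Sum>k\<in>S j. w k z) \<le> (\<Sum>k\<in>S j. \<delta> k * Re (P k z))"
      proof (rule sum_mono)
        fix k assume k: "k \<in> S j"
        then have kA: "k \<in> A" by (auto simp: S_def)
        have "(norm (l k))\<^sup>2 * (norm z)\<^sup>2 \<le> (norm (l k))\<^sup>2"
          using z by (simp add: mult_left_le power_le_one)
        then have "\<delta> k * (\<delta> k / (norm (1 - cnj (l k) * z))\<^sup>2) \<le> \<delta> k * Re (P k z)"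
          unfolding ReP[OF kA z] using \<delta>[OF kA]
          by (intro mult_left_mono divide_right_mono) (auto simp: \<delta>_def)
        then show "w k z \<le> \<delta> k * Re (P k z)"
          by (simp add: w_def power2_eq_square)
      qed
      then show ?thesis using at_node[OF j] by simp
    qed
    also have "\<dots> = exp 2 / d ^ 4 * exp (- (\<Sum>k\<in>S j. w k z))"
    proof -
      have "exp (4 * ln d) = d ^ 4" using d
        by (metis exp_ln exp_of_nat_mult of_nat_numeral)
      then show ?thesis by (simp add: exp_add exp_diff exp_minus field_simps)
    qed
    finally have 2: "norm (E j z) \<le> exp 2 / d ^ 4 * exp (- (\<Sum>k\<in>S j. w k z))" .
    have 3: "norm ((of_real (\<delta> j) / (1 - cnj (l j) * z))\<^sup>2) = w j z"
      using \<delta>[OF j] by (simp add: w_def norm_divide norm_power)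
    have "norm (F j z) = norm (B j z / B j (l j)) * w j z * norm (E j z)"
      unfolding F_def norm_mult 3 by simp
    also have "\<dots> \<le> 1 / d * w j z * (exp 2 / d ^ 4 * exp (- (\<Sum>k\<in>S j. w k z)))"
      using 1 2 d by (intro mult_mono) (auto simp: w_def)
    also have "\<dots> = exp 2 / d ^ 5 * (w j z * exp (- (\<Sum>k\<in>S j. w k z)))"
      by (simp add: field_simps power_numeral_reduce)
    finally show ?thesis by (simp add: S_def)
  qed
  show thesis
  proof
    show "(\<lambda>z. \<Sum>j\<in>A. a j * F j z) holomorphic_on unit_disc"
      using holF by (intro holomorphic_intros) auto
  next
    fix z :: complex assume z: "norm z < 1"
    have "norm (\<Sum>j\<in>A. a j * F j z) \<le> (\<Sum>j\<in>A. norm (a j * F j z))" by (rule norm_sum)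
    also have "\<dots> \<le> (\<Sum>j\<in>A. norm (F j z))"
      using a by (intro sum_mono) (simp add: norm_mult mult_left_le_one_le)
    also have "\<dots> \<le> (\<Sum>j\<in>A. exp 2 / d ^ 5 * (w j z * exp (- (\<Sum>k | k \<in> A \<and> norm (l j) \<le> norm (l k). w k z))))"
      using normF z by (intro sum_mono) auto
    also have "\<dots> = exp 2 / d ^ 5 * (\<Sum>j\<in>A. w j z * exp (- (\<Sum>k | k \<in> A \<and> norm (l j) \<le> norm (l k). w k z)))"
      by (simp add: sum_distrib_left)
    also have "\<dots> \<le> exp 2 / d ^ 5 * 1"
    proof (rule mult_left_mono)
      have "(\<Sum>j\<in>A. w j z * exp (- (\<Sum>k | k \<in> A \<and> norm (l j) \<le> norm (l k). w k z)))
          \<le> 1 - exp (- (\<Sum>k\<in>A. w k z))"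
        using A by (intro sum_weights_exp_le) (auto simp: w_def)
      then show "(\<Sum>j\<in>A. w j z * exp (- (\<Sum>k | k \<in> A \<and> norm (l j) \<le> norm (l k). w k z))) \<le> 1"
        using exp_gt_zero[of "- (\<Sum>k\<in>A. w k z)"] by linarith
    qed (use d in auto)
    finally show "norm (\<Sum>j\<in>A. a j * F j z) \<le> exp 2 / d ^ 5" by simp
  next
    fix i assume i: "i \<in> A"
    have "(\<Sum>j\<in>A. a j * F j (l i)) = (\<Sum>j\<in>A. if j = i then a i else 0)"
      using F_diag F_off i by (intro sum.cong) auto
    then show "(\<Sum>j\<in>A. a j * F j (l i)) = a i" using A i by simp
  qed
qed

text \<open>
A normal families argument reduces interpolation with a norm bound to finite sets of nodes.
\<close>

lemma interpolation_limit:
  fixes l a :: "nat \<Rightarrow> complex"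
  assumes l: "l \<in> I \<rightarrow> unit_disc"
    and fin: "\<And>A. finite A \<Longrightarrow> A \<subseteq> I \<Longrightarrow>
      \<exists>f. f holomorphic_on unit_disc \<and> (\<forall>z\<in>unit_disc. norm (f z) \<le> M) \<and> (\<forall>j\<in>A. f (l j) = a j)"
  shows "\<exists>f. f holomorphic_on unit_disc \<and> (\<forall>z\<in>unit_disc. norm (f z) \<le> M) \<and> (\<forall>j\<in>I. f (l j) = a j)"
proof -
  define HH where "HH = {f. f holomorphic_on unit_disc \<and> (\<forall>z\<in>unit_disc. norm (f z) \<le> M)}"
  have "\<forall>n. \<exists>f. f \<in> HH \<and> (\<forall>j\<in>I \<inter> {..n}. f (l j) = a j)"
    using fin by (auto simp: HH_def)
  then obtain f where f: "\<And>n. f n \<in> HH" "\<And>n j. j \<in> I \<Longrightarrow> j \<le> n \<Longrightarrow> f n (l j) = a j"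
    by (metis Int_iff atMost_iff)
  obtain g r where g: "g holomorphic_on unit_disc" "strict_mono (r :: nat \<Rightarrow> nat)"
     and lim: "\<And>x. x \<in> unit_disc \<Longrightarrow> (\<lambda>n. f (r n) x) \<longlonglongrightarrow> g x"
  proof (rule Montel[of unit_disc HH f])
    fix K :: "complex set" assume "K \<subseteq> unit_disc"
    then show "\<exists>B. \<forall>h\<in>HH. \<forall>z\<in>K. norm (h z) \<le> B" unfolding HH_def by blast
  qed (use f in \<open>auto simp: HH_def\<close>)
  have "norm (g z) \<le> M" if "z \<in> unit_disc" for z
  proof (rule LIMSEQ_le_const2)
    show "(\<lambda>n. norm (f (r n) z)) \<longlonglongrightarrow> norm (g z)" using lim[OF that] by (rule tendsto_norm)
    show "\<exists>N. \<forall>n\<ge>N. norm (f (r n) z) \<le> M" using f(1) that by (auto simp: HH_def)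
  qed
  moreover have "g (l j) = a j" if j: "j \<in> I" for j
  proof (rule LIMSEQ_unique)
    show "(\<lambda>n. f (r n) (l j)) \<longlonglongrightarrow> g (l j)" using lim[of "l j"] l j by blast
    have "f (r n) (l j) = a j" if "n \<ge> j" for n
      using f(2)[OF j] seq_suble[OF g(2), of n] that by auto
    then show "(\<lambda>n. f (r n) (l j)) \<longlonglongrightarrow> a j"
      by (intro tendsto_eventually) (auto simp: eventually_at_top_linorder)
  qed
  ultimately show ?thesis using g(1) by blast
qed

text \<open>
Finite subproducts express that the infinite products are bounded below, without presupposing
convergence and for finite index sets as well.
\<close>

definition uniformly_separated :: "nat set \<Rightarrow> (nat \<Rightarrow> complex) \<Rightarrow> bool" where
  "uniformly_separated I l \<longleftrightarrow>
     (\<exists>d>0. \<forall>j\<in>I. \<forall>A. finite A \<longrightarrow> A \<subseteq> I - {j} \<longrightarrow> d \<le> (\<Prod>k\<in>A. pseudohyp (l j) (l k)))"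

lemma uniformly_separated_imp_carleson_seq:
  assumes l: "l \<in> I \<rightarrow> unit_disc" and "uniformly_separated I l"
  shows "carleson_seq I l"
proof -
  obtain d where d: "d > 0"
    and "\<forall>j\<in>I. \<forall>A. finite A \<longrightarrow> A \<subseteq> I - {j} \<longrightarrow> d \<le> (\<Prod>k\<in>A. pseudohyp (l j) (l k))"
    using assms(2) unfolding uniformly_separated_def by (elim exE conjE that)
  note sep = this(2)[rule_format]
  show ?thesis unfolding carleson_seq_def
  proof (intro conjI allI impI)
    fix a :: "nat \<Rightarrow> complex" assume "bounded (a ` I)"
    then obtain C where C: "C > 0" "\<And>j. j \<in> I \<Longrightarrow> norm (a j) \<le> C"
      by (auto simp: bounded_pos)
    have "\<exists>f. f holomorphic_on unit_disc \<and> (\<forall>z\<in>unit_disc. norm (f z) \<le> exp 2 / d ^ 5) \<and>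
              (\<forall>j\<in>I. f (l j) = a j / C)"
    proof (rule interpolation_limit[OF l])
      fix A assume A: "finite A" "A \<subseteq> I"
      show "\<exists>f. f holomorphic_on unit_disc \<and> (\<forall>z\<in>unit_disc. norm (f z) \<le> exp 2 / d ^ 5) \<and>
              (\<forall>j\<in>A. f (l j) = a j / C)"
        by (rule finite_interpolation[of A l d "\<lambda>j. a j / C"])
           (use A l d sep C in \<open>auto simp: norm_divide subset_iff Pi_iff\<close>)
    qed
    then obtain f where f: "f holomorphic_on unit_disc"
       "\<And>z. z \<in> unit_disc \<Longrightarrow> norm (f z) \<le> exp 2 / d ^ 5" "\<And>j. j \<in> I \<Longrightarrow> f (l j) = a j / C"
      by blast
    have "bounded ((\<lambda>z. C * f z) ` unit_disc)"
      using f(2) C(1) by (auto simp: bounded_iff norm_mult intro!: exI[of _ "C * (exp 2 / d ^ 5)"] mult_left_mono)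
    then have "(\<lambda>z. C * f z) \<in> H_infinity"
      using f(1) holomorphic_on_mult[of "\<lambda>_. of_real C" unit_disc f] by (simp add: H_infinity_def)
    then show "\<exists>f\<in>H_infinity. \<forall>j\<in>I. a j = f (l j)"
      using f(3) C(1) by (intro bexI[of _ "\<lambda>z. C * f z"]) auto
  qed (rule l)
qed

text \<open>
The Schwarz lemma, transported by a Moebius map: dividing by a Blaschke factor does not increase
the supremum norm.
\<close>

lemma divide_out_zero:
  assumes f: "f holomorphic_on unit_disc" "\<And>z. norm z < 1 \<Longrightarrow> norm (f z) \<le> M"
    and a: "norm a < 1" "f a = 0"
  obtains g where "g holomorphic_on unit_disc" "\<And>z. norm z < 1 \<Longrightarrow> norm (g z) \<le> M"
    "\<And>z. norm z < 1 \<Longrightarrow> f z = Moebius_function 0 a z * g z"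
proof -
  define h where "h z = f (Moebius_function 0 (-a) z)" for z
  have "h = f \<circ> Moebius_function 0 (-a)" by (auto simp: h_def)
  moreover have "(f \<circ> Moebius_function 0 (-a)) holomorphic_on unit_disc"
    using f(1) a Moebius_function_norm_lt_1[of "-a"]
    by (intro holomorphic_on_compose_gen[of _ _ _ unit_disc] Moebius_function_holomorphic) auto
  ultimately have holh: "h holomorphic_on unit_disc" by simp
  have h0: "h 0 = 0" using a by (simp add: h_def Moebius_function_of_zero)
  obtain g where g: "g holomorphic_on unit_disc" "\<And>z. norm z < 1 \<Longrightarrow> h z = z * g z" "deriv h 0 = g 0"
    using Schwarz3[OF holh h0] by metis
  have normg: "norm (g z) \<le> M" if z: "norm z < 1" for z
  proof (rule dense_ge)
    fix N assume N: "M < N"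
    have "0 \<le> M" using f(2)[of a] a by simp
    then have N0: "N > 0" using N by simp
    define h' where "h' z = h z / of_real N" for z
    have hol: "h' holomorphic_on unit_disc" unfolding h'_def[abs_def] using N0
      by (intro holomorphic_intros holh) auto
    have lt: "norm (h' z) < 1" if "norm z < 1" for z
      using f(2)[OF Moebius_function_norm_lt_1[of "-a" z 0]] a that N N0
      by (simp add: h'_def h_def norm_divide)
    \<comment> \<open>The Schwarz lemma needs a strict bound, hence the detour over \<open>N > M\<close>.\<close>
    show "norm (g z) \<le> N"
    proof (cases "z = 0")
      case False
      have "norm (h' z) \<le> norm z" by (rule Schwarz_Lemma(1)[OF hol _ lt z]) (simp add: h'_def h0)
      then show ?thesis using g(2)[OF z] N0 False by (simp add: h'_def norm_divide norm_mult field_simps)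
    next
      case True
      have "norm (deriv h' 0) \<le> 1" by (rule Schwarz_Lemma(2)[OF hol _ lt z]) (simp add: h'_def h0)
      moreover have "deriv h' 0 = deriv h 0 / N"
        unfolding h'_def[abs_def] using N0 holh
        by (intro deriv_cdivide_right holomorphic_on_imp_differentiable_at[of _ unit_disc]) auto
      ultimately show ?thesis using g(3) True N0 by (simp add: norm_divide field_simps)
    qed
  qed
  show thesis
  proof
    have "(g \<circ> Moebius_function 0 a) holomorphic_on unit_disc"
      using g(1) a Moebius_function_norm_lt_1[of a]
      by (intro holomorphic_on_compose_gen[of _ _ _ unit_disc] Moebius_function_holomorphic) auto
    then show "(\<lambda>z. g (Moebius_function 0 a z)) holomorphic_on unit_disc" by (simp add: o_def)
    show "norm (g (Moebius_function 0 a z)) \<le> M" if "norm z < 1" for z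
      using normg Moebius_function_norm_lt_1 a that by blast
    show "f z = Moebius_function 0 a z * g (Moebius_function 0 a z)" if "norm z < 1" for z
      using g(2)[OF Moebius_function_norm_lt_1[OF a(1) that, of 0]] a that
      by (simp add: h_def Moebius_function_inverse)
  qed
qed

lemma norm_le_prod_pseudohyp:
  assumes "finite A" "inj_on l A" "\<And>k. k \<in> A \<Longrightarrow> norm (l k) < 1"
    and "f holomorphic_on unit_disc" "\<And>z. norm z < 1 \<Longrightarrow> norm (f z) \<le> M"
    and "\<And>k. k \<in> A \<Longrightarrow> f (l k) = 0" "norm z < 1"
  shows "norm (f z) \<le> M * (\<Prod>k\<in>A. pseudohyp z (l k))"
  using assms
proof (induction A arbitrary: f rule: finite_induct)
  case empty
  then show ?case by simp
next
  case (insert k A)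
  obtain g where g: "g holomorphic_on unit_disc" "\<And>z. norm z < 1 \<Longrightarrow> norm (g z) \<le> M"
    "\<And>z. norm z < 1 \<Longrightarrow> f z = Moebius_function 0 (l k) z * g z"
    using divide_out_zero[of f M "l k"] insert.prems by auto
  have "g (l i) = 0" if i: "i \<in> A" for i
  proof -
    have "Moebius_function 0 (l k) (l i) * g (l i) = 0"
      using g(3)[of "l i"] insert.prems i by auto
    moreover have "l k \<noteq> l i" using insert.prems(1) insert.hyps i by (auto simp: inj_on_def)
    then have "norm (Moebius_function 0 (l k) (l i)) \<noteq> 0"
      using insert.prems i by (simp add: norm_Moebius_function_0 pseudohyp_eq_0_iff del: norm_eq_zero)
    ultimately show ?thesis by simp
  qed
  then have "norm (g z) \<le> M * (\<Prod>k\<in>A. pseudohyp z (l k))"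
    using insert.prems by (intro insert.IH g) auto
  moreover have "norm (f z) = pseudohyp z (l k) * norm (g z)"
    using g(3)[of z] insert.prems by (simp add: norm_mult norm_Moebius_function_0 pseudohyp_commute)
  ultimately have "norm (f z) \<le> pseudohyp z (l k) * (M * (\<Prod>k\<in>A. pseudohyp z (l k)))"
    by (auto intro!: mult_left_mono)
  then show ?case using insert.hyps by (simp add: mult_ac)
qed

text \<open>
A gliding hump argument. If the functions that are 1 at one node and 0 at the others cannot be
chosen with a common bound, then data prescribed on finitely many nodes can always be prolonged to
a larger finite set of nodes so that no interpolating function is bounded by \<open>n\<close>: otherwise, after
passing to the limit over finite sets, the difference of two prolongations that differ at a single
node would be a bounded peak function. Doing this for every \<open>n\<close> in turn produces bounded data that no
bounded function interpolates.
\<close>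

lemma carleson_seq_uniform_bound:
  assumes car: "carleson_seq I l"
  shows "\<exists>M. \<forall>j\<in>I. \<exists>f. f holomorphic_on unit_disc \<and> (\<forall>z\<in>unit_disc. norm (f z) \<le> M) \<and>
            (\<forall>k\<in>I. f (l k) = (if k = j then 1 else 0))"
proof (rule ccontr)
  assume contr: "\<not> ?thesis"
  define good where "good M A a \<longleftrightarrow> (\<exists>f. f holomorphic_on unit_disc \<and>
      (\<forall>z\<in>unit_disc. norm (f z) \<le> M) \<and> (\<forall>k\<in>A. f (l k) = a k))"
    for M :: real and A and a :: "nat \<Rightarrow> complex"
  have l: "l \<in> I \<rightarrow> unit_disc" using car by (auto simp: carleson_seq_def)
  have good_ex: "\<exists>M. good M I a" if "\<And>j. norm (a j) \<le> 1" for a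
  proof -
    have "bounded (a ` I)" using that by (auto simp: bounded_iff)
    then obtain f where f: "f \<in> H_infinity" "\<forall>j\<in>I. a j = f (l j)"
      using car by (auto simp: carleson_seq_def)
    then obtain M where "\<forall>z\<in>unit_disc. norm (f z) \<le> M" by (auto simp: H_infinity_def bounded_iff)
    then show ?thesis using f unfolding good_def by (auto simp: H_infinity_def)
  qed
  have good_mono: "good M' A' a" if "good M A a" "M \<le> M'" "A' \<subseteq> A" for M M' A A' a
    using that unfolding good_def by (meson order_trans subsetD)
  have good_cong: "good M A a \<longleftrightarrow> good M A b" if "\<And>k. k \<in> A \<Longrightarrow> a k = b k" for M A a b
    using that unfolding good_def by auto
  have contr': "\<exists>j\<in>I. \<not> good M I (\<lambda>k. if k = j then 1 else 0)" for M
    using contr unfolding good_def by auto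
  have step: "\<exists>F' a'. finite F' \<and> F' \<subseteq> I \<and> (\<forall>j. norm (a' j) \<le> 1) \<and> F \<subseteq> F' \<and>
               (\<forall>j\<in>F. a' j = a j) \<and> \<not> good (real n) F' a'"
    if F: "finite F" "F \<subseteq> I" and a: "\<forall>j. norm (a j) \<le> 1" for F a n
  proof (rule ccontr)
    assume neg: "\<not> ?thesis"
    have all: "good n I a'" if a': "\<forall>j. norm (a' j) \<le> 1" "\<forall>j\<in>F. a' j = a j" for a'
      unfolding good_def
    proof (rule interpolation_limit[OF l])
      fix A assume A: "finite A" "A \<subseteq> I"
      have "good n (A \<union> F) a'" using neg F A a' by (metis Un_upper2 finite_UnI le_sup_iff)
      then have "good n A a'" by (rule good_mono) auto
      then show "\<exists>f. f holomorphic_on unit_disc \<and> (\<forall>z\<in>unit_disc. norm (f z) \<le> n) \<and> (\<forall>j\<in>A. f (l j) = a' j)"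
        unfolding good_def .
    qed
    have out: "good (2 * n) I (\<lambda>k. if k = j then 1 else 0)" if "j \<in> I - F" for j
    proof -
      have "good n I (\<lambda>k. if k \<in> F then a k else if k = j then 1 else 0)"
           "good n I (\<lambda>k. if k \<in> F then a k else 0)"
        using a by (auto intro!: all)
      then obtain f g where
        f: "f holomorphic_on unit_disc" "\<forall>z\<in>unit_disc. norm (f z) \<le> n"
           "\<forall>k\<in>I. f (l k) = (if k \<in> F then a k else if k = j then 1 else 0)"
        and g: "g holomorphic_on unit_disc" "\<forall>z\<in>unit_disc. norm (g z) \<le> n"
           "\<forall>k\<in>I. g (l k) = (if k \<in> F then a k else 0)"
        unfolding good_def by blast
      have "norm (f z - g z) \<le> 2 * real n" if "z \<in> unit_disc" for z
        using norm_triangle_ineq4[of "f z" "g z"] f(2) g(2) that by fastforce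
      moreover have "\<forall>k\<in>I. f (l k) - g (l k) = (if k = j then 1 else 0)" using f(3) g(3) that by auto
      ultimately show ?thesis unfolding good_def using f(1) g(1)
        by (intro exI[of _ "\<lambda>z. f z - g z"]) (auto intro!: holomorphic_intros)
    qed
    have "\<exists>M. good M I (\<lambda>k. if k = j then 1 else 0)" for j by (rule good_ex) auto
    then obtain m where m: "\<And>j. good (m j) I (\<lambda>k. if k = j then 1 else 0)" by metis
    define M where "M = Max (insert (2 * real n) (m ` F))"
    have "good M I (\<lambda>k. if k = j then 1 else 0)" if "j \<in> I" for j
    proof (cases "j \<in> F")
      case True
      then show ?thesis using F(1) by (intro good_mono[OF m]) (auto simp: M_def)
    next
      case False
      then show ?thesis using F(1) that by (intro good_mono[OF out]) (auto simp: M_def)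
    qed
    then show False using contr'[of M] by auto
  qed
  define P where "P x \<longleftrightarrow> finite (fst x) \<and> fst x \<subseteq> I \<and> (\<forall>j. norm (snd x j) \<le> 1)"
    for x :: "nat set \<times> (nat \<Rightarrow> complex)"
  define Q where "Q n x y \<longleftrightarrow> fst x \<subseteq> fst y \<and> (\<forall>j\<in>fst x. snd y j = snd x j) \<and> \<not> good (real n) (fst y) (snd y)"
    for n and x y :: "nat set \<times> (nat \<Rightarrow> complex)"
  have "\<exists>f. \<forall>n. P (f n) \<and> Q n (f n) (f (Suc n))"
  proof (rule dependent_nat_choice)
    show "\<exists>x. P x" by (intro exI[of _ "({}, \<lambda>_. 0)"]) (auto simp: P_def)
  next
    fix x n assume "P x"
    then show "\<exists>y. P y \<and> Q n x y" using step[of "fst x" "snd x" n] by (auto simp: P_def Q_def)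
  qed
  then obtain f where f: "\<And>n. P (f n)" "\<And>n. Q n (f n) (f (Suc n))" by blast
  define F a where "F n = fst (f n)" and "a n = snd (f n)" for n
  have P: "F n \<subseteq> I" "norm (a n j) \<le> 1" and Q: "F n \<subseteq> F (Suc n)" "j \<in> F n \<Longrightarrow> a (Suc n) j = a n j"
    "\<not> good (real n) (F (Suc n)) (a (Suc n))" for n j
    using f(1)[of n] f(2)[of n] by (auto simp: F_def a_def P_def Q_def)
  have FF: "F m \<subseteq> F n \<and> (\<forall>j\<in>F m. a n j = a m j)" if "m \<le> n" for m n
    using that
  proof (induction n rule: dec_induct)
    case (step n)
    then show ?case using Q(1)[of n] Q(2)[of _ n] by (auto simp: subset_iff)
  qed auto
  \<comment> \<open>The stages agree where they are defined, so the first stage that prescribes a value at \<open>j\<close> decides.\<close>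
  define b where "b j = a (LEAST n. j \<in> F n) j" for j
  have b: "b j = a n j" if "j \<in> F n" for j n
  proof -
    have "(LEAST n. j \<in> F n) \<le> n" using that by (rule Least_le)
    moreover have "j \<in> F (LEAST n. j \<in> F n)" using that by (rule LeastI)
    ultimately show ?thesis using FF by (simp add: b_def)
  qed
  have "\<exists>M. good M I b" using P(2) by (intro good_ex) (simp add: b_def)
  then obtain M where M: "good M I b" by blast
  obtain n where n: "M \<le> real n" using real_arch_simple by blast
  have "good n (F (Suc n)) b" using good_mono[OF M n] P(1) by blast
  then have "good n (F (Suc n)) (a (Suc n))" using good_cong[of "F (Suc n)" b "a (Suc n)" n] b by blast
  then show False using Q(3) by blast
qed

text \<open>
A function that is 1 at \<open>l j\<close>, vanishes at the points \<open>l k\<close> with \<open>k \<in> A\<close> and is bounded by \<open>M\<close>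
is at most \<open>M\<close> times the Blaschke product of these zeros, so that product is at least \<open>1/M\<close> at \<open>l j\<close>.
\<close>

lemma carleson_seq_imp_uniformly_separated:
  assumes car: "carleson_seq I l"
  shows "uniformly_separated I l"
proof -
  have l: "\<And>j. j \<in> I \<Longrightarrow> norm (l j) < 1" using car by (auto simp: carleson_seq_def)
  obtain M where M: "\<And>j. j \<in> I \<Longrightarrow> \<exists>f. f holomorphic_on unit_disc \<and> (\<forall>z\<in>unit_disc. norm (f z) \<le> M) \<and>
            (\<forall>k\<in>I. f (l k) = (if k = j then 1 else 0))"
    using carleson_seq_uniform_bound[OF car] by blast
  have inj: "inj_on l I"
  proof (rule inj_onI, rule ccontr)
    fix i j assume ij: "i \<in> I" "j \<in> I" "l i = l j" "i \<noteq> j"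
    then show False using M[of i] by (metis zero_neq_one)
  qed
  have "1 / max M 1 \<le> (\<Prod>k\<in>A. pseudohyp (l j) (l k))" if j: "j \<in> I" "finite A" "A \<subseteq> I - {j}" for j A
  proof -
    obtain f where f: "f holomorphic_on unit_disc" "\<And>z. z \<in> unit_disc \<Longrightarrow> norm (f z) \<le> M"
        "\<And>k. k \<in> I \<Longrightarrow> f (l k) = (if k = j then 1 else 0)" using M[OF j(1)] by blast
    have "f (l k) = 0" if "k \<in> A" for k
    proof -
      have "k \<in> I" "k \<noteq> j" using j(3) that by blast+
      then show ?thesis using f(3) by simp
    qed
    then have "norm (f (l j)) \<le> max M 1 * (\<Prod>k\<in>A. pseudohyp (l j) (l k))"
      using j l f inj by (intro norm_le_prod_pseudohyp) (auto intro: inj_on_subset max.coboundedI1)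
    then show ?thesis using f(3) j by (simp add: field_simps)
  qed
  then show ?thesis unfolding uniformly_separated_def
    by (intro exI[of _ "1 / max M 1"]) auto
qed

theorem carleson_seq_iff_uniformly_separated:
  assumes "l \<in> I \<rightarrow> unit_disc"
  shows "carleson_seq I l \<longleftrightarrow> uniformly_separated I l"
  using uniformly_separated_imp_carleson_seq carleson_seq_imp_uniformly_separated assms by blast

lemma uniformly_separated_imp_sum_bounded:
  assumes "uniformly_separated I l" and l: "l \<in> I \<rightarrow> unit_disc"
  obtains e S where "e > 0" "\<And>j k. j \<in> I \<Longrightarrow> k \<in> I \<Longrightarrow> j \<noteq> k \<Longrightarrow> e \<le> pseudohyp (l j) (l k)"
    "\<And>j A. j \<in> I \<Longrightarrow> finite A \<Longrightarrow> A \<subseteq> I - {j} \<Longrightarrow> (\<Sum>k\<in>A. 1 - (pseudohyp (l j) (l k))\<^sup>2) \<le> S"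
proof -
  obtain d where d: "d > 0"
    and "\<forall>j\<in>I. \<forall>A. finite A \<longrightarrow> A \<subseteq> I - {j} \<longrightarrow> d \<le> (\<Prod>k\<in>A. pseudohyp (l j) (l k))"
    using assms(1) unfolding uniformly_separated_def by (elim exE conjE that)
  note sep = this(2)[rule_format]
  show thesis
  proof (rule that[OF d])
    show "d \<le> pseudohyp (l j) (l k)" if "j \<in> I" "k \<in> I" "j \<noteq> k" for j k
      using sep[of j "{k}"] that by auto
    show "(\<Sum>k\<in>A. 1 - (pseudohyp (l j) (l k))\<^sup>2) \<le> - 2 * ln d"
      if "j \<in> I" "finite A" "A \<subseteq> I - {j}" for j A
      using that sep d by (intro sum_one_minus_sq_le_ln_prod) auto
  qed
qed

text \<open>
Separation allows \<open>- ln r\<^sup>2 \<le> (1 - r\<^sup>2) / r\<^sup>2\<close> to be bounded by a multiple of \<open>1 - r\<^sup>2\<close>, which turns the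
bound on the sums into a lower bound for the products.
\<close>

lemma sum_bounded_imp_uniformly_separated:
  assumes e: "e > 0" and sep: "\<And>j k. j \<in> I \<Longrightarrow> k \<in> I \<Longrightarrow> j \<noteq> k \<Longrightarrow> e \<le> pseudohyp (l j) (l k)"
    and S: "\<And>j A. j \<in> I \<Longrightarrow> finite A \<Longrightarrow> A \<subseteq> I - {j} \<Longrightarrow> (\<Sum>k\<in>A. 1 - (pseudohyp (l j) (l k))\<^sup>2) \<le> S"
    and l: "l \<in> I \<rightarrow> unit_disc"
  shows "uniformly_separated I l"
proof -
  have "exp (- S / (2 * e\<^sup>2)) \<le> (\<Prod>k\<in>A. pseudohyp (l j) (l k))"
    if j: "j \<in> I" "finite A" "A \<subseteq> I - {j}" for j A
  proof -
    have pos: "e \<le> pseudohyp (l j) (l k)" if "k \<in> A" for k using sep[of j k] j that by auto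
    have ln_ge: "- (1 - r\<^sup>2) / (2 * e\<^sup>2) \<le> ln r" if r: "e \<le> r" "r < 1" for r :: real
    proof -
      have r0: "r > 0" using e r by simp
      have "ln (1 / r\<^sup>2) \<le> 1 / r\<^sup>2 - 1" using r0 by (intro ln_le_minus_one) auto
      then have "- 2 * ln r \<le> (1 - r\<^sup>2) / r\<^sup>2" using r0 by (simp add: ln_div ln_realpow diff_divide_distrib)
      also have "\<dots> \<le> (1 - r\<^sup>2) / e\<^sup>2"
        using r e r0 by (intro divide_left_mono power_mono) (auto simp: power_le_one)
      finally have "- ((1 - r\<^sup>2) / e\<^sup>2) / 2 \<le> ln r" by simp
      moreover have "- ((1 - r\<^sup>2) / e\<^sup>2) / 2 = - (1 - r\<^sup>2) / (2 * e\<^sup>2)"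
        by (simp only: minus_divide_left divide_divide_eq_left mult.commute[of 2])
      ultimately show ?thesis by (simp only:)
    qed
    have "- S / (2 * e\<^sup>2) \<le> - (\<Sum>k\<in>A. 1 - (pseudohyp (l j) (l k))\<^sup>2) / (2 * e\<^sup>2)"
      using S[OF j] e by (intro divide_right_mono) auto
    also have "\<dots> = (\<Sum>k\<in>A. - (1 - (pseudohyp (l j) (l k))\<^sup>2) / (2 * e\<^sup>2))"
      by (simp only: sum_divide_distrib sum_negf[symmetric])
    also have "\<dots> \<le> (\<Sum>k\<in>A. ln (pseudohyp (l j) (l k)))"
      using pos l j by (intro sum_mono ln_ge pseudohyp_lt_1) auto
    also have "\<dots> = ln (\<Prod>k\<in>A. pseudohyp (l j) (l k))"
      using pos e j by (subst ln_prod) (auto dest: pos intro: less_le_trans)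
    finally have "exp (- S / (2 * e\<^sup>2)) \<le> exp (ln (\<Prod>k\<in>A. pseudohyp (l j) (l k)))" by simp
    also have "\<dots> = (\<Prod>k\<in>A. pseudohyp (l j) (l k))"
      using pos e by (intro exp_ln prod_pos) (auto dest: pos intro: less_le_trans)
    finally show ?thesis .
  qed
  then show ?thesis unfolding uniformly_separated_def by (intro exI[of _ "exp (- S / (2 * e\<^sup>2))"]) auto
qed

section \<open>Hoelder estimates for maps with bounded steps\<close>

text \<open>
The trace of \<open>\<rho>\<close>-uniform continuity at a single scale. It is all that the estimates below use, and
\<open>d\<close> is unchanged when \<open>F\<close> is composed with Moebius maps of the disc on either side, which is what
makes the resulting constants uniform over all such compositions.
\<close>

definition step_bounded :: "real \<Rightarrow> (complex \<Rightarrow> complex) \<Rightarrow> bool" where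
  "step_bounded d F \<longleftrightarrow> 0 < d \<and> F \<in> unit_disc \<rightarrow> unit_disc \<and>
     (\<forall>z\<in>unit_disc. \<forall>w\<in>unit_disc. pseudohyp z w < d \<longrightarrow> pseudohyp (F z) (F w) \<le> 1/2)"

lemma bdry_dist_pos_iff: "0 < bdry_dist z \<longleftrightarrow> norm z < 1"
  by (simp add: bdry_dist_def)

lemma pseudohyp_le_divide_bdry_dist:
  assumes "norm z < 1" "norm w < 1"
  shows "pseudohyp z w \<le> norm (z - w) / bdry_dist z"
proof -
  have "bdry_dist z \<le> norm (1 - cnj z * w)" "0 < bdry_dist z"
    using bdry_dist_le_norm_one_minus(1)[of z w] assms by (simp_all add: bdry_dist_pos_iff)
  then show ?thesis unfolding pseudohyp_def norm_divide
    by (intro divide_left_mono mult_pos_pos norm_ge_zero) (assumption | linarith)+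
qed

text \<open>
If a segment stays at distance at least \<open>\<tau>\<close> from the circle and is shorter than \<open>N d \<tau>\<close>, then each
of its \<open>N\<close> equal parts has endpoints at \<open>\<rho>\<close>-distance below \<open>d\<close>. Each part changes \<open>\<delta> \<circ> F\<close> by a factor of
at most 3 and moves the image by at most \<open>2 \<delta>(F x)\<close>.
\<close>

lemma step_bounded_segment:
  assumes F: "step_bounded d F" and N: "norm (p - q) < real N * d * \<tau>" and \<tau>: "0 < \<tau>"
    and seg: "\<And>x. x \<in> closed_segment p q \<Longrightarrow> \<tau> \<le> bdry_dist x"
  shows "bdry_dist (F p) \<le> 3 ^ N * bdry_dist (F q)"
    and "(\<And>x. x \<in> closed_segment p q \<Longrightarrow> bdry_dist (F x) \<le> s) \<Longrightarrow> norm (F p - F q) \<le> 2 * real N * s"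
proof -
  have d: "0 < d" using F by (simp add: step_bounded_def)
  have "real N * d * \<tau> > 0" using N norm_ge_zero[of "p - q"] by linarith
  then have N0: "real N > 0" using d \<tau> by (simp add: zero_less_mult_iff)
  define x where "x i = p + (real i / real N) *\<^sub>R (q - p)" for i
  have xseg: "x i \<in> closed_segment p q" if "i \<le> N" for i
    unfolding x_def in_segment using that N0
    by (intro exI[of _ "real i / real N"]) (auto simp: algebra_simps)
  have xD: "norm (x i) < 1" "\<tau> \<le> bdry_dist (x i)" if "i \<le> N" for i
    using seg[OF xseg[OF that]] \<tau> by (auto simp: bdry_dist_def)
  have FD: "norm (F (x i)) < 1" if "i \<le> N" for i
    using F xD(1)[OF that] by (auto simp: step_bounded_def Pi_iff)
  have step: "pseudohyp (F (x i)) (F (x (Suc i))) \<le> 1/2" if i: "Suc i \<le> N" for i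
  proof -
    have "x i - x (Suc i) = - ((1 / real N) *\<^sub>R (q - p))"
      unfolding x_def by (simp add: add_divide_distrib scaleR_add_left)
    then have "norm (x i - x (Suc i)) = norm (p - q) / real N"
      by (simp add: norm_minus_commute)
    also have "\<dots> < d * \<tau>" using N N0 by (simp add: field_simps)
    also have "\<dots> \<le> d * bdry_dist (x i)" using xD(2)[of i] i d by simp
    finally have "norm (x i - x (Suc i)) / bdry_dist (x i) < d"
      using xD(1)[of i] i by (simp add: divide_less_eq bdry_dist_pos_iff)
    then have "pseudohyp (x i) (x (Suc i)) < d"
      using pseudohyp_le_divide_bdry_dist[of "x i" "x (Suc i)"] xD(1) i by fastforce
    then show ?thesis using F xD(1) i by (auto simp: step_bounded_def)
  qed
  have x0: "x 0 = p" by (simp add: x_def)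
  have xN: "x N = q" using N0 by (simp add: x_def)
  have "bdry_dist (F p) \<le> 3 ^ i * bdry_dist (F (x i))" if "i \<le> N" for i
    using that
  proof (induction i)
    case (Suc i)
    have "bdry_dist (F (x i)) \<le> 3 * bdry_dist (F (x (Suc i)))"
      using step[of i] FD Suc.prems
      by (intro pseudohyp_half_imp(2)) (auto simp: pseudohyp_commute)
    then show ?case using Suc by (auto intro: order_trans)
  qed (simp add: x0)
  from this[of N] show "bdry_dist (F p) \<le> 3 ^ N * bdry_dist (F q)" by (simp add: xN)
  assume s: "\<And>x. x \<in> closed_segment p q \<Longrightarrow> bdry_dist (F x) \<le> s"
  have "norm (F p - F (x i)) \<le> 2 * real i * s" if "i \<le> N" for i
    using that
  proof (induction i)
    case (Suc i)
    have "norm (F (x i) - F (x (Suc i))) \<le> 2 * bdry_dist (F (x i))"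
      using step[of i] FD Suc.prems by (intro pseudohyp_half_imp(1)) auto
    also have "\<dots> \<le> 2 * s" using s xseg Suc.prems by simp
    finally have "norm (F (x i) - F (x (Suc i))) \<le> 2 * s" .
    moreover have "norm (F p - F (x (Suc i))) \<le> norm (F p - F (x i)) + norm (F (x i) - F (x (Suc i)))"
      using norm_triangle_ineq[of "F p - F (x i)" "F (x i) - F (x (Suc i))"] by simp
    ultimately show ?case using Suc by (simp add: algebra_simps)
  qed (simp add: x0)
  from this[of N] show "norm (F p - F q) \<le> 2 * real N * s" by (simp add: xN)
qed

lemma bdry_dist_on_segment:
  assumes "x \<in> closed_segment p q" "norm p \<le> r" "norm q \<le> r"
  shows "1 - r \<le> bdry_dist x"
proof -
  have "closed_segment p q \<subseteq> cball 0 r"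
    using assms by (intro closed_segment_subset) auto
  then show ?thesis using assms by (auto simp: bdry_dist_def)
qed

lemma bdry_dist_growth_dyadic:
  assumes F: "step_bounded d F" and N: "1 < real N * d"
  shows "norm z < 1 \<Longrightarrow> (1/2) ^ k \<le> bdry_dist z \<Longrightarrow> bdry_dist (F 0) \<le> 3 ^ (N * k) * bdry_dist (F z)"
proof (induction k arbitrary: z)
  case 0
  then have "z = 0" by (simp add: bdry_dist_def)
  then show ?case by simp
next
  case (Suc k)
  have Fz: "0 \<le> bdry_dist (F z)"
    using F Suc.prems(1) by (auto simp: step_bounded_def Pi_iff bdry_dist_def intro: less_imp_le)
  define c :: real where "c = (1/2) ^ k"
  have c: "0 < c" "c \<le> 1" by (auto simp: c_def power_le_one)
  show ?case
  proof (cases "c \<le> bdry_dist z")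
    case True
    then have "bdry_dist (F 0) \<le> 3 ^ (N * k) * bdry_dist (F z)"
      using Suc by (simp add: c_def)
    also have "\<dots> \<le> 3 ^ (N * Suc k) * bdry_dist (F z)"
      using Fz by (intro mult_right_mono power_increasing) auto
    finally show ?thesis .
  next
    case False
    then have zc: "1 - c < norm z" by (simp add: bdry_dist_def)
    then have z0: "norm z > 0" using c by linarith
    define s where "s = (1 - c) / norm z"
    have s: "0 \<le> s" "s \<le> 1" using zc z0 c by (auto simp: s_def)
    have nz': "norm (s *\<^sub>R z) = 1 - c" using z0 s c by (simp add: s_def)
    have "s *\<^sub>R z - z = (s - 1) *\<^sub>R z" by (simp add: algebra_simps)
    then have "norm (s *\<^sub>R z - z) = (1 - s) * norm z" using s by simp
    also have "\<dots> = c - bdry_dist z" using z0 by (simp add: s_def bdry_dist_def field_simps)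
    also have "\<dots> \<le> 1 * bdry_dist z" using Suc.prems by (simp add: c_def)
    also have "\<dots> < real N * d * bdry_dist z"
      using N Suc.prems(1) by (intro mult_strict_right_mono) (auto simp: bdry_dist_pos_iff)
    finally have "bdry_dist (F (s *\<^sub>R z)) \<le> 3 ^ N * bdry_dist (F z)"
    proof (rule step_bounded_segment(1)[OF F])
      fix x assume x: "x \<in> closed_segment (s *\<^sub>R z) z"
      show "bdry_dist z \<le> bdry_dist x"
        using bdry_dist_on_segment[OF x, of "norm z"] nz' zc by (simp add: bdry_dist_def)
    qed (use Suc.prems in \<open>simp add: bdry_dist_pos_iff\<close>)
    moreover have "bdry_dist (F 0) \<le> 3 ^ (N * k) * bdry_dist (F (s *\<^sub>R z))"
    proof (rule Suc.IH)
      show "norm (s *\<^sub>R z) < 1" "(1/2) ^ k \<le> bdry_dist (s *\<^sub>R z)"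
        unfolding bdry_dist_def nz' using c by (simp_all add: c_def)
    qed
    ultimately have "bdry_dist (F 0) \<le> 3 ^ (N * k) * (3 ^ N * bdry_dist (F z))"
      by (meson mult_left_mono order_trans zero_le_numeral zero_le_power)
    then show ?thesis by (simp add: power_add mult_ac)
  qed
qed

text \<open>
About \<open>log\<^sub>2 (1 / \<delta>(z))\<close> dyadic stages lead from 0 to \<open>z\<close>, and each costs a bounded factor, so
\<open>\<delta>(F z)\<close> is bounded below by a power of \<open>\<delta>(z)\<close>.
\<close>

lemma bdry_dist_growth:
  assumes "0 < d"
  obtains \<beta> where "0 < \<beta>"
    "\<And>F z. step_bounded d F \<Longrightarrow> norm z < 1 \<Longrightarrow>
       bdry_dist (F 0) * (bdry_dist z / 2) powr \<beta> \<le> bdry_dist (F z)"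
proof -
  obtain N where "1 / d < real N" using reals_Archimedean2 by blast
  then have N: "1 < real N * d" using assms by (simp add: field_simps)
  then have N0: "N > 0" by (cases N) auto
  define \<beta> where "\<beta> = real N * log 2 3"
  have \<beta>: "0 < \<beta>" using N0 by (simp add: \<beta>_def)
  show thesis
  proof (rule that[OF \<beta>])
    fix F and z :: complex assume F: "step_bounded d F" and z: "norm z < 1"
    define \<delta> where "\<delta> = bdry_dist z"
    have \<delta>: "0 < \<delta>" "\<delta> \<le> 1" using z by (auto simp: \<delta>_def bdry_dist_def)
    define k where "k = nat \<lceil>log 2 (1 / \<delta>)\<rceil>"
    have "log 2 (1 / \<delta>) \<ge> 0" using \<delta> by simp
    then have k: "log 2 (1 / \<delta>) \<le> real k" "real k < log 2 (1 / \<delta>) + 1"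
      by (auto simp: k_def) linarith+
    have "2 powr log 2 (1 / \<delta>) \<le> 2 powr real k" using k by simp
    then have k1: "(1/2) ^ k \<le> \<delta>" using \<delta> by (simp add: powr_realpow field_simps)
    have "2 powr real k \<le> 2 powr (log 2 (1 / \<delta>) + 1)" using k by simp
    also have "\<dots> = 2 / \<delta>" using \<delta> by (simp add: powr_add)
    finally have k2: "2 powr real k \<le> 2 / \<delta>" .
    have "3 ^ (N * k) = (2 powr log 2 3) powr (real N * real k)"
      by (simp add: powr_realpow flip: of_nat_mult)
    also have "\<dots> = (2 powr real k) powr \<beta>" by (simp only: powr_powr \<beta>_def mult_ac)
    also have "\<dots> \<le> (2 / \<delta>) powr \<beta>" using k2 \<beta> by (intro powr_mono2) auto
    finally have 3: "3 ^ (N * k) \<le> (2 / \<delta>) powr \<beta>" .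
    have Fz: "0 \<le> bdry_dist (F z)"
      using F z by (auto simp: step_bounded_def Pi_iff bdry_dist_def intro: less_imp_le)
    have "bdry_dist (F 0) \<le> 3 ^ (N * k) * bdry_dist (F z)"
      using bdry_dist_growth_dyadic[OF F N z] k1 by (simp add: \<delta>_def)
    also have "\<dots> \<le> (2 / \<delta>) powr \<beta> * bdry_dist (F z)" using 3 Fz by (rule mult_right_mono)
    finally have "bdry_dist (F 0) * (\<delta> / 2) powr \<beta> \<le> ((2 / \<delta>) powr \<beta> * bdry_dist (F z)) * (\<delta> / 2) powr \<beta>"
      by (rule mult_right_mono) simp
    also have "\<dots> = ((2 / \<delta>) powr \<beta> * (\<delta> / 2) powr \<beta>) * bdry_dist (F z)" by simp
    also have "(2 / \<delta>) powr \<beta> * (\<delta> / 2) powr \<beta> = 1" using \<delta> by (simp flip: powr_mult)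
    finally show "bdry_dist (F 0) * (bdry_dist z / 2) powr \<beta> \<le> bdry_dist (F z)" by (simp add: \<delta>_def)
  qed
qed

text \<open>
As long as \<open>\<delta>\<close> at most doubles along a radius, the radial segment is no longer than \<open>\<delta>(z)\<close>, so \<open>N\<close>
steps suffice.
\<close>

lemma radial_step:
  assumes F: "step_bounded d F" and N: "1 < real N * d"
    and C: "0 < C" "0 < \<alpha>" "\<And>z. norm z < 1 \<Longrightarrow> bdry_dist (F z) \<le> C * bdry_dist z powr \<alpha>"
    and z: "norm z < 1" and s: "0 \<le> s" "s \<le> 1" and 2: "bdry_dist (s *\<^sub>R z) \<le> 2 * bdry_dist z"
  shows "norm (F (s *\<^sub>R z) - F z) \<le> 2 * real N * (C * bdry_dist (s *\<^sub>R z) powr \<alpha>)"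
proof (rule step_bounded_segment(2)[OF F])
  have sz: "norm (s *\<^sub>R z) \<le> norm z" using s by (simp add: mult_left_le_one_le)
  have "s *\<^sub>R z - z = (s - 1) *\<^sub>R z" by (simp add: algebra_simps)
  then have "norm (s *\<^sub>R z - z) = (1 - s) * norm z" using s by simp
  also have "\<dots> = bdry_dist (s *\<^sub>R z) - bdry_dist z"
    using s by (simp add: bdry_dist_def algebra_simps)
  also have "\<dots> \<le> 1 * bdry_dist z" using 2 by simp
  also have "\<dots> < real N * d * bdry_dist z"
    using N z by (intro mult_strict_right_mono) (auto simp: bdry_dist_pos_iff)
  finally show "norm (s *\<^sub>R z - z) < real N * d * bdry_dist z" .
  show "0 < bdry_dist z" using z by (simp add: bdry_dist_pos_iff)
  fix x assume x: "x \<in> closed_segment (s *\<^sub>R z) z"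
  show "bdry_dist z \<le> bdry_dist x"
    using bdry_dist_on_segment[OF x, of "norm z"] sz by (simp add: bdry_dist_def)
  then have x1: "norm x < 1" "0 < bdry_dist x" using z by (auto simp: bdry_dist_def)
  obtain u where u: "0 \<le> u" "u \<le> 1" "x = (1 - u) *\<^sub>R (s *\<^sub>R z) + u *\<^sub>R z"
    using x by (auto simp: in_segment)
  have "x = ((1 - u) * s + u) *\<^sub>R z" unfolding u(3) by (simp add: algebra_simps)
  moreover have "s \<le> (1 - u) * s + u" using u s mult_left_le_one_le[of u s] by (simp add: algebra_simps)
  ultimately have "norm (s *\<^sub>R z) \<le> norm x" using s by (auto intro!: mult_right_mono)
  then have "bdry_dist x powr \<alpha> \<le> bdry_dist (s *\<^sub>R z) powr \<alpha>"
    using x1 C by (intro powr_mono2) (auto simp: bdry_dist_def)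
  then show "bdry_dist (F x) \<le> C * bdry_dist (s *\<^sub>R z) powr \<alpha>"
    using C(3)[OF x1(1)] C(1) by (meson mult_left_mono less_imp_le order_trans)
qed

text \<open>
Along a radius the distances to the circle halve from stage to stage, so the contributions of the
stages form a geometric series dominated by its first term.
\<close>

lemma radial_holder:
  assumes F: "step_bounded d F" and N: "1 < real N * d"
    and C: "0 < C" "0 < \<alpha>" "\<And>z. norm z < 1 \<Longrightarrow> bdry_dist (F z) \<le> C * bdry_dist z powr \<alpha>"
    and z: "norm z < 1" and s: "0 \<le> s" "s \<le> 1"
  shows "norm (F (s *\<^sub>R z) - F z) \<le> 2 * real N * C / (1 - (1/2) powr \<alpha>) * bdry_dist (s *\<^sub>R z) powr \<alpha>"
proof -
  define D where "D = 2 * real N * C"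
  define q :: real where "q = (1/2) powr \<alpha>"
  define K where "K = D / (1 - q)"
  have q: "0 < q" "q < 1" using C(2) powr_less_mono2[of \<alpha> "1/2" 1] by (auto simp: q_def)
  have D: "0 \<le> D" using C by (simp add: D_def)
  have DK: "D \<le> K" using q D by (simp add: K_def field_simps)
  \<comment> \<open>\<open>K\<close> is the sum of the geometric series with first term \<open>D\<close> and ratio \<open>q\<close>.\<close>
  have Kq: "D + K * q = K" using q by (simp add: K_def field_simps)
  have near: "norm (F (s *\<^sub>R z) - F z) \<le> D * bdry_dist (s *\<^sub>R z) powr \<alpha>"
    if "norm z < 1" "0 \<le> s" "s \<le> 1" "bdry_dist (s *\<^sub>R z) \<le> 2 * bdry_dist z" for s z
    using radial_step[OF F N C that] by (simp add: D_def mult_ac)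
  have main: "norm (F (s *\<^sub>R z) - F z) \<le> K * bdry_dist (s *\<^sub>R z) powr \<alpha>"
    if "0 \<le> s" "s \<le> 1" "bdry_dist (s *\<^sub>R z) \<le> 2 ^ k * bdry_dist z" for s k
    using that
  proof (induction k arbitrary: s)
    case 0
    then have "norm (F (s *\<^sub>R z) - F z) \<le> D * bdry_dist (s *\<^sub>R z) powr \<alpha>"
      using z by (intro near) (auto simp: bdry_dist_def)
    also have "\<dots> \<le> K * bdry_dist (s *\<^sub>R z) powr \<alpha>" using DK by (intro mult_right_mono) auto
    finally show ?case .
  next
    case (Suc k)
    define \<delta> where "\<delta> = bdry_dist (s *\<^sub>R z)"
    show ?case
    proof (cases "\<delta> \<le> 2 * bdry_dist z")
      case True
      then have "norm (F (s *\<^sub>R z) - F z) \<le> D * bdry_dist (s *\<^sub>R z) powr \<alpha>"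
        using z Suc.prems by (intro near) (auto simp: \<delta>_def)
      also have "\<dots> \<le> K * bdry_dist (s *\<^sub>R z) powr \<alpha>" using DK by (intro mult_right_mono) auto
      finally show ?thesis .
    next
      case False
      have sz: "s * norm z \<le> norm z" using Suc.prems by (simp add: mult_left_le_one_le)
      have \<delta>: "\<delta> = 1 - s * norm z" using Suc.prems by (simp add: \<delta>_def bdry_dist_def)
      have \<delta>1: "0 < \<delta>" "\<delta> \<le> 1" using sz z Suc.prems by (auto simp: \<delta>)
      have lt: "1 - \<delta> / 2 < norm z" using False by (simp add: bdry_dist_def)
      then have z0: "norm z > 0" using \<delta>1 by linarith
      define s' where "s' = (1 - \<delta> / 2) / norm z"
      have s': "0 < s'" "s' \<le> 1" using lt z0 \<delta>1 by (auto simp: s'_def)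
      have "s * norm z \<le> 1 - \<delta> / 2" using \<delta> \<delta>1 by linarith
      then have ss': "s \<le> s'" using z0 by (simp add: s'_def field_simps)
      have n': "bdry_dist (s' *\<^sub>R z) = \<delta> / 2" using z0 \<delta>1 by (simp add: bdry_dist_def s'_def)
      have "norm (F ((s / s') *\<^sub>R (s' *\<^sub>R z)) - F (s' *\<^sub>R z)) \<le>
            D * bdry_dist ((s / s') *\<^sub>R (s' *\<^sub>R z)) powr \<alpha>"
      proof (rule near)
        show "norm (s' *\<^sub>R z) < 1" using n' \<delta>1 by (simp add: bdry_dist_def)
        show "bdry_dist ((s / s') *\<^sub>R (s' *\<^sub>R z)) \<le> 2 * bdry_dist (s' *\<^sub>R z)"
          using s' unfolding n' by (simp add: \<delta>_def)
      qed (use s' ss' Suc.prems in auto)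
      then have 1: "norm (F (s *\<^sub>R z) - F (s' *\<^sub>R z)) \<le> D * \<delta> powr \<alpha>"
        using s' by (simp add: \<delta>_def)
      have 2: "norm (F (s' *\<^sub>R z) - F z) \<le> K * bdry_dist (s' *\<^sub>R z) powr \<alpha>"
      proof (rule Suc.IH)
        show "bdry_dist (s' *\<^sub>R z) \<le> 2 ^ k * bdry_dist z"
          using Suc.prems(3) by (simp add: n' \<delta>_def)
      qed (use s' in auto)
      have "(\<delta> / 2) powr \<alpha> = q * \<delta> powr \<alpha>"
        using powr_mult[of "1/2" \<delta> \<alpha>] \<delta>1 by (simp add: q_def)
      then have 3: "norm (F (s' *\<^sub>R z) - F z) \<le> K * q * \<delta> powr \<alpha>" using 2 n' by (simp add: mult_ac)
      have "norm (F (s *\<^sub>R z) - F z) \<le> norm (F (s *\<^sub>R z) - F (s' *\<^sub>R z)) + norm (F (s' *\<^sub>R z) - F z)"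
        using norm_triangle_ineq[of "F (s *\<^sub>R z) - F (s' *\<^sub>R z)" "F (s' *\<^sub>R z) - F z"] by simp
      also have "\<dots> \<le> (D + K * q) * \<delta> powr \<alpha>" using 1 3 by (simp add: algebra_simps)
      finally show ?thesis unfolding Kq \<delta>_def .
    qed
  qed
  have "0 < bdry_dist z" using z by (simp add: bdry_dist_pos_iff)
  moreover obtain k where "bdry_dist (s *\<^sub>R z) / bdry_dist z < 2 ^ k"
    using real_arch_pow[of 2] by auto
  ultimately have "bdry_dist (s *\<^sub>R z) \<le> 2 ^ k * bdry_dist z" by (simp add: field_simps)
  from main[OF s this] show ?thesis by (simp add: K_def D_def q_def)
qed

text \<open>
With \<open>t = \<bar>1 - cnj z w\<bar>\<close>, both points are joined radially to the circle of radius \<open>1 - t\<close>; there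
the endpoints are at distance at most \<open>3 t\<close>, which is a bounded number of steps. The constant \<open>K\<close> is
obtained before \<open>F\<close>, as later it is needed simultaneously for a whole family of maps.
\<close>

lemma holder_estimate:
  assumes d: "0 < d" and C: "0 < C" and \<alpha>: "0 < \<alpha>"
  obtains K where "0 < K"
    "\<And>F z w. step_bounded d F \<Longrightarrow> (\<And>z. norm z < 1 \<Longrightarrow> bdry_dist (F z) \<le> C * bdry_dist z powr \<alpha>) \<Longrightarrow>
       norm z < 1 \<Longrightarrow> norm w < 1 \<Longrightarrow> norm (F z - F w) \<le> K * norm (1 - cnj z * w) powr \<alpha>"
proof -
  obtain N where "3 / d < real N" using reals_Archimedean2 by blast
  then have N3: "3 < real N * d" using d by (simp add: field_simps)
  then have N: "1 < real N * d" by simp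
  define K1 where "K1 = 2 * real N * C / (1 - (1/2) powr \<alpha>)"
  have K1: "0 \<le> K1" using C \<alpha> by (auto simp: K1_def powr_le1)
  define K2 where "K2 = 2 * real N * C * 4 powr \<alpha>"
  have K2: "0 \<le> K2" using C by (simp add: K2_def)
  define K where "K = 2 * K1 + K2 + 2 * 2 powr \<alpha>"
  have K: "0 < K" using K1 K2 by (auto simp: K_def intro: add_nonneg_pos)
  show thesis
  proof (rule that[OF K])
    fix F and z w :: complex
    assume F: "step_bounded d F" and FC: "\<And>z. norm z < 1 \<Longrightarrow> bdry_dist (F z) \<le> C * bdry_dist z powr \<alpha>"
      and z: "norm z < 1" and w: "norm w < 1"
    have FD: "norm (F z) < 1" "norm (F w) < 1" using F z w by (auto simp: step_bounded_def Pi_iff)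
    define t where "t = norm (1 - cnj z * w)"
    have t: "bdry_dist z \<le> t" "bdry_dist w \<le> t" "norm (z - w) \<le> t"
      using bdry_dist_le_norm_one_minus[of z w] norm_diff_le_norm_one_minus[of z w] z w
      by (auto simp: t_def)
    have t0: "0 < t" using t(1) z by (simp add: bdry_dist_def)
    show "norm (F z - F w) \<le> K * norm (1 - cnj z * w) powr \<alpha>"
    proof (cases "t < 1/2")
      case False
      have "norm (F z - F w) \<le> 2" using norm_triangle_ineq4[of "F z" "F w"] FD by simp
      also have "2 = 2 * 2 powr \<alpha> * (1/2) powr \<alpha>" by (simp add: powr_divide)
      also have "\<dots> \<le> K * t powr \<alpha>"
        using False \<alpha> K1 K2 by (intro mult_mono powr_mono2) (auto simp: K_def)
      finally show ?thesis by (simp add: t_def)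
    next
      case True
      have radial: "\<exists>v. norm v = 1 - t \<and> norm (v - u) \<le> t \<and> norm (F v - F u) \<le> K1 * t powr \<alpha>"
        if u: "norm u < 1" "bdry_dist u \<le> t" for u
      proof -
        have u0: "norm u > 0" "1 - t \<le> norm u" using u True by (auto simp: bdry_dist_def)
        define s where "s = (1 - t) / norm u"
        have s: "0 \<le> s" "s \<le> 1" using u0 True by (auto simp: s_def)
        have n: "norm (s *\<^sub>R u) = 1 - t" using u0 True by (simp add: s_def)
        have "s *\<^sub>R u - u = (s - 1) *\<^sub>R u" by (simp add: algebra_simps)
        then have "norm (s *\<^sub>R u - u) = (1 - s) * norm u" using s by simp
        also have "\<dots> = norm u - (1 - t)" using u0 by (simp add: s_def field_simps)
        finally have "norm (s *\<^sub>R u - u) \<le> t" using u by simp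
        moreover have "norm (F (s *\<^sub>R u) - F u) \<le> K1 * t powr \<alpha>"
          using radial_holder[OF F N C \<alpha> FC u(1) s] n by (simp add: K1_def bdry_dist_def)
        ultimately show ?thesis using n by blast
      qed
      obtain z' where z': "norm z' = 1 - t" "norm (z' - z) \<le> t" "norm (F z' - F z) \<le> K1 * t powr \<alpha>"
        using radial[OF z t(1)] by blast
      obtain w' where w': "norm w' = 1 - t" "norm (w' - w) \<le> t" "norm (F w' - F w) \<le> K1 * t powr \<alpha>"
        using radial[OF w t(2)] by blast
      have tri: "norm (x - y) \<le> norm (x - a) + norm (a - b) + norm (y - b)" for x y a b :: complex
        using norm_triangle_ineq[of "x - a" "a - y"] norm_triangle_ineq[of "a - b" "b - y"]
        by (simp add: norm_minus_commute[of b y])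
      have zw: "norm (z' - w') \<le> 3 * t" using tri[of z' w' z w] z' w' t by linarith
      have "norm (F z' - F w') \<le> 2 * real N * (C * (4 * t) powr \<alpha>)"
      proof (rule step_bounded_segment(2)[OF F _ t0])
        have "3 * t < real N * d * t" using N3 t0 by (intro mult_strict_right_mono)
        then show "norm (z' - w') < real N * d * t" using zw by linarith
        fix x assume x: "x \<in> closed_segment z' w'"
        show xt: "t \<le> bdry_dist x" using bdry_dist_on_segment[OF x, of "1 - t"] z' w' by simp
        have "norm (x - z') \<le> norm (z' - w')"
          using segment_bound1[OF x] by (simp add: norm_minus_commute)
        moreover have "norm z' - norm x \<le> norm (z' - x)" by (rule norm_triangle_ineq2)
        ultimately have "bdry_dist x \<le> 4 * t"
          using zw z' by (simp add: bdry_dist_def norm_minus_commute)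
        then have "bdry_dist x powr \<alpha> \<le> (4 * t) powr \<alpha>" using xt t0 \<alpha> by (intro powr_mono2) auto
        moreover have "norm x < 1" using xt t0 by (simp add: bdry_dist_def)
        ultimately show "bdry_dist (F x) \<le> C * (4 * t) powr \<alpha>"
          using FC[of x] C by (meson mult_left_mono less_imp_le order_trans)
      qed
      also have "\<dots> = K2 * t powr \<alpha>" using t0 by (simp add: K2_def powr_mult)
      finally have "norm (F z' - F w') \<le> K2 * t powr \<alpha>" .
      then have "norm (F z - F w) \<le> K1 * t powr \<alpha> + K2 * t powr \<alpha> + K1 * t powr \<alpha>"
        using tri[of "F z" "F w" "F z'" "F w'"] z'(3) w'(3)
        by (simp add: norm_minus_commute)
      also have "\<dots> = (2 * K1 + K2) * t powr \<alpha>" by (simp add: algebra_simps)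
      also have "\<dots> \<le> K * t powr \<alpha>" by (intro mult_right_mono) (auto simp: K_def)
      finally show ?thesis by (simp add: t_def)
    qed
  qed
qed

section \<open>Extension to the closed disc and the boundary map\<close>

lemma step_bounded_of_unif_cont:
  assumes "pseudohyp_unif_cont F" "F \<in> unit_disc \<rightarrow> unit_disc"
  obtains d where "step_bounded d F"
proof -
  have "(1/2 :: real) > 0" by simp
  then obtain d where "d > 0" "\<And>z w. z \<in> unit_disc \<Longrightarrow> w \<in> unit_disc \<Longrightarrow>
        pseudohyp z w < d \<Longrightarrow> pseudohyp (F z) (F w) < 1/2"
    using assms(1) unfolding pseudohyp_unif_cont_def by meson
  then have "step_bounded d F" using assms(2) by (auto simp: step_bounded_def intro: less_imp_le)
  then show thesis by (rule that)
qed

lemma step_bounded_pos: "step_bounded d F \<Longrightarrow> 0 < d"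
  and step_bounded_norm: "step_bounded d F \<Longrightarrow> norm z < 1 \<Longrightarrow> norm (F z) < 1"
  by (auto simp: step_bounded_def Pi_iff)

text \<open>
The lower bound of \<open>bdry_dist_growth\<close> for a left inverse is an upper bound for the map itself.
The dependence on \<open>G\<close> is only through \<open>\<delta>(G 0)\<close>, which is 1 if \<open>G\<close> fixes 0.
\<close>

lemma bdry_dist_holder_upper:
  assumes "0 < d"
  obtains \<alpha> where "0 < \<alpha>"
    "\<And>F G z. step_bounded d G \<Longrightarrow> norm z < 1 \<Longrightarrow> norm (F z) < 1 \<Longrightarrow> G (F z) = z \<Longrightarrow>
       bdry_dist (F z) \<le> 2 * (1 / bdry_dist (G 0)) powr \<alpha> * bdry_dist z powr \<alpha>"
proof -
  obtain \<beta> where \<beta>: "0 < \<beta>" and gr: "\<And>G z. step_bounded d G \<Longrightarrow> norm z < 1 \<Longrightarrow>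
       bdry_dist (G 0) * (bdry_dist z / 2) powr \<beta> \<le> bdry_dist (G z)"
    using bdry_dist_growth[OF assms] by metis
  show thesis
  proof (rule that[of "1 / \<beta>"])
    show "0 < 1 / \<beta>" using \<beta> by simp
    fix F G :: "complex \<Rightarrow> complex" and z :: complex
    assume G: "step_bounded d G" and z: "norm z < 1" "norm (F z) < 1" "G (F z) = z"
    have G0: "0 < bdry_dist (G 0)" using step_bounded_norm[OF G, of 0] by (simp add: bdry_dist_pos_iff)
    have pos: "0 < bdry_dist (F z)" "0 < bdry_dist z" using z by (simp_all add: bdry_dist_pos_iff)
    have "(bdry_dist (F z) / 2) powr \<beta> \<le> 1 / bdry_dist (G 0) * bdry_dist z"
      using gr[OF G z(2)] z(3) G0 by (simp add: field_simps)
    then have "((bdry_dist (F z) / 2) powr \<beta>) powr (1 / \<beta>) \<le> (1 / bdry_dist (G 0) * bdry_dist z) powr (1 / \<beta>)"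
      using \<beta> by (intro powr_mono2) auto
    also have "((bdry_dist (F z) / 2) powr \<beta>) powr (1 / \<beta>) = bdry_dist (F z) / 2"
      using \<beta> pos by (simp add: powr_powr)
    also have "(1 / bdry_dist (G 0) * bdry_dist z) powr (1 / \<beta>) =
         (1 / bdry_dist (G 0)) powr (1 / \<beta>) * bdry_dist z powr (1 / \<beta>)"
      using G0 pos by (intro powr_mult)
    finally show "bdry_dist (F z) \<le> 2 * (1 / bdry_dist (G 0)) powr (1 / \<beta>) * bdry_dist z powr (1 / \<beta>)"
      by simp
  qed
qed

text \<open>
The estimate settles points near the circle, where \<open>\<bar>1 - cnj z w\<bar>\<close> is small as soon as \<open>\<bar>z - w\<bar>\<close> is;
elsewhere compactness applies.
\<close>

lemma uniformly_continuous_of_holder_estimate: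
  assumes F: "continuous_on unit_disc F" and \<alpha>: "0 < \<alpha>" and K: "0 < K"
    and hold: "\<And>z w. norm z < 1 \<Longrightarrow> norm w < 1 \<Longrightarrow> norm (F z - F w) \<le> K * norm (1 - cnj z * w) powr \<alpha>"
  shows "uniformly_continuous_on unit_disc F"
  unfolding uniformly_continuous_on_def
proof (intro allI impI)
  fix e :: real assume e: "0 < e"
  define t where "t = (e / (2 * K)) powr (1 / \<alpha>)"
  have t: "0 < t" using e K by (simp add: t_def)
  have Kt: "K * t powr \<alpha> < e" using e K \<alpha> by (simp add: t_def powr_powr)
  have "compact (cball 0 (1 - t / 8) :: complex set)" by simp
  moreover have "cball 0 (1 - t / 8) \<subseteq> (unit_disc :: complex set)" using t by auto
  ultimately have "uniformly_continuous_on (cball 0 (1 - t / 8)) F"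
    using F continuous_on_subset compact_uniformly_continuous by blast
  then obtain d where d: "0 < d" "\<And>z w. z \<in> cball 0 (1 - t / 8) \<Longrightarrow> w \<in> cball 0 (1 - t / 8) \<Longrightarrow>
        dist z w < d \<Longrightarrow> dist (F z) (F w) < e"
    using e unfolding uniformly_continuous_on_def by metis
  show "\<exists>d>0. \<forall>x\<in>unit_disc. \<forall>x'\<in>unit_disc. dist x' x < d \<longrightarrow> dist (F x') (F x) < e"
  proof (intro exI[of _ "min d (t / 8)"] conjI ballI impI)
    fix w z :: complex assume zw: "w \<in> unit_disc" "z \<in> unit_disc" and "dist z w < min d (t / 8)"
    then have dist: "dist z w < d" "norm (z - w) < t / 8" by (simp_all add: dist_norm)
    show "dist (F z) (F w) < e"
    proof (cases "bdry_dist z < t / 4")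
      case True
      then have "norm (1 - cnj z * w) \<le> t" using norm_one_minus_le[of z w] zw dist t by simp
      then have "K * norm (1 - cnj z * w) powr \<alpha> \<le> K * t powr \<alpha>"
        using K \<alpha> by (intro mult_left_mono powr_mono2) auto
      then show ?thesis using hold[of z w] zw Kt by (simp add: dist_norm)
    next
      case False
      have "norm w - norm z \<le> norm (z - w)" using norm_triangle_ineq2[of w z] by (simp add: norm_minus_commute)
      then show ?thesis using False dist t by (intro d(2)) (auto simp: bdry_dist_def)
    qed
  qed (use d t in auto)
qed

lemma closure_unit_disc: "closure (unit_disc :: complex set) = cball 0 1"
  by simp

lemma eq_on_cball_of_eq_on_disc:
  fixes f g :: "complex \<Rightarrow> complex"
  assumes "continuous_on (cball 0 1) f" "continuous_on (cball 0 1) g"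
    "\<And>z. norm z < 1 \<Longrightarrow> f z = g z" "norm z \<le> 1"
  shows "f z = g z"
proof -
  have "norm (f z - g z) \<le> 0"
  proof (rule continuous_le_on_closure[where S = unit_disc and f = "\<lambda>z. norm (f z - g z)"])
    show "continuous_on (closure unit_disc) (\<lambda>z. norm (f z - g z))"
      unfolding closure_unit_disc using assms by (intro continuous_intros)
  qed (use assms in auto)
  then show ?thesis by simp
qed

lemma le_on_closed_bidisc:
  fixes P Q :: "complex \<times> complex \<Rightarrow> real"
  assumes "continuous_on (cball 0 1 \<times> cball 0 1) P" "continuous_on (cball 0 1 \<times> cball 0 1) Q"
    and "\<And>z w. norm z < 1 \<Longrightarrow> norm w < 1 \<Longrightarrow> P (z, w) \<le> Q (z, w)"
    and "norm z \<le> 1" "norm w \<le> 1"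
  shows "P (z, w) \<le> Q (z, w)"
proof -
  have cl: "closure (unit_disc \<times> unit_disc) = (cball 0 1 \<times> cball 0 1 :: (complex \<times> complex) set)"
    by (simp add: closure_Times)
  have "P (z, w) - Q (z, w) \<le> 0"
  proof (rule continuous_le_on_closure[where S = "unit_disc \<times> unit_disc" and f = "\<lambda>p. P p - Q p"])
    show "continuous_on (closure (unit_disc \<times> unit_disc)) (\<lambda>p. P p - Q p)"
      unfolding cl using assms by (intro continuous_intros)
    show "(z, w) \<in> closure (unit_disc \<times> unit_disc)" unfolding cl using assms by auto
    fix p :: "complex \<times> complex" assume "p \<in> unit_disc \<times> unit_disc"
    then show "P p - Q p \<le> 0" using assms(3)[of "fst p" "snd p"] by (auto simp: mem_Times_iff)
  qed
  then show ?thesis by simp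
qed

lemma continuous_on_compose_fst:
  "continuous_on A f \<Longrightarrow> continuous_on (A \<times> B) (\<lambda>p. f (fst p))"
  by (rule continuous_on_compose2[where g = f]) (auto intro: continuous_intros)

lemma continuous_on_compose_snd:
  "continuous_on B f \<Longrightarrow> continuous_on (A \<times> B) (\<lambda>p. f (snd p))"
  by (rule continuous_on_compose2[where g = f]) (auto intro: continuous_intros)

lemma homeomorphism_disc_extend:
  assumes hom: "homeomorphism unit_disc unit_disc F G"
    and F: "uniformly_continuous_on unit_disc F" and G: "uniformly_continuous_on unit_disc G"
  obtains H K :: "complex \<Rightarrow> complex" where "homeomorphism (cball 0 1) (cball 0 1) H K"
    "\<And>z. norm z < 1 \<Longrightarrow> H z = F z" "\<And>z. norm z < 1 \<Longrightarrow> K z = G z"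
proof -
  obtain H where "uniformly_continuous_on (closure unit_disc) H" "\<And>z. z \<in> unit_disc \<Longrightarrow> F z = H z"
    using uniformly_continuous_on_extension_on_closure[OF F] by metis
  then have H: "continuous_on (cball 0 1) H" "\<And>z. norm z < 1 \<Longrightarrow> H z = F z"
    by (simp_all add: uniformly_continuous_imp_continuous)
  obtain K where "uniformly_continuous_on (closure unit_disc) K" "\<And>z. z \<in> unit_disc \<Longrightarrow> G z = K z"
    using uniformly_continuous_on_extension_on_closure[OF G] by metis
  then have K: "continuous_on (cball 0 1) K" "\<And>z. norm z < 1 \<Longrightarrow> K z = G z"
    by (simp_all add: uniformly_continuous_imp_continuous)
  have FG: "\<And>z. norm z < 1 \<Longrightarrow> norm (F z) < 1" "\<And>z. norm z < 1 \<Longrightarrow> norm (G z) < 1"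
    "\<And>z. norm z < 1 \<Longrightarrow> G (F z) = z" "\<And>z. norm z < 1 \<Longrightarrow> F (G z) = z"
    using hom by (auto simp: homeomorphism_def)
  have maps: "h ` cball 0 1 \<subseteq> cball 0 1" if "continuous_on (cball 0 1) h" "\<And>z. norm z < 1 \<Longrightarrow> norm (h z) < 1"
    for h :: "complex \<Rightarrow> complex"
  proof -
    have "h ` unit_disc \<subseteq> cball 0 1" using that(2) by (auto simp: less_eq_real_def)
    then show ?thesis using image_closure_subset[of unit_disc h "cball 0 1"] that(1) by simp
  qed
  have HH: "H ` cball 0 1 \<subseteq> cball 0 1" and KK: "K ` cball 0 1 \<subseteq> cball 0 1"
    using maps H K FG by metis+
  have KH: "K (H z) = z" if "norm z \<le> 1" for z
  proof (rule eq_on_cball_of_eq_on_disc[where g = "\<lambda>z. z" and f = "\<lambda>z. K (H z)"])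
    show "continuous_on (cball 0 1) (\<lambda>z. K (H z))"
      using K(1) H(1) HH by (rule continuous_on_compose2)
  qed (use that H K FG in auto)
  have HK: "H (K z) = z" if "norm z \<le> 1" for z
  proof (rule eq_on_cball_of_eq_on_disc[where g = "\<lambda>z. z" and f = "\<lambda>z. H (K z)"])
    show "continuous_on (cball 0 1) (\<lambda>z. H (K z))"
      using H(1) K(1) KK by (rule continuous_on_compose2)
  qed (use that H K FG in auto)
  have "homeomorphism (cball 0 1) (cball 0 1) H K"
    using H(1) K(1) HH KK KH HK by (intro homeomorphismI) auto
  then show thesis using that H(2) K(2) by blast
qed

text \<open>
An extension is determined on the closed disc by density, which identifies the definite description.
\<close>

lemma closed_disc_extension_eq:
  assumes hom: "homeomorphism (cball 0 1) (cball 0 1) H K" and H: "\<And>z. norm z < 1 \<Longrightarrow> H z = F z"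
  shows "closed_disc_extension F = restrict H (cball 0 1)"
  unfolding closed_disc_extension_def
proof (rule the_equality)
  have "homeomorphism (cball 0 1) (cball 0 1) (restrict H (cball 0 1)) K"
    by (rule homeomorphism_cong[OF hom]) auto
  then show "restrict H (cball 0 1) \<in> extensional (cball 0 1) \<and>
      (\<exists>K. homeomorphism (cball 0 1) (cball 0 1) (restrict H (cball 0 1)) K) \<and>
      (\<forall>z\<in>unit_disc. restrict H (cball 0 1) z = F z)"
    using H by auto
next
  fix H' assume H': "H' \<in> extensional (cball 0 1) \<and>
      (\<exists>K. homeomorphism (cball 0 1) (cball 0 1) H' K) \<and> (\<forall>z\<in>unit_disc. H' z = F z)"
  then have c: "continuous_on (cball 0 1) H'" by (auto simp: homeomorphism_def)
  have c': "continuous_on (cball 0 1) H" using hom by (auto simp: homeomorphism_def)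
  have "H' z = H z" if "norm z \<le> 1" for z
    using eq_on_cball_of_eq_on_disc[OF c c'] H H' that by simp
  then show "H' = restrict H (cball 0 1)"
    using H' by (auto simp: restrict_def extensional_def)
qed

lemma boundary_map_eq:
  assumes "homeomorphism (cball 0 1) (cball 0 1) H K" and "\<And>z. norm z < 1 \<Longrightarrow> H z = F z"
  shows "boundary_map F = restrict H unit_circle"
proof -
  have "closed_disc_extension F = restrict H (cball 0 1)"
    by (rule closed_disc_extension_eq[OF assms(1)]) (rule assms(2))
  then show ?thesis by (auto simp: boundary_map_def restrict_def)
qed

lemma homeomorphism_circle:
  assumes hom: "homeomorphism (cball 0 1) (cball 0 1) H K"
    and H: "\<And>z. norm z < 1 \<Longrightarrow> norm (H z) < 1" and K: "\<And>z. norm z < 1 \<Longrightarrow> norm (K z) < 1"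
  shows "homeomorphism unit_circle unit_circle H K"
proof (rule homeomorphismI)
  have HK: "\<And>z. norm z \<le> 1 \<Longrightarrow> norm (H z) \<le> 1" "\<And>z. norm z \<le> 1 \<Longrightarrow> norm (K z) \<le> 1"
    "\<And>z. norm z \<le> 1 \<Longrightarrow> K (H z) = z" "\<And>z. norm z \<le> 1 \<Longrightarrow> H (K z) = z"
    using hom by (auto simp: homeomorphism_def)
  show "continuous_on unit_circle H" "continuous_on unit_circle K"
    using hom by (auto simp: homeomorphism_def intro: continuous_on_subset)
  have "norm (H z) = 1" if z: "norm z = 1" for z
  proof (rule ccontr)
    assume "norm (H z) \<noteq> 1"
    then have "norm (H z) < 1" using HK(1)[of z] z by simp
    then show False using K[of "H z"] HK(3)[of z] z by simp
  qed
  then show "H ` unit_circle \<subseteq> unit_circle" by auto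
  have "norm (K z) = 1" if z: "norm z = 1" for z
  proof (rule ccontr)
    assume "norm (K z) \<noteq> 1"
    then have "norm (K z) < 1" using HK(2)[of z] z by simp
    then show False using H[of "K z"] HK(4)[of z] z by simp
  qed
  then show "K ` unit_circle \<subseteq> unit_circle" by auto
qed (use hom in \<open>auto simp: homeomorphism_def\<close>)

text \<open>
The cubic Taylor remainder is at most \<open>2 \<bar>x\<bar> / 3\<close> because \<open>\<bar>x\<bar> < 2\<close>.
\<close>

lemma abs_sin_ge:
  fixes x :: real
  assumes "\<bar>x\<bar> \<le> pi / 2"
  shows "\<bar>x\<bar> / 3 \<le> \<bar>sin x\<bar>"
proof -
  have "\<bar>sin x - (\<Sum>m<3. sin_coeff m * x ^ m)\<bar> \<le> inverse (fact 3) * \<bar>x\<bar> ^ 3"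
    by (rule Maclaurin_sin_bound)
  moreover have "(\<Sum>m<3. sin_coeff m * x ^ m) = x"
    by (simp add: numeral_3_eq_3 sin_coeff_def)
  moreover have "inverse (fact 3) * \<bar>x\<bar> ^ 3 \<le> 2 / 3 * \<bar>x\<bar>"
  proof -
    have "\<bar>x\<bar> * \<bar>x\<bar> \<le> 2 * 2" using assms pi_less_4 by (intro mult_mono) auto
    then have "\<bar>x\<bar> * \<bar>x\<bar> * \<bar>x\<bar> \<le> 4 * \<bar>x\<bar>" by (intro mult_right_mono) auto
    then show ?thesis by (simp add: fact_numeral power3_eq_cube)
  qed
  ultimately show ?thesis by linarith
qed

lemma circle_dist_bounds:
  assumes "norm \<zeta> = 1" "norm \<eta> = 1"
  shows "norm (\<zeta> - \<eta>) \<le> 2 * pi * circle_dist \<zeta> \<eta>" "2 * pi * circle_dist \<zeta> \<eta> \<le> 3 * norm (\<zeta> - \<eta>)"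
proof -
  define \<theta> where "\<theta> = Arg (\<eta> / \<zeta>)"
  have nz: "\<zeta> \<noteq> 0" "\<eta> / \<zeta> \<noteq> 0" using assms by auto
  have "\<eta> / \<zeta> = exp (\<i> * of_real \<theta>)"
    using Arg_eq[OF nz(2)] assms by (simp add: \<theta>_def norm_divide)
  then have "norm (\<eta> / \<zeta> - 1) = 2 * \<bar>sin (\<theta> / 2)\<bar>" by (simp add: dist_exp_i_1)
  moreover have "norm (\<eta> / \<zeta> - 1) = norm ((\<eta> - \<zeta>) / \<zeta>)" using nz by (simp add: diff_divide_distrib)
  ultimately have n: "norm (\<zeta> - \<eta>) = 2 * \<bar>sin (\<theta> / 2)\<bar>"
    using assms by (simp add: norm_divide norm_minus_commute)
  have c: "2 * pi * circle_dist \<zeta> \<eta> = \<bar>\<theta>\<bar>" by (simp add: circle_dist_def \<theta>_def)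
  have "\<bar>\<theta>\<bar> \<le> pi" using Arg_bounded[of "\<eta> / \<zeta>"] by (auto simp: \<theta>_def)
  then have "\<bar>\<theta> / 2\<bar> / 3 \<le> \<bar>sin (\<theta> / 2)\<bar>" by (intro abs_sin_ge) auto
  then show "2 * pi * circle_dist \<zeta> \<eta> \<le> 3 * norm (\<zeta> - \<eta>)" unfolding n c by simp
  have "\<bar>sin (\<theta> / 2)\<bar> \<le> \<bar>\<theta> / 2\<bar>" by (rule abs_sin_x_le_abs_x)
  then show "norm (\<zeta> - \<eta>) \<le> 2 * pi * circle_dist \<zeta> \<eta>" unfolding n c by simp
qed

lemma circle_dist_nonneg: "0 \<le> circle_dist \<zeta> \<eta>"
  by (simp add: circle_dist_def)

text \<open>
Chord length and arc length are comparable, so the bi-Lipschitz condition may be tested with chords.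
\<close>

lemma BiLip_circle_iff:
  assumes hom: "homeomorphism unit_circle unit_circle H K"
  shows "restrict H unit_circle \<in> BiLip_circle \<longleftrightarrow>
    (\<exists>L>0. \<forall>\<zeta>\<in>unit_circle. \<forall>\<eta>\<in>unit_circle.
       norm (H \<zeta> - H \<eta>) \<le> L * norm (\<zeta> - \<eta>) \<and> norm (\<zeta> - \<eta>) \<le> L * norm (H \<zeta> - H \<eta>))"
proof
  have Hc: "norm (H \<zeta>) = 1" if "norm \<zeta> = 1" for \<zeta> using hom that by (auto simp: homeomorphism_def)
  note bounds = circle_dist_bounds
  {
    assume "restrict H unit_circle \<in> BiLip_circle"
    then obtain L where L: "L \<ge> 1" "\<And>\<zeta> \<eta>. norm \<zeta> = 1 \<Longrightarrow> norm \<eta> = 1 \<Longrightarrow>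
           inverse L * circle_dist \<zeta> \<eta> \<le> circle_dist (H \<zeta>) (H \<eta>) \<and>
           circle_dist (H \<zeta>) (H \<eta>) \<le> L * circle_dist \<zeta> \<eta>"
      unfolding BiLip_circle_def by auto
    show "\<exists>L>0. \<forall>\<zeta>\<in>unit_circle. \<forall>\<eta>\<in>unit_circle.
       norm (H \<zeta> - H \<eta>) \<le> L * norm (\<zeta> - \<eta>) \<and> norm (\<zeta> - \<eta>) \<le> L * norm (H \<zeta> - H \<eta>)"
    proof (intro exI[of _ "L * 3"] conjI ballI)
      fix \<zeta> \<eta> assume "\<zeta> \<in> unit_circle" "\<eta> \<in> unit_circle"
      then have n: "norm \<zeta> = 1" "norm \<eta> = 1" by auto
      note nH = Hc[OF n(1)] Hc[OF n(2)]
      have "norm (H \<zeta> - H \<eta>) \<le> 2 * pi * circle_dist (H \<zeta>) (H \<eta>)" using bounds(1)[OF nH] .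
      also have "\<dots> \<le> 2 * pi * (L * circle_dist \<zeta> \<eta>)" using L(2)[OF n] by simp
      also have "\<dots> = L * (2 * pi * circle_dist \<zeta> \<eta>)" by simp
      also have "\<dots> \<le> L * (3 * norm (\<zeta> - \<eta>))" using bounds(2)[OF n] L(1) by (intro mult_left_mono) auto
      finally show "norm (H \<zeta> - H \<eta>) \<le> L * 3 * norm (\<zeta> - \<eta>)" by simp
      have "circle_dist \<zeta> \<eta> \<le> L * circle_dist (H \<zeta>) (H \<eta>)"
        using L(1) L(2)[OF n] by (simp add: field_simps)
      then have "2 * pi * circle_dist \<zeta> \<eta> \<le> 2 * pi * (L * circle_dist (H \<zeta>) (H \<eta>))" by simp
      also have "\<dots> = L * (2 * pi * circle_dist (H \<zeta>) (H \<eta>))" by simp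
      also have "\<dots> \<le> L * (3 * norm (H \<zeta> - H \<eta>))" using bounds(2)[OF nH] L(1) by (intro mult_left_mono) auto
      finally show "norm (\<zeta> - \<eta>) \<le> L * 3 * norm (H \<zeta> - H \<eta>)" using bounds(1)[OF n] by simp
    qed (use L in auto)
  }
  assume "\<exists>L>0. \<forall>\<zeta>\<in>unit_circle. \<forall>\<eta>\<in>unit_circle.
       norm (H \<zeta> - H \<eta>) \<le> L * norm (\<zeta> - \<eta>) \<and> norm (\<zeta> - \<eta>) \<le> L * norm (H \<zeta> - H \<eta>)"
  then obtain L where L: "L > 0" "\<And>\<zeta> \<eta>. norm \<zeta> = 1 \<Longrightarrow> norm \<eta> = 1 \<Longrightarrow> norm (H \<zeta> - H \<eta>) \<le> L * norm (\<zeta> - \<eta>)"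
    "\<And>\<zeta> \<eta>. norm \<zeta> = 1 \<Longrightarrow> norm \<eta> = 1 \<Longrightarrow> norm (\<zeta> - \<eta>) \<le> L * norm (H \<zeta> - H \<eta>)" by auto
  define M where "M = max 1 (3 * L)"
  have M: "M \<ge> 1" "3 * L \<le> M" by (auto simp: M_def)
  have "inverse M * circle_dist \<zeta> \<eta> \<le> circle_dist (H \<zeta>) (H \<eta>) \<and>
        circle_dist (H \<zeta>) (H \<eta>) \<le> M * circle_dist \<zeta> \<eta>"
    if n: "norm \<zeta> = 1" "norm \<eta> = 1" for \<zeta> \<eta>
  proof
    note nH = Hc[OF n(1)] Hc[OF n(2)]
    have up: "2 * pi * c \<le> 2 * pi * (M * c')"
      if "2 * pi * c \<le> 3 * r" "r \<le> L * r'" "r' \<le> 2 * pi * c'" "0 \<le> c'" for c c' r r'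
    proof -
      have "3 * r \<le> 3 * L * r'" using that by simp
      also have "\<dots> \<le> 3 * L * (2 * pi * c')" using that L(1) by (intro mult_left_mono) auto
      also have "\<dots> \<le> M * (2 * pi * c')" using M that by (intro mult_right_mono) auto
      finally have "2 * pi * c \<le> M * (2 * pi * c')" using that by linarith
      also have "\<dots> = 2 * pi * (M * c')" by simp
      finally show ?thesis .
    qed
    have "2 * pi * circle_dist (H \<zeta>) (H \<eta>) \<le> 2 * pi * (M * circle_dist \<zeta> \<eta>)"
      by (rule up[OF bounds(2)[OF nH] L(2)[OF n] bounds(1)[OF n] circle_dist_nonneg])
    then show "circle_dist (H \<zeta>) (H \<eta>) \<le> M * circle_dist \<zeta> \<eta>" by simp
    have "2 * pi * circle_dist \<zeta> \<eta> \<le> 2 * pi * (M * circle_dist (H \<zeta>) (H \<eta>))"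
      by (rule up[OF bounds(2)[OF n] L(3)[OF n] bounds(1)[OF nH] circle_dist_nonneg])
    then show "inverse M * circle_dist \<zeta> \<eta> \<le> circle_dist (H \<zeta>) (H \<eta>)"
      using M by (simp add: field_simps)
  qed
  moreover have "homeomorphism unit_circle unit_circle (restrict H unit_circle) K"
    by (rule homeomorphism_cong[OF hom]) auto
  ultimately show "restrict H unit_circle \<in> BiLip_circle"
    using M(1) unfolding BiLip_circle_def by auto
qed

lemma step_bounded_Moebius:
  assumes F: "step_bounded d F" and ab: "norm a < 1" "norm b < 1"
  shows "step_bounded d (\<lambda>z. Moebius_function 0 a (F (Moebius_function 0 b z)))"
  unfolding step_bounded_def
proof (intro conjI ballI impI)
  show "0 < d" using F by (rule step_bounded_pos)
  show "(\<lambda>z. Moebius_function 0 a (F (Moebius_function 0 b z))) \<in> unit_disc \<rightarrow> unit_disc"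
    using ab step_bounded_norm[OF F] Moebius_function_norm_lt_1 by simp
  fix z w assume zw: "z \<in> unit_disc" "w \<in> unit_disc" "pseudohyp z w < d"
  define x y where "x = Moebius_function 0 b z" and "y = Moebius_function 0 b w"
  have xy: "norm x < 1" "norm y < 1" "pseudohyp x y < d"
    using zw ab by (auto simp: x_def y_def Moebius_function_norm_lt_1 pseudohyp_Moebius_function)
  then have "pseudohyp (F x) (F y) \<le> 1/2" using F by (auto simp: step_bounded_def)
  then show "pseudohyp (Moebius_function 0 a (F (Moebius_function 0 b z)))
                       (Moebius_function 0 a (F (Moebius_function 0 b w))) \<le> 1/2"
    using ab xy step_bounded_norm[OF F] by (simp add: pseudohyp_Moebius_function flip: x_def y_def)
qed

text \<open>
The point \<open>w\<close> sees an arc of length about \<open>\<delta>(w)\<close> next to \<open>w / \<bar>w\<bar>\<close> under a large angle.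
\<close>

lemma Moebius_separates_close_points:
  assumes w: "norm w < 1"
  obtains \<zeta> \<eta> where "norm \<zeta> = 1" "norm \<eta> = 1" "norm (\<zeta> - \<eta>) \<le> 2 * bdry_dist w"
    "1/2 \<le> norm (Moebius_function 0 w \<zeta> - Moebius_function 0 w \<eta>)"
proof -
  define \<delta> where "\<delta> = bdry_dist w"
  have \<delta>: "0 < \<delta>" "\<delta> \<le> 1" using w by (auto simp: \<delta>_def bdry_dist_def)
  define \<zeta> where "\<zeta> = (if w = 0 then 1 else sgn w)"
  have \<zeta>: "norm \<zeta> = 1" by (simp add: \<zeta>_def norm_sgn)
  have w\<zeta>: "cnj w * \<zeta> = of_real (norm w)"
    by (auto simp: \<zeta>_def sgn_eq mult.commute[of "cnj w"] complex_norm_square[symmetric] power2_eq_square)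
  \<comment> \<open>The Cayley transform of \<open>\<delta>\<close> is a point of the circle at distance between \<open>\<delta>\<close> and \<open>2 \<delta>\<close> from 1.\<close>
  define u where "u = (1 + \<i> * of_real \<delta>) / (1 - \<i> * of_real \<delta>)"
  have n: "norm (1 - \<i> * of_real \<delta>) = sqrt (1 + \<delta>\<^sup>2)" "norm (1 + \<i> * of_real \<delta>) = sqrt (1 + \<delta>\<^sup>2)"
    by (simp_all add: cmod_def)
  have s: "1 \<le> sqrt (1 + \<delta>\<^sup>2)" by simp
  have "sqrt (1 + \<delta>\<^sup>2) \<le> sqrt 4" using \<delta> power_le_one[of \<delta> 2] by (intro real_sqrt_le_mono) linarith
  then have s2: "sqrt (1 + \<delta>\<^sup>2) \<le> 2" by simp
  have nz: "1 - \<i> * of_real \<delta> \<noteq> 0" using n(1) s by (metis norm_zero not_one_le_zero)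
  have s0: "sqrt (1 + \<delta>\<^sup>2) \<noteq> 0" using s by linarith
  have u: "norm u = 1" unfolding u_def norm_divide n by (rule divide_self[OF s0])
  have "u - 1 = 2 * \<i> * of_real \<delta> / (1 - \<i> * of_real \<delta>)" using nz by (simp add: u_def field_simps)
  then have u1: "norm (u - 1) = 2 * \<delta> / sqrt (1 + \<delta>\<^sup>2)" using \<delta> n by (simp add: norm_divide norm_mult)
  define \<eta> where "\<eta> = \<zeta> * u"
  have \<eta>: "norm \<eta> = 1" by (simp add: \<eta>_def norm_mult \<zeta> u)
  have "\<zeta> - \<eta> = - \<zeta> * (u - 1)" by (simp add: \<eta>_def algebra_simps)
  then have d: "norm (\<zeta> - \<eta>) = 2 * \<delta> / sqrt (1 + \<delta>\<^sup>2)" using u1 \<zeta> by (simp add: norm_mult)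
  have le: "norm (\<zeta> - \<eta>) \<le> 2 * \<delta>" 
  proof -
    have "2 * \<delta> / q \<le> 2 * \<delta>" if "1 \<le> q" for q using that \<delta> by (simp add: field_simps)
    then show ?thesis using s unfolding d by blast
  qed
  have ge: "\<delta> \<le> norm (\<zeta> - \<eta>)"
  proof -
    have "\<delta> \<le> 2 * \<delta> / q" if "1 \<le> q" "q \<le> 2" for q using that \<delta> by (simp add: field_simps)
    then show ?thesis using s s2 unfolding d by blast
  qed
  show thesis
  proof (rule that[OF \<zeta> \<eta>])
    show "norm (\<zeta> - \<eta>) \<le> 2 * bdry_dist w" using le by (simp add: \<delta>_def)
    have "1 - cnj w * \<zeta> = of_real \<delta>" by (simp add: w\<zeta> \<delta>_def bdry_dist_def)
    then have a: "norm (1 - cnj w * \<zeta>) = \<delta>" using \<delta> by simp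
    have "norm (1 - cnj w * \<eta>) \<le> norm (1 - cnj w * \<zeta>) + norm (cnj w * (\<zeta> - \<eta>))"
      using norm_triangle_ineq[of "1 - cnj w * \<zeta>" "cnj w * (\<zeta> - \<eta>)"] by (simp add: algebra_simps)
    also have "norm (cnj w * (\<zeta> - \<eta>)) \<le> norm (\<zeta> - \<eta>)"
      using w by (simp add: norm_mult mult_left_le_one_le)
    finally have b: "norm (1 - cnj w * \<eta>) \<le> 2 * norm (\<zeta> - \<eta>)" using a ge by simp
    have b0: "0 < norm (1 - cnj w * \<eta>)" using one_minus_cnj_mult_nonzero[of w \<eta>] w \<eta> by simp
    have "norm (complex_of_real (1 - (norm w)\<^sup>2)) = 1 - (norm w)\<^sup>2"
      using w by (simp only: norm_of_real) (simp add: power_le_one)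
    then have eq: "norm (Moebius_function 0 w \<zeta> - Moebius_function 0 w \<eta>) =
        (1 - (norm w)\<^sup>2) * norm (\<zeta> - \<eta>) / (\<delta> * norm (1 - cnj w * \<eta>))"
      using Moebius_function_diff[of w \<zeta> \<eta>] w \<zeta> \<eta> a by (simp only: norm_mult norm_divide)
    have "\<delta> \<le> 1 - (norm w)\<^sup>2"
      using w by (simp add: \<delta>_def bdry_dist_def power2_eq_square mult_left_le)
    then have "\<delta> * norm (1 - cnj w * \<eta>) \<le> (1 - (norm w)\<^sup>2) * (2 * norm (\<zeta> - \<eta>))"
      using b \<delta> by (intro mult_mono) auto
    then show "1/2 \<le> norm (Moebius_function 0 w \<zeta> - Moebius_function 0 w \<eta>)"
      unfolding eq using \<delta> b0 by (simp add: field_simps)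
  qed
qed

text \<open>
For fixed \<open>w\<close> let \<open>F'\<close> and \<open>G'\<close> be \<open>F\<close> and \<open>G\<close> composed with the Moebius maps that move \<open>w\<close> and
\<open>F w\<close> to 0. They fix 0 and inherit \<open>d\<close> and \<open>d'\<close>, so the Hoelder estimate for \<open>G'\<close> has constants
independent of \<open>w\<close>. Undoing the normalisation and passing to the boundary yields a lower bound for
\<open>\<bar>H \<zeta> - H \<eta>\<bar> / \<delta>(F w)\<close> in terms of how far apart \<open>\<zeta>\<close> and \<open>\<eta>\<close> look from \<open>w\<close>; the points provided by
\<open>Moebius_separates_close_points\<close> turn the Lipschitz bound into \<open>\<delta>(F w) \<le> C \<delta>(w)\<close>.
\<close>

lemma bdry_dist_le_of_boundary_lipschitz:
  assumes F: "step_bounded d F" and G: "step_bounded d' G"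
    and GF: "\<And>z. norm z < 1 \<Longrightarrow> G (F z) = z"
    and FG: "\<And>z. norm z < 1 \<Longrightarrow> F (G z) = z"
    and H: "continuous_on (cball 0 1) H" "\<And>z. norm z < 1 \<Longrightarrow> H z = F z" "\<And>\<zeta>. norm \<zeta> = 1 \<Longrightarrow> norm (H \<zeta>) = 1"
    and L: "0 < L" "\<And>\<zeta> \<eta>. norm \<zeta> = 1 \<Longrightarrow> norm \<eta> = 1 \<Longrightarrow> norm (H \<zeta> - H \<eta>) \<le> L * norm (\<zeta> - \<eta>)"
  shows "\<exists>C>0. \<forall>w. norm w < 1 \<longrightarrow> bdry_dist (F w) \<le> C * bdry_dist w"
proof -
  let ?M = "Moebius_function 0"
  note FD = step_bounded_norm[OF F] and GD = step_bounded_norm[OF G]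
  obtain \<alpha> where \<alpha>: "0 < \<alpha>" and up:
    "\<And>F' G' z. step_bounded d G' \<Longrightarrow> norm z < 1 \<Longrightarrow> norm (F' z) < 1 \<Longrightarrow> G' (F' z) = z \<Longrightarrow>
       bdry_dist (F' z) \<le> 2 * (1 / bdry_dist (G' 0)) powr \<alpha> * bdry_dist z powr \<alpha>"
    using bdry_dist_holder_upper[OF step_bounded_pos[OF F]] by metis
  obtain K where K: "0 < K" and hold:
    "\<And>G' z w. step_bounded d' G' \<Longrightarrow> (\<And>z. norm z < 1 \<Longrightarrow> bdry_dist (G' z) \<le> 2 * bdry_dist z powr \<alpha>) \<Longrightarrow>
       norm z < 1 \<Longrightarrow> norm w < 1 \<Longrightarrow> norm (G' z - G' w) \<le> K * norm (1 - cnj z * w) powr \<alpha>"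
    using holder_estimate[OF step_bounded_pos[OF G] _ \<alpha>, of 2] by (metis zero_less_numeral)
  have key: "norm (?M w p - ?M w q) \<le> K * (2 * norm (1 - cnj (F p) * F q) / bdry_dist (F w)) powr \<alpha>"
    if w: "norm w < 1" and p: "norm p < 1" and q: "norm q < 1" for w p q
  proof -
    define a where "a = F w"
    have a: "norm a < 1" using FD w by (simp add: a_def)
    define F' G' where "F' z = ?M a (F (?M (-w) z))" and "G' z = ?M w (G (?M (-a) z))" for z
    have F': "step_bounded d F'" unfolding F'_def[abs_def] using F a w by (intro step_bounded_Moebius) auto
    have G': "step_bounded d' G'" unfolding G'_def[abs_def] using G a w by (intro step_bounded_Moebius) auto
    have F'0: "F' 0 = 0" using w by (simp add: F'_def Moebius_function_of_zero a_def Moebius_function_eq_zero)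
    have FG': "F' (G' z) = z" if "norm z < 1" for z
    proof -
      have n: "norm (?M (-a) z) < 1" using Moebius_function_norm_lt_1[of "-a" z] a that by simp
      then show ?thesis
        using FG[OF n] GD[OF n] a w that by (simp add: F'_def G'_def Moebius_function_inverse)
    qed
    have "bdry_dist (G' z) \<le> 2 * bdry_dist z powr \<alpha>" if "norm z < 1" for z
      using up[where F' = G' and G' = F' and z = z, OF F' that step_bounded_norm[OF G' that] FG'[OF that]] F'0 by (simp add: bdry_dist_def)
    from hold[OF G' this] have hold': "norm (G' u - G' v) \<le> K * norm (1 - cnj u * v) powr \<alpha>"
      if "norm u < 1" "norm v < 1" for u v using that by blast
    define u v where "u = ?M a (F p)" and "v = ?M a (F q)"
    have uv: "norm u < 1" "norm v < 1"
      using a p q FD by (auto simp: u_def v_def Moebius_function_norm_lt_1)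
    have "G' u = ?M w p" "G' v = ?M w q"
      using a p q FD GF by (simp_all add: u_def v_def G'_def Moebius_function_inverse)
    then have 1: "norm (?M w p - ?M w q) \<le> K * norm (1 - cnj u * v) powr \<alpha>" using hold'[OF uv] by simp
    have \<delta>a: "0 < bdry_dist a" using a by (simp add: bdry_dist_pos_iff)
    have "norm (1 - cnj u * v) =
       (1 - (norm a)\<^sup>2) * norm (1 - cnj (F p) * F q) / (norm (1 - cnj a * F p) * norm (1 - cnj a * F q))"
      unfolding u_def v_def using a FD p q by (intro norm_one_minus_Moebius_function) (auto intro: less_imp_le)
    also have "\<dots> \<le> (2 * bdry_dist a) * norm (1 - cnj (F p) * F q) / (bdry_dist a * bdry_dist a)"
    proof (intro frac_le mult_right_mono mult_mono)
      have "0 \<le> (1 - norm a)\<^sup>2" by simp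
      then show "1 - (norm a)\<^sup>2 \<le> 2 * bdry_dist a" by (simp add: bdry_dist_def power2_eq_square algebra_simps)
      show "bdry_dist a \<le> norm (1 - cnj a * F p)" "bdry_dist a \<le> norm (1 - cnj a * F q)"
        using bdry_dist_le_norm_one_minus(1) a FD p q by (auto intro: less_imp_le)
    qed (use \<delta>a in auto)
    also have "\<dots> = 2 * norm (1 - cnj (F p) * F q) / bdry_dist a" using \<delta>a by simp
    finally have "norm (1 - cnj u * v) powr \<alpha> \<le> (2 * norm (1 - cnj (F p) * F q) / bdry_dist a) powr \<alpha>"
      using \<alpha> by (intro powr_mono2) auto
    with 1 show ?thesis using K unfolding a_def by (meson mult_left_mono less_imp_le order_trans)
  qed
  \<comment> \<open>The inequality \<open>key\<close> extends by continuity to boundary points, where \<open>F\<close> becomes \<open>H\<close>.\<close>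
  have bdry: "norm (?M w \<zeta> - ?M w \<eta>) \<le> K * (2 * norm (1 - cnj (H \<zeta>) * H \<eta>) / bdry_dist (F w)) powr \<alpha>"
    if w: "norm w < 1" and \<zeta>: "norm \<zeta> = 1" and \<eta>: "norm \<eta> = 1" for w \<zeta> \<eta>
  proof -
    have Fw: "0 < bdry_dist (F w)" using FD w by (simp add: bdry_dist_pos_iff)
    note [continuous_intros] = continuous_on_compose_fst continuous_on_compose_snd
      continuous_on_Moebius_function H(1)
    have "(\<lambda>p. norm (?M w (fst p) - ?M w (snd p))) (\<zeta>, \<eta>) \<le>
          (\<lambda>p. K * (2 * norm (1 - cnj (H (fst p)) * H (snd p)) / bdry_dist (F w)) powr \<alpha>) (\<zeta>, \<eta>)"
    proof (rule le_on_closed_bidisc)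
      show "continuous_on (cball 0 1 \<times> cball 0 1) (\<lambda>p. norm (?M w (fst p) - ?M w (snd p)))"
        by (intro continuous_intros w)
      show "continuous_on (cball 0 1 \<times> cball 0 1)
         (\<lambda>p. K * (2 * norm (1 - cnj (H (fst p)) * H (snd p)) / bdry_dist (F w)) powr \<alpha>)"
        using Fw \<alpha> by (intro continuous_on_powr' continuous_intros) auto
    qed (use key w \<zeta> \<eta> H(2) in auto)
    then show ?thesis by simp
  qed
  have circ: "norm (1 - cnj x * y) = norm (x - y)" if "norm x = 1" for x y
  proof -
    have "(norm (1 - cnj x * y))\<^sup>2 = (norm (x - y))\<^sup>2" using norm_one_minus_sq[of x y] that by simp
    then show ?thesis by (simp add: power2_eq_iff_nonneg)
  qed
  define C where "C = 4 * L * (2 * K) powr (1 / \<alpha>)"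
  have C: "0 < C" using K L by (simp add: C_def)
  have "bdry_dist (F w) \<le> C * bdry_dist w" if w: "norm w < 1" for w
  proof -
    have pos: "0 < bdry_dist (F w)" "0 < bdry_dist w" using FD w by (auto simp: bdry_dist_pos_iff)
    obtain \<zeta> \<eta> where ze: "norm \<zeta> = 1" "norm \<eta> = 1" "norm (\<zeta> - \<eta>) \<le> 2 * bdry_dist w"
      "1/2 \<le> norm (?M w \<zeta> - ?M w \<eta>)"
      using Moebius_separates_close_points[OF w] by metis
    have "norm (1 - cnj (H \<zeta>) * H \<eta>) = norm (H \<zeta> - H \<eta>)" by (rule circ[OF H(3)[OF ze(1)]])
    also have "\<dots> \<le> L * (2 * bdry_dist w)"
      using L(2)[OF ze(1,2)] ze(3) L(1) by (meson mult_left_mono less_imp_le order_trans)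
    finally have "2 * norm (1 - cnj (H \<zeta>) * H \<eta>) / bdry_dist (F w) \<le> 4 * L * bdry_dist w / bdry_dist (F w)"
      using pos by (intro divide_right_mono) auto
    then have "K * (2 * norm (1 - cnj (H \<zeta>) * H \<eta>) / bdry_dist (F w)) powr \<alpha>
        \<le> K * (4 * L * bdry_dist w / bdry_dist (F w)) powr \<alpha>"
      using K \<alpha> pos by (intro mult_left_mono powr_mono2) auto
    then have "1/2 \<le> K * (4 * L * bdry_dist w / bdry_dist (F w)) powr \<alpha>"
      using bdry[OF w ze(1,2)] ze(4) by linarith
    then have "1 \<le> 2 * K * (4 * L * bdry_dist w / bdry_dist (F w)) powr \<alpha>" by simp
    then have "1 powr (1 / \<alpha>) \<le> (2 * K * (4 * L * bdry_dist w / bdry_dist (F w)) powr \<alpha>) powr (1 / \<alpha>)"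
      using \<alpha> by (intro powr_mono2) auto
    also have "\<dots> = (2 * K) powr (1 / \<alpha>) * (4 * L * bdry_dist w / bdry_dist (F w))"
      using K L \<alpha> pos by (simp add: powr_mult powr_powr)
    finally show ?thesis using pos by (simp add: C_def field_simps)
  qed
  then show ?thesis using C by blast
qed

lemma unif_homeo_extends:
  assumes hom: "homeomorphism unit_disc unit_disc F G"
    and F: "pseudohyp_unif_cont F" and G: "pseudohyp_unif_cont G"
  obtains d d' H K where "step_bounded d F" "step_bounded d' G"
    "homeomorphism (cball 0 1) (cball 0 1) H K" "homeomorphism unit_circle unit_circle H K"
    "\<And>z. norm z < 1 \<Longrightarrow> H z = F z" "\<And>z. norm z < 1 \<Longrightarrow> K z = G z"
proof -
  have FG: "\<And>z. norm z < 1 \<Longrightarrow> norm (F z) < 1" "\<And>z. norm z < 1 \<Longrightarrow> norm (G z) < 1"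
    "\<And>z. norm z < 1 \<Longrightarrow> G (F z) = z" "\<And>z. norm z < 1 \<Longrightarrow> F (G z) = z"
    "continuous_on unit_disc F" "continuous_on unit_disc G"
    using hom by (auto simp: homeomorphism_def)
  obtain d where d: "step_bounded d F" using step_bounded_of_unif_cont[OF F] FG by auto
  obtain d' where d': "step_bounded d' G" using step_bounded_of_unif_cont[OF G] FG by auto
  have uc: "uniformly_continuous_on unit_disc A"
    if A: "step_bounded a A" and B: "step_bounded b B" and cont: "continuous_on unit_disc A"
      and BA: "\<And>z. norm z < 1 \<Longrightarrow> B (A z) = z" for a b A B
  proof -
    obtain \<alpha> where \<alpha>: "0 < \<alpha>" and up: "\<And>z. norm z < 1 \<Longrightarrow>
        bdry_dist (A z) \<le> 2 * (1 / bdry_dist (B 0)) powr \<alpha> * bdry_dist z powr \<alpha>"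
      using bdry_dist_holder_upper[OF step_bounded_pos[OF B]] B step_bounded_norm[OF A] BA by metis
    have "bdry_dist (B 0) > 0" using step_bounded_norm[OF B, of 0] by (simp add: bdry_dist_pos_iff)
    then have C: "0 < 2 * (1 / bdry_dist (B 0)) powr \<alpha>" by simp
    obtain K where K: "0 < K"
      "\<And>z w. norm z < 1 \<Longrightarrow> norm w < 1 \<Longrightarrow> norm (A z - A w) \<le> K * norm (1 - cnj z * w) powr \<alpha>"
      using holder_estimate[OF step_bounded_pos[OF A] C \<alpha>] A up by metis
    show ?thesis by (rule uniformly_continuous_of_holder_estimate[OF cont \<alpha> K])
  qed
  obtain H K where HK: "homeomorphism (cball 0 1) (cball 0 1) H K"
    "\<And>z. norm z < 1 \<Longrightarrow> H z = F z" "\<And>z. norm z < 1 \<Longrightarrow> K z = G z"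
    using homeomorphism_disc_extend[OF hom uc[OF d d'] uc[OF d' d]] FG by metis
  have "homeomorphism unit_circle unit_circle H K"
    using HK FG by (intro homeomorphism_circle) auto
  then show thesis using that d d' HK by blast
qed

lemma linear_estimate_of_comparable:
  assumes F: "step_bounded d F" and C: "0 < C" "\<And>z. norm z < 1 \<Longrightarrow> bdry_dist (F z) \<le> C * bdry_dist z"
  obtains K where "0 < K"
    "\<And>z w. norm z < 1 \<Longrightarrow> norm w < 1 \<Longrightarrow> norm (F z - F w) \<le> K * norm (1 - cnj z * w)"
proof -
  have *: "bdry_dist (F z) \<le> C * bdry_dist z powr 1" if "norm z < 1" for z
    using C(2)[OF that] that by (simp add: bdry_dist_def)
  obtain K where K: "0 < K"
      "\<And>z w. norm z < 1 \<Longrightarrow> norm w < 1 \<Longrightarrow> norm (F z - F w) \<le> K * norm (1 - cnj z * w) powr 1"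
    using holder_estimate[OF step_bounded_pos[OF F] C(1), of 1] F * by (metis zero_less_one)
  show thesis by (rule that[OF K(1)]) (use K(2) in simp)
qed

lemma boundary_lipschitz_of_linear_estimate:
  assumes H: "continuous_on (cball 0 1) H"
    and K: "\<And>z w. norm z < 1 \<Longrightarrow> norm w < 1 \<Longrightarrow> norm (H z - H w) \<le> K * norm (1 - cnj z * w)"
    and \<zeta>: "norm \<zeta> = 1" "norm \<eta> = 1"
  shows "norm (H \<zeta> - H \<eta>) \<le> K * norm (\<zeta> - \<eta>)"
proof -
  note [continuous_intros] = continuous_on_compose_fst continuous_on_compose_snd H
  have "(\<lambda>p. norm (H (fst p) - H (snd p))) (\<zeta>, \<eta>) \<le> (\<lambda>p. K * norm (1 - cnj (fst p) * snd p)) (\<zeta>, \<eta>)"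
    by (rule le_on_closed_bidisc) (use K \<zeta> in \<open>auto intro!: continuous_intros\<close>)
  moreover have "(norm (1 - cnj \<zeta> * \<eta>))\<^sup>2 = (norm (\<zeta> - \<eta>))\<^sup>2" using norm_one_minus_sq[of \<zeta> \<eta>] \<zeta> by simp
  then have "norm (1 - cnj \<zeta> * \<eta>) = norm (\<zeta> - \<eta>)" by (simp add: power2_eq_iff_nonneg)
  ultimately show ?thesis by simp
qed

lemma comparable_bdry_dist_iff:
  assumes GF: "\<And>z. norm z < 1 \<Longrightarrow> norm (F z) < 1" "\<And>z. norm z < 1 \<Longrightarrow> norm (G z) < 1"
    "\<And>z. norm z < 1 \<Longrightarrow> G (F z) = z" "\<And>z. norm z < 1 \<Longrightarrow> F (G z) = z"
  shows "comparable_on unit_disc (\<lambda>z. bdry_dist (F z)) bdry_dist \<longleftrightarrow>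
    (\<exists>C>0. \<forall>z. norm z < 1 \<longrightarrow> bdry_dist (F z) \<le> C * bdry_dist z) \<and>
    (\<exists>C>0. \<forall>z. norm z < 1 \<longrightarrow> bdry_dist (G z) \<le> C * bdry_dist z)"
proof
  assume "comparable_on unit_disc (\<lambda>z. bdry_dist (F z)) bdry_dist"
  then obtain c C where cC: "0 < c" "c \<le> C" "\<And>z. norm z < 1 \<Longrightarrow> c * bdry_dist z \<le> bdry_dist (F z)"
    "\<And>z. norm z < 1 \<Longrightarrow> bdry_dist (F z) \<le> C * bdry_dist z"
    unfolding comparable_on_def by auto
  have "bdry_dist (G z) \<le> 1 / c * bdry_dist z" if "norm z < 1" for z
    using cC(3)[of "G z"] GF that cC(1) by (simp add: field_simps)
  then show "(\<exists>C>0. \<forall>z. norm z < 1 \<longrightarrow> bdry_dist (F z) \<le> C * bdry_dist z) \<and>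
    (\<exists>C>0. \<forall>z. norm z < 1 \<longrightarrow> bdry_dist (G z) \<le> C * bdry_dist z)"
    using cC(1,2,4) by (intro conjI exI[of _ C] exI[of _ "1 / c"]) auto
next
  assume "(\<exists>C>0. \<forall>z. norm z < 1 \<longrightarrow> bdry_dist (F z) \<le> C * bdry_dist z) \<and>
    (\<exists>C>0. \<forall>z. norm z < 1 \<longrightarrow> bdry_dist (G z) \<le> C * bdry_dist z)"
  then obtain C D where C: "C > 0" "\<And>z. norm z < 1 \<Longrightarrow> bdry_dist (F z) \<le> C * bdry_dist z"
    and D: "D > 0" "\<And>z. norm z < 1 \<Longrightarrow> bdry_dist (G z) \<le> D * bdry_dist z" by blast
  have 1: "1 / D * bdry_dist z \<le> bdry_dist (F z)" if "norm z < 1" for z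
    using D(2)[of "F z"] GF that D(1) by (simp add: field_simps)
  have 2: "1 / D \<le> C" using 1[of 0] C(2)[of 0] by (simp add: bdry_dist_def)
  show "comparable_on unit_disc (\<lambda>z. bdry_dist (F z)) bdry_dist"
    unfolding comparable_on_def using 1 2 C(2) D(1) by (intro exI[of _ "1 / D"] exI[of _ C]) auto
qed

theorem BiLip_boundary_iff_comparable:
  assumes "pseudohyp_unif_homeo \<Phi>"
  shows "boundary_map \<Phi> \<in> BiLip_circle \<longleftrightarrow> comparable_on unit_disc (\<lambda>z. bdry_dist (\<Phi> z)) bdry_dist"
proof -
  obtain G where hom: "homeomorphism unit_disc unit_disc \<Phi> G"
    and uc: "pseudohyp_unif_cont \<Phi>" "pseudohyp_unif_cont G"
    using assms unfolding pseudohyp_unif_homeo_def by blast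
  have FG: "\<And>z. norm z < 1 \<Longrightarrow> norm (\<Phi> z) < 1" "\<And>z. norm z < 1 \<Longrightarrow> norm (G z) < 1"
    "\<And>z. norm z < 1 \<Longrightarrow> G (\<Phi> z) = z" "\<And>z. norm z < 1 \<Longrightarrow> \<Phi> (G z) = z"
    using hom by (auto simp: homeomorphism_def)
  obtain d d' H K where d: "step_bounded d \<Phi>" and d': "step_bounded d' G"
    and HK: "homeomorphism (cball 0 1) (cball 0 1) H K"
    and circ: "homeomorphism unit_circle unit_circle H K"
    and H: "\<And>z. norm z < 1 \<Longrightarrow> H z = \<Phi> z" and K: "\<And>z. norm z < 1 \<Longrightarrow> K z = G z"
    using unif_homeo_extends[OF hom uc] by metis
  have cont: "continuous_on (cball 0 1) H" "continuous_on (cball 0 1) K"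
    using HK by (auto simp: homeomorphism_def)
  have circ': "\<And>\<zeta>. norm \<zeta> = 1 \<Longrightarrow> norm (H \<zeta>) = 1" "\<And>\<zeta>. norm \<zeta> = 1 \<Longrightarrow> norm (K \<zeta>) = 1"
    "\<And>\<zeta>. norm \<zeta> = 1 \<Longrightarrow> K (H \<zeta>) = \<zeta>" "\<And>\<zeta>. norm \<zeta> = 1 \<Longrightarrow> H (K \<zeta>) = \<zeta>"
    using circ by (auto simp: homeomorphism_def)
  have bm: "boundary_map \<Phi> \<in> BiLip_circle \<longleftrightarrow> (\<exists>L>0. \<forall>\<zeta>\<in>unit_circle. \<forall>\<eta>\<in>unit_circle.
       norm (H \<zeta> - H \<eta>) \<le> L * norm (\<zeta> - \<eta>) \<and> norm (\<zeta> - \<eta>) \<le> L * norm (H \<zeta> - H \<eta>))"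
  proof -
    have "boundary_map \<Phi> = restrict H unit_circle" by (rule boundary_map_eq[OF HK]) (rule H)
    then show ?thesis using BiLip_circle_iff[OF circ] by simp
  qed
  have cmp: "comparable_on unit_disc (\<lambda>z. bdry_dist (\<Phi> z)) bdry_dist \<longleftrightarrow>
    (\<exists>C>0. \<forall>z. norm z < 1 \<longrightarrow> bdry_dist (\<Phi> z) \<le> C * bdry_dist z) \<and>
    (\<exists>C>0. \<forall>z. norm z < 1 \<longrightarrow> bdry_dist (G z) \<le> C * bdry_dist z)"
    by (rule comparable_bdry_dist_iff) (use FG in auto)
  show ?thesis unfolding bm cmp
  proof
    assume "\<exists>L>0. \<forall>\<zeta>\<in>unit_circle. \<forall>\<eta>\<in>unit_circle.
       norm (H \<zeta> - H \<eta>) \<le> L * norm (\<zeta> - \<eta>) \<and> norm (\<zeta> - \<eta>) \<le> L * norm (H \<zeta> - H \<eta>)"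
    then obtain L where L: "L > 0"
      "\<And>\<zeta> \<eta>. norm \<zeta> = 1 \<Longrightarrow> norm \<eta> = 1 \<Longrightarrow> norm (H \<zeta> - H \<eta>) \<le> L * norm (\<zeta> - \<eta>)"
      "\<And>\<zeta> \<eta>. norm \<zeta> = 1 \<Longrightarrow> norm \<eta> = 1 \<Longrightarrow> norm (\<zeta> - \<eta>) \<le> L * norm (H \<zeta> - H \<eta>)" by auto
    have L': "norm (K \<zeta> - K \<eta>) \<le> L * norm (\<zeta> - \<eta>)" if "norm \<zeta> = 1" "norm \<eta> = 1" for \<zeta> \<eta>
      using L(3)[of "K \<zeta>" "K \<eta>"] circ' that by simp
    show "(\<exists>C>0. \<forall>z. norm z < 1 \<longrightarrow> bdry_dist (\<Phi> z) \<le> C * bdry_dist z) \<and>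
          (\<exists>C>0. \<forall>z. norm z < 1 \<longrightarrow> bdry_dist (G z) \<le> C * bdry_dist z)"
      using bdry_dist_le_of_boundary_lipschitz[OF d d' FG(3,4) cont(1) H circ'(1) L(1,2)]
        bdry_dist_le_of_boundary_lipschitz[OF d' d FG(4,3) cont(2) K circ'(2) L(1) L']
      by blast
  next
    assume "(\<exists>C>0. \<forall>z. norm z < 1 \<longrightarrow> bdry_dist (\<Phi> z) \<le> C * bdry_dist z) \<and>
          (\<exists>C>0. \<forall>z. norm z < 1 \<longrightarrow> bdry_dist (G z) \<le> C * bdry_dist z)"
    then obtain C D where C: "C > 0" "\<And>z. norm z < 1 \<Longrightarrow> bdry_dist (\<Phi> z) \<le> C * bdry_dist z"
      and D: "D > 0" "\<And>z. norm z < 1 \<Longrightarrow> bdry_dist (G z) \<le> D * bdry_dist z" by blast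
    obtain A where A: "0 < A"
      "\<And>z w. norm z < 1 \<Longrightarrow> norm w < 1 \<Longrightarrow> norm (\<Phi> z - \<Phi> w) \<le> A * norm (1 - cnj z * w)"
      using linear_estimate_of_comparable[OF d C] by metis
    obtain B where B: "0 < B"
      "\<And>z w. norm z < 1 \<Longrightarrow> norm w < 1 \<Longrightarrow> norm (G z - G w) \<le> B * norm (1 - cnj z * w)"
      using linear_estimate_of_comparable[OF d' D] by metis
    have HL: "norm (H \<zeta> - H \<eta>) \<le> A * norm (\<zeta> - \<eta>)" if "norm \<zeta> = 1" "norm \<eta> = 1" for \<zeta> \<eta>
      using A(2) H that by (intro boundary_lipschitz_of_linear_estimate cont) auto
    have KL: "norm (K \<zeta> - K \<eta>) \<le> B * norm (\<zeta> - \<eta>)" if "norm \<zeta> = 1" "norm \<eta> = 1" for \<zeta> \<eta>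
      using B(2) K that by (intro boundary_lipschitz_of_linear_estimate cont) auto
    show "\<exists>L>0. \<forall>\<zeta>\<in>unit_circle. \<forall>\<eta>\<in>unit_circle.
       norm (H \<zeta> - H \<eta>) \<le> L * norm (\<zeta> - \<eta>) \<and> norm (\<zeta> - \<eta>) \<le> L * norm (H \<zeta> - H \<eta>)"
    proof (intro exI[of _ "max A B"] conjI ballI)
      show "0 < max A B" using A by simp
    next
      fix \<zeta> \<eta> assume "\<zeta> \<in> unit_circle" "\<eta> \<in> unit_circle"
      then have n: "norm \<zeta> = 1" "norm \<eta> = 1" by auto
      have "A * norm (\<zeta> - \<eta>) \<le> max A B * norm (\<zeta> - \<eta>)" by (intro mult_right_mono) auto
      then show "norm (H \<zeta> - H \<eta>) \<le> max A B * norm (\<zeta> - \<eta>)" using HL[OF n] by linarith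
      have "norm (K (H \<zeta>) - K (H \<eta>)) \<le> B * norm (H \<zeta> - H \<eta>)" using n circ' by (intro KL) auto
      moreover have "B * norm (H \<zeta> - H \<eta>) \<le> max A B * norm (H \<zeta> - H \<eta>)" by (intro mult_right_mono) auto
      ultimately show "norm (\<zeta> - \<eta>) \<le> max A B * norm (H \<zeta> - H \<eta>)" using n circ' by simp
    qed
  qed
qed

section \<open>Maps that preserve interpolating sequences\<close>

lemma comparable_on_rescale:
  assumes "comparable_on S A B" and p: "\<And>z. z \<in> S \<Longrightarrow> 0 \<le> A z \<and> 0 \<le> B z"
    and k: "0 < k" "k \<le> K"
    and A: "\<And>z. z \<in> S \<Longrightarrow> k * A z \<le> A' z \<and> A' z \<le> K * A z"
    and B: "\<And>z. z \<in> S \<Longrightarrow> k * B z \<le> B' z \<and> B' z \<le> K * B z"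
  shows "comparable_on S A' B'"
proof -
  obtain c C where c: "0 < c" "c \<le> C" "\<And>z. z \<in> S \<Longrightarrow> c * B z \<le> A z \<and> A z \<le> C * B z"
    using assms(1) unfolding comparable_on_def by blast
  have K: "0 < K" using k by simp
  have "k * c / K * B' z \<le> A' z \<and> A' z \<le> K * C / k * B' z" if z: "z \<in> S" for z
  proof
    have "k * c / K * B' z \<le> k * c / K * (K * B z)" using B[OF z] c k K by (intro mult_left_mono) auto
    also have "\<dots> = k * (c * B z)" using K by simp
    also have "\<dots> \<le> k * A z" using c(3)[OF z] k by (intro mult_left_mono) auto
    finally show "k * c / K * B' z \<le> A' z" using A[OF z] by simp
    have "A' z \<le> K * A z" using A[OF z] by simp
    also have "\<dots> \<le> K * (C * B z)" using c(3)[OF z] K by (intro mult_left_mono) auto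
    also have "\<dots> = K * C / k * (k * B z)" using k by simp
    also have "\<dots> \<le> K * C / k * B' z" using B[OF z] c k K by (intro mult_left_mono) auto
    finally show "A' z \<le> K * C / k * B' z" .
  qed
  moreover have "0 < k * c / K" using c k K by simp
  moreover have "k * c / K \<le> K * C / k"
  proof -
    have "k * c / K \<le> c" using k K c by (simp add: field_simps)
    also have "c \<le> C" by (rule c(2))
    also have "C \<le> K * C / k" using k K c by (simp add: field_simps)
    finally show ?thesis .
  qed
  ultimately show ?thesis unfolding comparable_on_def by blast
qed

lemma comparable_sq_iff_bdry_dist:
  assumes F: "F \<in> unit_disc \<rightarrow> unit_disc"
  shows "comparable_on unit_disc (\<lambda>z. 1 - (norm (F z))\<^sup>2) (\<lambda>z. 1 - (norm z)\<^sup>2) \<longleftrightarrow>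
         comparable_on unit_disc (\<lambda>z. bdry_dist (F z)) bdry_dist"
proof -
  have n: "norm (F z) < 1" if "z \<in> unit_disc" for z using F that by auto
  have b: "0 \<le> bdry_dist z" "bdry_dist z \<le> 1 - (norm z)\<^sup>2" "1 - (norm z)\<^sup>2 \<le> 2 * bdry_dist z"
    if "norm z < 1" for z
    using bdry_dist_vs_sq[of z] that by (auto simp: bdry_dist_def)
  show ?thesis
  proof
    assume *: "comparable_on unit_disc (\<lambda>z. 1 - (norm (F z))\<^sup>2) (\<lambda>z. 1 - (norm z)\<^sup>2)"
    show "comparable_on unit_disc (\<lambda>z. bdry_dist (F z)) bdry_dist"
    proof (rule comparable_on_rescale[OF *, of "1/2" 1])
      fix z :: complex assume "z \<in> unit_disc"
      then have z: "norm z < 1" "norm (F z) < 1" using n by auto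
      show "0 \<le> 1 - (norm (F z))\<^sup>2 \<and> 0 \<le> 1 - (norm z)\<^sup>2"
        "1/2 * (1 - (norm (F z))\<^sup>2) \<le> bdry_dist (F z) \<and> bdry_dist (F z) \<le> 1 * (1 - (norm (F z))\<^sup>2)"
        "1/2 * (1 - (norm z)\<^sup>2) \<le> bdry_dist z \<and> bdry_dist z \<le> 1 * (1 - (norm z)\<^sup>2)"
        using b[OF z(1)] b[OF z(2)] by (simp_all add: field_simps)
    qed auto
  next
    assume *: "comparable_on unit_disc (\<lambda>z. bdry_dist (F z)) bdry_dist"
    show "comparable_on unit_disc (\<lambda>z. 1 - (norm (F z))\<^sup>2) (\<lambda>z. 1 - (norm z)\<^sup>2)"
    proof (rule comparable_on_rescale[OF *, of 1 2])
      fix z :: complex assume "z \<in> unit_disc"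
      then have z: "norm z < 1" "norm (F z) < 1" using n by auto
      show "0 \<le> bdry_dist (F z) \<and> 0 \<le> bdry_dist z"
        "1 * bdry_dist (F z) \<le> 1 - (norm (F z))\<^sup>2 \<and> 1 - (norm (F z))\<^sup>2 \<le> 2 * bdry_dist (F z)"
        "1 * bdry_dist z \<le> 1 - (norm z)\<^sup>2 \<and> 1 - (norm z)\<^sup>2 \<le> 2 * bdry_dist z"
        using b[OF z(1)] b[OF z(2)] by linarith+
    qed auto
  qed
qed

lemma carleson_seq_cong:
  assumes "\<And>j. j \<in> I \<Longrightarrow> l j = l' j"
  shows "carleson_seq I l \<longleftrightarrow> carleson_seq I l'"
  using assms by (simp add: carleson_seq_def Pi_iff)

text \<open>
In \<open>1 - \<rho>(z, w)\<^sup>2 = (1 - \<bar>z\<bar>\<^sup>2) (1 - \<bar>w\<bar>\<^sup>2) / \<bar>1 - cnj z w\<bar>\<^sup>2\<close> the numerators are comparable by the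
hypotheses on \<open>\<delta>\<close>, and \<open>\<bar>1 - cnj z w\<bar>\<close> is bounded by a multiple of \<open>\<bar>1 - cnj (F z) (F w)\<bar>\<close> by the
linear estimate for the inverse map.
\<close>

lemma one_minus_pseudohyp_sq_image_le:
  assumes FD: "\<And>z. norm z < 1 \<Longrightarrow> norm (F z) < 1"
    and C: "0 < C" "\<And>z. norm z < 1 \<Longrightarrow> bdry_dist (F z) \<le> C * bdry_dist z"
    and D: "0 < D" "\<And>z. norm z < 1 \<Longrightarrow> bdry_dist z \<le> D * bdry_dist (F z)"
    and B: "0 < B" "\<And>z w. norm z < 1 \<Longrightarrow> norm w < 1 \<Longrightarrow> norm (z - w) \<le> B * norm (1 - cnj (F z) * F w)"
    and z: "norm z < 1" and w: "norm w < 1"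
  shows "1 - (pseudohyp (F z) (F w))\<^sup>2 \<le> 4 * C\<^sup>2 * (2 * D + B)\<^sup>2 * (1 - (pseudohyp z w)\<^sup>2)"
proof -
  define s where "s = norm (1 - cnj z * w)"
  define t where "t = norm (1 - cnj (F z) * F w)"
  have s: "0 < s" using one_minus_cnj_mult_nonzero[of z w] z w by (simp add: s_def)
  have t: "0 < t" using one_minus_cnj_mult_nonzero[of "F z" "F w"] z w FD by (simp add: t_def less_imp_le)
  have "s \<le> 2 * bdry_dist z + norm (z - w)" unfolding s_def using z by (intro norm_one_minus_le) auto
  also have "\<dots> \<le> 2 * (D * bdry_dist (F z)) + B * t" using D(2)[OF z] B(2)[OF z w] by (simp add: t_def)
  also have "\<dots> \<le> 2 * (D * t) + B * t"
    using bdry_dist_le_norm_one_minus(1)[of "F z" "F w"] FD z w D(1) by (simp add: t_def less_imp_le)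
  finally have st: "s \<le> (2 * D + B) * t" by (simp add: algebra_simps)
  then have "s\<^sup>2 \<le> ((2 * D + B) * t)\<^sup>2" using s by (intro power_mono) auto
  moreover have "1 / t\<^sup>2 \<le> E\<^sup>2 / s\<^sup>2" if "s\<^sup>2 \<le> (E * t)\<^sup>2" for E
    using that s t by (simp add: field_simps power_mult_distrib)
  ultimately have st2: "1 / t\<^sup>2 \<le> (2 * D + B)\<^sup>2 / s\<^sup>2" by blast
  have up: "1 - (norm (F x))\<^sup>2 \<le> 2 * C * (1 - (norm x)\<^sup>2)" if x: "norm x < 1" for x
  proof -
    have "1 - (norm (F x))\<^sup>2 \<le> 2 * bdry_dist (F x)" using bdry_dist_vs_sq(2) FD[OF x] by simp
    also have "\<dots> \<le> 2 * (C * bdry_dist x)" using C(2)[OF x] by simp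
    also have "\<dots> \<le> 2 * (C * (1 - (norm x)\<^sup>2))" using bdry_dist_vs_sq(1)[of x] x C(1) by simp
    finally show ?thesis by simp
  qed
  have pos: "0 \<le> 1 - (norm x)\<^sup>2" if "norm x < 1" for x :: complex using that by (simp add: power_le_one)
  have "1 - (pseudohyp (F z) (F w))\<^sup>2 = (1 - (norm (F z))\<^sup>2) * (1 - (norm (F w))\<^sup>2) * (1 / t\<^sup>2)"
    by (simp add: one_minus_pseudohyp_sq FD z w t_def)
  also have "\<dots> \<le> (2 * C * (1 - (norm z)\<^sup>2)) * (2 * C * (1 - (norm w)\<^sup>2)) * ((2 * D + B)\<^sup>2 / s\<^sup>2)"
    using up z w st2 pos FD C(1) by (intro mult_mono mult_nonneg_nonneg) auto
  also have "\<dots> = 4 * C\<^sup>2 * (2 * D + B)\<^sup>2 * ((1 - (norm z)\<^sup>2) * (1 - (norm w)\<^sup>2) / s\<^sup>2)"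
    by (simp add: power2_eq_square)
  also have "\<dots> = 4 * C\<^sup>2 * (2 * D + B)\<^sup>2 * (1 - (pseudohyp z w)\<^sup>2)"
    by (simp only: one_minus_pseudohyp_sq[OF z w] s_def)
  finally show ?thesis .
qed

lemma carleson_seq_image:
  assumes FD: "\<And>z. norm z < 1 \<Longrightarrow> norm (F z) < 1" and GF: "\<And>z. norm z < 1 \<Longrightarrow> G (F z) = z"
    and G: "pseudohyp_unif_cont G" "step_bounded d G"
    and C: "0 < C" "\<And>z. norm z < 1 \<Longrightarrow> bdry_dist (F z) \<le> C * bdry_dist z"
    and D: "0 < D" "\<And>z. norm z < 1 \<Longrightarrow> bdry_dist (G z) \<le> D * bdry_dist z"
    and car: "carleson_seq I l"
  shows "carleson_seq I (F \<circ> l)"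
proof -
  have l: "l \<in> I \<rightarrow> unit_disc" using car by (simp add: carleson_seq_def)
  then have ln: "norm (l j) < 1" if "j \<in> I" for j using that by auto
  have Fl: "(F \<circ> l) \<in> I \<rightarrow> unit_disc" using ln FD by auto
  obtain B where B: "0 < B"
    "\<And>z w. norm z < 1 \<Longrightarrow> norm w < 1 \<Longrightarrow> norm (G z - G w) \<le> B * norm (1 - cnj z * w)"
    using linear_estimate_of_comparable[OF G(2) D] by metis
  have B': "norm (z - w) \<le> B * norm (1 - cnj (F z) * F w)" if "norm z < 1" "norm w < 1" for z w
    using B(2)[of "F z" "F w"] that FD GF by simp
  have D': "bdry_dist z \<le> D * bdry_dist (F z)" if "norm z < 1" for z
    using D(2)[of "F z"] that FD GF by simp
  obtain e S where e: "e > 0" "\<And>j k. j \<in> I \<Longrightarrow> k \<in> I \<Longrightarrow> j \<noteq> k \<Longrightarrow> e \<le> pseudohyp (l j) (l k)"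
    and S: "\<And>j A. j \<in> I \<Longrightarrow> finite A \<Longrightarrow> A \<subseteq> I - {j} \<Longrightarrow> (\<Sum>k\<in>A. 1 - (pseudohyp (l j) (l k))\<^sup>2) \<le> S"
    using uniformly_separated_imp_sum_bounded[OF carleson_seq_imp_uniformly_separated[OF car] l] by metis
  obtain t where t: "t > 0" "\<And>u v. norm u < 1 \<Longrightarrow> norm v < 1 \<Longrightarrow> pseudohyp u v < t \<Longrightarrow> pseudohyp (G u) (G v) < e"
    using G(1) e(1) unfolding pseudohyp_unif_cont_def by fastforce
  define M where "M = 4 * C\<^sup>2 * (2 * D + B)\<^sup>2"
  have M: "0 \<le> M" by (simp add: M_def)
  have "uniformly_separated I (F \<circ> l)"
  proof (rule sum_bounded_imp_uniformly_separated[OF t(1) _ _ Fl])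
    fix j k assume jk: "j \<in> I" "k \<in> I" "j \<noteq> k"
    show "t \<le> pseudohyp ((F \<circ> l) j) ((F \<circ> l) k)"
    proof (rule ccontr)
      assume "\<not> ?thesis"
      then have "pseudohyp (G (F (l j))) (G (F (l k))) < e" using jk ln FD by (intro t(2)) auto
      then show False using e(2)[OF jk] GF ln jk by simp
    qed
  next
    fix j A assume A: "j \<in> I" "finite A" "A \<subseteq> I - {j}"
    have "(\<Sum>k\<in>A. 1 - (pseudohyp ((F \<circ> l) j) ((F \<circ> l) k))\<^sup>2) \<le> (\<Sum>k\<in>A. M * (1 - (pseudohyp (l j) (l k))\<^sup>2))"
      unfolding o_def M_def using A
      by (intro sum_mono one_minus_pseudohyp_sq_image_le[OF FD C D(1) D' B(1) B'] ln) auto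
    also have "\<dots> = M * (\<Sum>k\<in>A. 1 - (pseudohyp (l j) (l k))\<^sup>2)" by (rule sum_distrib_left[symmetric])
    also have "\<dots> \<le> M * S" using S[OF A] M by (intro mult_left_mono)
    finally show "(\<Sum>k\<in>A. 1 - (pseudohyp ((F \<circ> l) j) ((F \<circ> l) k))\<^sup>2) \<le> M * S" .
  qed
  then show ?thesis by (rule uniformly_separated_imp_carleson_seq[OF Fl])
qed

lemma one_minus_pseudohyp_sq_tendsto_0:
  assumes a: "norm a < 1" and b: "\<And>n. norm (b n) < 1" "(\<lambda>n. bdry_dist (b n)) \<longlonglongrightarrow> 0"
  shows "(\<lambda>n. 1 - (pseudohyp a (b n))\<^sup>2) \<longlonglongrightarrow> 0"
proof (rule tendsto_sandwich)
  have a0: "0 < bdry_dist a" using a by (simp add: bdry_dist_pos_iff)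
  show "\<forall>\<^sub>F n in sequentially. 0 \<le> 1 - (pseudohyp a (b n))\<^sup>2"
    using pseudohyp_lt_1[OF a b(1)] by (auto simp: power_le_one less_imp_le)
  show "\<forall>\<^sub>F n in sequentially. 1 - (pseudohyp a (b n))\<^sup>2 \<le> 2 * bdry_dist (b n) / (bdry_dist a)\<^sup>2"
  proof (rule always_eventually, rule allI)
    fix n
    have "(1 - (norm a)\<^sup>2) * (1 - (norm (b n))\<^sup>2) \<le> 1 * (2 * bdry_dist (b n))"
      using bdry_dist_vs_sq(2)[of "b n"] a b(1)[of n] by (intro mult_mono) (auto simp: power_le_one)
    moreover have "(bdry_dist a)\<^sup>2 \<le> (norm (1 - cnj a * b n))\<^sup>2"
      using bdry_dist_le_norm_one_minus(1)[of a "b n"] a b(1)[of n] a0 by (intro power_mono) auto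
    ultimately show "1 - (pseudohyp a (b n))\<^sup>2 \<le> 2 * bdry_dist (b n) / (bdry_dist a)\<^sup>2"
      unfolding one_minus_pseudohyp_sq[OF a b(1)] using a0 b(1)[of n]
      by (intro frac_le) (auto simp: bdry_dist_def)
  qed
  show "(\<lambda>n. 2 * bdry_dist (b n) / (bdry_dist a)\<^sup>2) \<longlonglongrightarrow> 0"
    using tendsto_divide[OF tendsto_mult[OF tendsto_const[of 2] b(2)] tendsto_const[of "(bdry_dist a)\<^sup>2"]] a0
    by simp
qed simp

text \<open>
For a fixed point \<open>a\<close>, \<open>1 - \<rho>(a, b)\<^sup>2\<close> tends to 0 as \<open>b\<close> approaches the circle. Choosing the indices
one after the other makes this quantity smaller than \<open>(1/4)\<^sup>k\<close> between the \<open>k\<close>-th pair and all earlier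
ones; the two members of a pair are separated by assumption. The even and odd places of the
resulting sequence hold the first and second members of the chosen pairs.
\<close>

lemma sparse_pairs_uniformly_separated:
  fixes c :: "bool \<Rightarrow> nat \<Rightarrow> complex"
  assumes c: "\<And>b n. norm (c b n) < 1" and lim: "\<And>b. (\<lambda>n. bdry_dist (c b n)) \<longlonglongrightarrow> 0"
    and e: "0 < e" "\<And>n. e \<le> pseudohyp (c True n) (c False n)"
  obtains r where "strict_mono (r :: nat \<Rightarrow> nat)"
    "uniformly_separated UNIV (\<lambda>j. c (even j) (r (j div 2)))"
proof -
  have "\<exists>r. \<forall>k. True \<and> (r k < r (Suc k) \<and> (\<forall>m\<le>r k. \<forall>b b'.
          1 - (pseudohyp (c b m) (c b' (r (Suc k))))\<^sup>2 < (1/4) ^ Suc k))"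
  proof (rule dependent_nat_choice)
    fix x k :: nat
    have "\<forall>\<^sub>F n in sequentially. \<forall>m\<in>{..x}. \<forall>b\<in>UNIV. \<forall>b'\<in>UNIV.
           1 - (pseudohyp (c b m) (c b' n))\<^sup>2 < (1/4) ^ Suc k"
    proof (intro eventually_ball_finite ballI)
      fix m b b'
      show "\<forall>\<^sub>F n in sequentially. 1 - (pseudohyp (c b m) (c b' n))\<^sup>2 < (1/4) ^ Suc k"
        by (rule order_tendstoD(2)[OF one_minus_pseudohyp_sq_tendsto_0[OF c c lim]]) simp
    qed auto
    then have "\<forall>\<^sub>F n in sequentially. x < n \<and> (\<forall>m\<in>{..x}. \<forall>b\<in>UNIV. \<forall>b'\<in>UNIV.
           1 - (pseudohyp (c b m) (c b' n))\<^sup>2 < (1/4) ^ Suc k)"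
      by (rule eventually_conj[OF eventually_gt_at_top])
    from eventually_happens'[OF sequentially_bot this]
    show "\<exists>y. True \<and> (x < y \<and> (\<forall>m\<le>x. \<forall>b b'. 1 - (pseudohyp (c b m) (c b' y))\<^sup>2 < (1/4) ^ Suc k))"
      by auto
  qed auto
  then obtain r where r: "\<And>k. r k < r (Suc k)"
    "\<And>k m b b'. m \<le> r k \<Longrightarrow> 1 - (pseudohyp (c b m) (c b' (r (Suc k))))\<^sup>2 < (1/4) ^ Suc k"
    by blast
  have mono: "strict_mono r" using r(1) by (simp add: strict_mono_Suc_iff)
  define l where "l j = c (even j) (r (j div 2))" for j
  have lD: "l \<in> UNIV \<rightarrow> unit_disc" using c by (auto simp: l_def)
  have less: "1 - (pseudohyp (l i) (l k))\<^sup>2 \<le> (1/4) ^ (k div 2)" if ik: "i div 2 < k div 2" for i k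
  proof -
    obtain m where m: "k div 2 = Suc m" "i div 2 \<le> m" using ik by (cases "k div 2") auto
    have "r (i div 2) \<le> r m" using mono m(2) by (simp add: strict_mono_less_eq)
    from r(2)[OF this, of "even i" "even k"] show ?thesis unfolding l_def m(1) by simp
  qed
  have far: "1 - (pseudohyp (l i) (l k))\<^sup>2 \<le> (1/4) ^ max (i div 2) (k div 2)" if ik: "i div 2 \<noteq> k div 2" for i k
  proof (cases "i div 2 < k div 2")
    case True
    then show ?thesis using less[of i k] by (simp add: max_def)
  next
    case False
    then show ?thesis using less[of k i] ik by (simp add: max_def pseudohyp_commute)
  qed
  have near: "e \<le> pseudohyp (l i) (l k)" if ik: "i \<noteq> k" "i div 2 = k div 2" for i k
  proof -
    have "even i \<noteq> even k" using ik by (metis dvd_mult_div_cancel odd_two_times_div_two_succ)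
    then show ?thesis using e(2)[of "r (i div 2)"] ik(2)
      by (cases "even i") (auto simp: l_def pseudohyp_commute)
  qed
  have "uniformly_separated UNIV l"
  proof (rule sum_bounded_imp_uniformly_separated[OF _ _ _ lD])
    show "0 < min e (1/2)" using e by simp
    fix j k :: nat assume jk: "j \<noteq> k"
    show "min e (1/2) \<le> pseudohyp (l j) (l k)"
    proof (cases "j div 2 = k div 2")
      case True
      then show ?thesis using near[OF jk] by simp
    next
      case False
      then have "max (j div 2) (k div 2) \<ge> 1" by auto
      then have "(1/4 :: real) ^ max (j div 2) (k div 2) \<le> (1/4) ^ 1" by (intro power_decreasing) auto
      then have "(1/2)\<^sup>2 \<le> (pseudohyp (l j) (l k))\<^sup>2" using far[OF False] by (simp add: power2_eq_square)
      then have "1/2 \<le> pseudohyp (l j) (l k)" by (rule power2_le_imp_le) simp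
      then show ?thesis by simp
    qed
  next
    fix j :: nat and A :: "nat set" assume A: "finite A"
    have term_le: "1 - (pseudohyp (l j) (l k))\<^sup>2 \<le> (if k div 2 = j div 2 then 1 else 0) + 2 * (1/2) ^ k" for k
    proof (cases "k div 2 = j div 2")
      case True
      have "0 \<le> (pseudohyp (l j) (l k))\<^sup>2" "0 \<le> 2 * (1/2 :: real) ^ k" by auto
      then show ?thesis unfolding if_P[OF True] by linarith
    next
      case False
      have "1 - (pseudohyp (l j) (l k))\<^sup>2 \<le> (1/4) ^ max (j div 2) (k div 2)" using far[of j k] False by simp
      also have "\<dots> \<le> (1/4) ^ (k div 2)" by (intro power_decreasing) auto
      also have "\<dots> = ((1/2)\<^sup>2) ^ (k div 2)" by (simp add: power2_eq_square)
      also have "\<dots> = 2 * (1/2) ^ Suc (2 * (k div 2))" by (simp flip: power_mult)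
      also have "\<dots> \<le> 2 * (1/2) ^ k" by (intro mult_left_mono power_decreasing) auto
      finally show ?thesis using False by simp
    qed
    have "(\<Sum>k\<in>A. 1 - (pseudohyp (l j) (l k))\<^sup>2) \<le> (\<Sum>k\<in>A. (if k div 2 = j div 2 then 1 else 0) + 2 * (1/2) ^ k)"
      by (intro sum_mono term_le)
    also have "\<dots> = (\<Sum>k\<in>A. if k div 2 = j div 2 then 1 else 0) + 2 * (\<Sum>k\<in>A. (1/2) ^ k)"
      by (simp add: sum.distrib sum_distrib_left)
    also have "(\<Sum>k\<in>A. if k div 2 = j div 2 then 1 else 0) = real (card {k\<in>A. k div 2 = j div 2})"
      using A by (simp add: sum.If_cases Int_def)
    also have "card {k\<in>A. k div 2 = j div 2} \<le> card {2 * (j div 2), Suc (2 * (j div 2))}"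
    proof (rule card_mono)
      have "k = 2 * (j div 2) \<or> k = Suc (2 * (j div 2))" if "k div 2 = j div 2" for k
        using that by presburger
      then show "{k\<in>A. k div 2 = j div 2} \<subseteq> {2 * (j div 2), Suc (2 * (j div 2))}" by blast
    qed simp
    also have "\<dots> \<le> 2" by (simp add: card_insert_if)
    also have "(\<Sum>k\<in>A. (1/2 :: real) ^ k) \<le> (\<Sum>k. (1/2) ^ k)"
      using A by (intro sum_le_suminf) (auto intro: summable_geometric)
    also have "(\<Sum>k. (1/2 :: real) ^ k) = 2" by (subst suminf_geometric) auto
    finally show "(\<Sum>k\<in>A. 1 - (pseudohyp (l j) (l k))\<^sup>2) \<le> 6" by simp
  qed
  then show thesis using that[OF mono] by (simp add: l_def[abs_def])
qed

text \<open>
Pairs that violate uniform continuity must tend to the circle, since on compact subsets of the disc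
continuity is uniform. The images of a sparse subsequence of these pairs form an interpolating
sequence, and by hypothesis so do the pairs themselves, which is impossible because their two members
approach each other.
\<close>

lemma pseudohyp_unif_cont_of_carleson:
  assumes cont: "continuous_on unit_disc F" and FD: "\<And>z. norm z < 1 \<Longrightarrow> norm (F z) < 1"
    and C: "\<And>z. norm z < 1 \<Longrightarrow> bdry_dist (F z) \<le> C * bdry_dist z"
    and car: "\<And>l. l \<in> UNIV \<rightarrow> unit_disc \<Longrightarrow> carleson_seq UNIV (F \<circ> l) \<Longrightarrow> carleson_seq UNIV l"
  shows "pseudohyp_unif_cont F"
proof (rule ccontr)
  assume "\<not> ?thesis"
  then obtain e where e: "e > 0" and neg: "\<And>d. d > 0 \<Longrightarrow> \<exists>z w. norm z < 1 \<and> norm w < 1 \<and>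
      pseudohyp z w < d \<and> e \<le> pseudohyp (F z) (F w)"
    unfolding pseudohyp_unif_cont_def by (metis mem_ball_0 not_le)
  have "\<forall>n. \<exists>z w. norm z < 1 \<and> norm w < 1 \<and>
      pseudohyp z w < inverse (Suc n) \<and> e \<le> pseudohyp (F z) (F w)"
    by (intro allI neg) simp
  then obtain z w where zw: "\<And>n. norm (z n) < 1" "\<And>n. norm (w n) < 1"
    "\<And>n. pseudohyp (z n) (w n) < inverse (Suc n)" "\<And>n. e \<le> pseudohyp (F (z n)) (F (w n))" by metis
  have half: "pseudohyp (z n) (w n) \<le> 1/2" if "n \<ge> 1" for n
  proof -
    have "inverse (real (Suc n)) \<le> 1/2" using that by (simp add: field_simps)
    then show ?thesis using zw(3)[of n] by simp
  qed
  have lim_z: "(\<lambda>n. bdry_dist (z n)) \<longlonglongrightarrow> 0"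
  proof (rule LIMSEQ_I)
    fix s :: real assume s: "s > 0"
    \<comment> \<open>The radius leaves room for \<open>w n\<close>, since \<open>\<delta>(z n) \<le> 3 \<delta>(w n)\<close>.\<close>
    let ?B = "cball 0 (1 - s / 3) :: complex set"
    have BD: "?B \<subseteq> unit_disc" using s by auto
    have FB: "norm (F x) < 1" if "x \<in> ?B" for x using FD BD that by auto
    have contB: "continuous_on ?B F" using cont BD by (rule continuous_on_subset)
    have "continuous_on (?B \<times> ?B) (\<lambda>p. pseudohyp (F (fst p)) (F (snd p)))"
      unfolding pseudohyp_def
      using one_minus_cnj_mult_nonzero FB
      by (intro continuous_intros continuous_on_compose_fst[OF contB] continuous_on_compose_snd[OF contB])
         (auto simp: less_imp_le)
    then have "uniformly_continuous_on (?B \<times> ?B) (\<lambda>p. pseudohyp (F (fst p)) (F (snd p)))"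
      by (intro compact_uniformly_continuous compact_Times) auto
    then obtain d where d: "d > 0" "\<And>p q. p \<in> ?B \<times> ?B \<Longrightarrow> q \<in> ?B \<times> ?B \<Longrightarrow> dist q p < d \<Longrightarrow>
        dist (pseudohyp (F (fst q)) (F (snd q))) (pseudohyp (F (fst p)) (F (snd p))) < e"
      using e unfolding uniformly_continuous_on_def by metis
    obtain N where N: "2 / d < real N" using reals_Archimedean2 by blast
    have "norm (bdry_dist (z n) - 0) < s" if n: "n \<ge> max 1 N" for n
    proof (rule ccontr)
      assume "\<not> ?thesis"
      then have sz: "s \<le> bdry_dist (z n)" using zw(1)[of n] by (simp add: bdry_dist_def)
      have "bdry_dist (z n) \<le> 3 * bdry_dist (w n)"
        using half[of n] n zw by (intro pseudohyp_half_imp(2)) (auto simp: pseudohyp_commute)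
      then have B: "z n \<in> ?B" "w n \<in> ?B" using sz s by (auto simp: bdry_dist_def)
      have "norm (1 - cnj (z n) * w n) \<le> 1 + norm (z n) * norm (w n)"
        using norm_triangle_ineq4[of 1 "cnj (z n) * w n"] by (simp add: norm_mult)
      also have "\<dots> \<le> 2" using zw(1,2)[of n] by (simp add: mult_le_one less_imp_le)
      finally have "norm (z n - w n) \<le> inverse (Suc n) * 2"
        unfolding norm_diff_eq_pseudohyp[OF zw(1,2)] using zw(3)[of n] by (intro mult_mono) auto
      also have "\<dots> < d"
      proof -
        have "2 < d * real N" using N d(1) by (simp add: field_simps)
        also have "\<dots> \<le> d * real (Suc n)" using n d(1) by (intro mult_left_mono) auto
        finally show ?thesis by (simp add: field_simps)
      qed
      finally have "dist (z n, w n) (z n, z n) < d"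
        by (simp add: dist_Pair_Pair dist_norm norm_minus_commute)
      then have "dist (pseudohyp (F (z n)) (F (w n))) (pseudohyp (F (z n)) (F (z n))) < e"
        using d(2)[of "(z n, z n)" "(z n, w n)"] B by simp
      moreover have "pseudohyp (F (z n)) (F (z n)) = 0" by (simp add: pseudohyp_def)
      ultimately show False using zw(4)[of n] by (simp add: dist_real_def)
    qed
    then show "\<exists>N. \<forall>n\<ge>N. norm (bdry_dist (z n) - 0) < s" by blast
  qed
  have pos: "0 \<le> bdry_dist x" if "norm x < 1" for x using that by (simp add: bdry_dist_def)
  have lim_w: "(\<lambda>n. bdry_dist (w n)) \<longlonglongrightarrow> 0"
  proof (rule tendsto_sandwich[of "\<lambda>_. 0" _ _ "\<lambda>n. 3 * bdry_dist (z n)"])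
    show "\<forall>\<^sub>F n in sequentially. bdry_dist (w n) \<le> 3 * bdry_dist (z n)"
      using pseudohyp_half_imp(2)[OF zw(1,2) half] by (auto simp: eventually_at_top_linorder)
    show "(\<lambda>n. 3 * bdry_dist (z n)) \<longlonglongrightarrow> 0" using tendsto_mult_left[OF lim_z, of 3] by simp
    show "\<forall>\<^sub>F n in sequentially. 0 \<le> bdry_dist (w n)" using pos zw(2) by simp
  qed simp
  have lim_F: "(\<lambda>n. bdry_dist (F (x n))) \<longlonglongrightarrow> 0"
    if x: "\<And>n. norm (x n) < 1" "(\<lambda>n. bdry_dist (x n)) \<longlonglongrightarrow> 0" for x
  proof (rule tendsto_sandwich[of "\<lambda>_. 0" _ _ "\<lambda>n. C * bdry_dist (x n)"])
    show "\<forall>\<^sub>F n in sequentially. bdry_dist (F (x n)) \<le> C * bdry_dist (x n)" using C x(1) by simp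
    show "(\<lambda>n. C * bdry_dist (x n)) \<longlonglongrightarrow> 0" using tendsto_mult_left[OF x(2), of C] by simp
    show "\<forall>\<^sub>F n in sequentially. 0 \<le> bdry_dist (F (x n))" using pos FD x(1) by simp
  qed simp
  define x where "x b n = (if b then z n else w n)" for b n
  have x: "norm (x b n) < 1" "(\<lambda>n. bdry_dist (x b n)) \<longlonglongrightarrow> 0" for b n
    using zw(1,2) lim_z lim_w by (cases b; simp add: x_def)+
  obtain r where r: "strict_mono (r :: nat \<Rightarrow> nat)"
    "uniformly_separated UNIV (\<lambda>j. F (x (even j) (r (j div 2))))"
  proof (rule sparse_pairs_uniformly_separated[of "\<lambda>b n. F (x b n)" e])
    show "e \<le> pseudohyp (F (x True n)) (F (x False n))" for n using zw(4) by (simp add: x_def)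
  qed (use x FD lim_F e in auto)
  define l where "l j = x (even j) (r (j div 2))" for j
  have lD: "l \<in> UNIV \<rightarrow> unit_disc" "F \<circ> l \<in> UNIV \<rightarrow> unit_disc" using x FD by (auto simp: l_def)
  have "carleson_seq UNIV (F \<circ> l)"
    using r(2) lD(2) by (intro uniformly_separated_imp_carleson_seq) (simp_all add: o_def l_def)
  then have "uniformly_separated UNIV l"
    using car lD(1) by (intro carleson_seq_imp_uniformly_separated) auto
  then obtain d S where d: "d > 0" "\<And>j k. j \<noteq> k \<Longrightarrow> d \<le> pseudohyp (l j) (l k)"
    using uniformly_separated_imp_sum_bounded[OF _ lD(1)] by (metis UNIV_I)
  obtain n where n: "inverse (Suc n) < d" using reals_Archimedean[OF d(1)] by blast
  have "d \<le> pseudohyp (l (2 * n)) (l (Suc (2 * n)))" by (rule d(2)) simp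
  also have "\<dots> = pseudohyp (z (r n)) (w (r n))" by (simp add: l_def x_def)
  also have "\<dots> < inverse (Suc (r n))" by (rule zw(3))
  also have "\<dots> \<le> inverse (Suc n)" using seq_suble[OF r(1), of n] by (simp add: field_simps)
  finally show False using n by simp
qed

text \<open>
The image is open by invariance of domain and relatively closed because points of the image near
\<open>u\<close> come from a compact part of the disc.
\<close>

lemma homeomorphism_disc_of_proper_inj:
  assumes cont: "continuous_on unit_disc F" and FD: "F \<in> unit_disc \<rightarrow> unit_disc"
    and inj: "inj_on F unit_disc"
    and C: "0 < C" "\<And>z. norm z < 1 \<Longrightarrow> bdry_dist (F z) \<le> C * bdry_dist z"
  obtains G where "homeomorphism unit_disc unit_disc F G"
proof -
  let ?S = "F ` unit_disc"
  have sub: "?S \<subseteq> unit_disc" using FD by auto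
  have op: "open ?S" by (rule invariance_of_domain[OF cont _ inj]) simp
  have "u \<in> ?S" if u: "u \<in> closure ?S" "u \<in> unit_disc" for u
  proof (rule ccontr)
    assume nu: "u \<notin> ?S"
    have u0: "0 < bdry_dist u" using u(2) by (simp add: bdry_dist_pos_iff)
    define s where "s = bdry_dist u / (2 * C)"
    have s: "0 < s" using u0 C(1) by (simp add: s_def)
    have TD: "cball 0 (1 - s) \<subseteq> (unit_disc :: complex set)" using s by auto
    have "compact (F ` cball 0 (1 - s))"
      using cont TD by (intro compact_continuous_image) (auto intro: continuous_on_subset)
    then have "open (- (F ` cball 0 (1 - s)))" using compact_imp_closed by blast
    moreover have "u \<in> - (F ` cball 0 (1 - s))" using nu TD by auto
    ultimately obtain r where r: "r > 0" "ball u r \<subseteq> - (F ` cball 0 (1 - s))"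
      by (meson open_contains_ball)
    obtain v where v: "v \<in> ?S" "dist v u < min r (bdry_dist u / 2)"
      using u(1) r(1) u0 unfolding closure_approachable by (metis half_gt_zero min_less_iff_conj)
    then obtain z where z: "norm z < 1" "v = F z" by auto
    have "v \<in> ball u r" using v by (simp add: dist_commute)
    then have "z \<notin> cball 0 (1 - s)" using r z by auto
    then have "bdry_dist z < s" by (simp add: bdry_dist_def)
    then have "C * bdry_dist z < bdry_dist u / 2" using C(1) by (simp add: s_def field_simps)
    moreover have "norm v - norm u \<le> dist v u" unfolding dist_norm by (rule norm_triangle_ineq2)
    ultimately show False using C(2)[OF z(1)] z(2) v(2) by (simp add: bdry_dist_def)
  qed
  then have "?S = unit_disc \<inter> closure ?S" using sub closure_subset[of ?S] by blast
  then have "closedin (top_of_set unit_disc) ?S" by (metis closed_closure closedin_closed_Int)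
  moreover have "openin (top_of_set unit_disc) ?S" using op sub by (simp add: open_openin_trans)
  moreover have "connected (unit_disc :: complex set)" by simp
  ultimately have "?S = {} \<or> ?S = unit_disc" unfolding connected_clopen by blast
  then have "?S = unit_disc" by auto
  then show thesis using invariance_of_domain_homeomorphism[OF _ cont _ inj] that by (metis open_ball order_refl)
qed

lemma carleson_seq_pair_iff:
  assumes "norm (l 0) < 1" "norm (l 1) < 1"
  shows "carleson_seq {0, 1} l \<longleftrightarrow> l 0 \<noteq> l (1::nat)"
proof
  assume "carleson_seq {0, 1} l"
  then obtain f :: "complex \<Rightarrow> complex" where "f (l 0) = 0" "f (l 1) = 1"
    unfolding carleson_seq_def
    by (elim conjE allE[of _ "\<lambda>j. if j = 0 then 0 else 1"]) auto
  then show "l 0 \<noteq> l 1" by auto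
next
  assume ne: "l 0 \<noteq> l 1"
  have l: "l \<in> {0, 1} \<rightarrow> unit_disc" using assms by auto
  have "0 < pseudohyp (l 0) (l 1)" using ne assms by (metis pseudohyp_eq_0_iff pseudohyp_nonneg less_eq_real_def)
  then have "uniformly_separated {0, 1} l"
  proof (rule sum_bounded_imp_uniformly_separated[OF _ _ _ l])
    fix j k :: nat assume "j \<in> {0, 1}" "k \<in> {0, 1}" "j \<noteq> k"
    then show "pseudohyp (l 0) (l 1) \<le> pseudohyp (l j) (l k)" by (auto simp: pseudohyp_commute)
  next
    fix j :: nat and A assume A: "finite A" "A \<subseteq> {0, 1} - {j}"
    have "(\<Sum>k\<in>A. 1 - (pseudohyp (l j) (l k))\<^sup>2) \<le> (\<Sum>k\<in>A. 1)" by (intro sum_mono) simp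
    also have "\<dots> = real (card A)" by simp
    also have "card A \<le> card {0 :: nat, 1}" using A by (intro card_mono) auto
    finally show "(\<Sum>k\<in>A. 1 - (pseudohyp (l j) (l k))\<^sup>2) \<le> 2" by simp
  qed
  then show "carleson_seq {0, 1} l" by (rule uniformly_separated_imp_carleson_seq[OF l])
qed

theorem comparable_carleson_iff_comparable_homeo:
  assumes cont: "continuous_on unit_disc \<Phi>" and D: "\<Phi> \<in> unit_disc \<rightarrow> unit_disc"
  shows "\<Phi> \<in> comparable_carleson_equiv_maps \<longleftrightarrow>
    pseudohyp_unif_homeo \<Phi> \<and> comparable_on unit_disc (\<lambda>z. bdry_dist (\<Phi> z)) bdry_dist"
proof
  assume "\<Phi> \<in> comparable_carleson_equiv_maps"
  then have car: "\<And>I l. l \<in> I \<rightarrow> unit_disc \<Longrightarrow> carleson_seq I l \<longleftrightarrow> carleson_seq I (\<Phi> \<circ> l)"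
    and comp: "comparable_on unit_disc (\<lambda>z. bdry_dist (\<Phi> z)) bdry_dist"
    by (auto simp: comparable_carleson_equiv_maps_def carleson_equiv_maps_def comparable_sq_iff_bdry_dist)
  obtain c C where cC: "0 < c" "c \<le> C" "\<And>z. z \<in> unit_disc \<Longrightarrow> c * bdry_dist z \<le> bdry_dist (\<Phi> z)"
    "\<And>z. z \<in> unit_disc \<Longrightarrow> bdry_dist (\<Phi> z) \<le> C * bdry_dist z"
    using comp unfolding comparable_on_def by blast
  have C: "0 < C" "\<And>z. norm z < 1 \<Longrightarrow> bdry_dist (\<Phi> z) \<le> C * bdry_dist z" using cC by auto
  have inj: "inj_on \<Phi> unit_disc"
  proof (rule inj_onI, rule ccontr)
    fix z w assume zw: "z \<in> unit_disc" "w \<in> unit_disc" "\<Phi> z = \<Phi> w" "z \<noteq> w"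
    define l where "l j = (if j = (0::nat) then z else w)" for j
    have "carleson_seq {0, 1} l" using zw by (subst carleson_seq_pair_iff) (auto simp: l_def)
    then have "carleson_seq {0, 1} (\<Phi> \<circ> l)" using car[of l "{0, 1}"] zw by (auto simp: l_def)
    moreover have "norm ((\<Phi> \<circ> l) 0) < 1" "norm ((\<Phi> \<circ> l) 1) < 1" using D zw by (auto simp: l_def)
    ultimately have "(\<Phi> \<circ> l) 0 \<noteq> (\<Phi> \<circ> l) 1" using carleson_seq_pair_iff by blast
    then show False using zw by (simp add: l_def)
  qed
  obtain G where hom: "homeomorphism unit_disc unit_disc \<Phi> G"
    using homeomorphism_disc_of_proper_inj[OF cont D inj C] by metis
  then have FG: "\<And>z. norm z < 1 \<Longrightarrow> norm (\<Phi> z) < 1" "\<And>z. norm z < 1 \<Longrightarrow> norm (G z) < 1"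
    "\<And>z. norm z < 1 \<Longrightarrow> G (\<Phi> z) = z" "\<And>z. norm z < 1 \<Longrightarrow> \<Phi> (G z) = z"
    "continuous_on unit_disc G"
    by (auto simp: homeomorphism_def)
  have "pseudohyp_unif_cont \<Phi>"
    using car by (intro pseudohyp_unif_cont_of_carleson[OF cont FG(1) C(2)]) auto
  moreover have "pseudohyp_unif_cont G"
  proof (rule pseudohyp_unif_cont_of_carleson[OF FG(5) FG(2), of "1 / c"])
    fix z :: complex assume z: "norm z < 1"
    show "bdry_dist (G z) \<le> 1 / c * bdry_dist z"
      using cC(3)[of "G z"] FG z cC(1) by (simp add: field_simps)
  next
    fix l :: "nat \<Rightarrow> complex" assume l: "l \<in> UNIV \<rightarrow> unit_disc" "carleson_seq UNIV (G \<circ> l)"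
    have "(G \<circ> l) \<in> UNIV \<rightarrow> unit_disc" using l(1) FG(2) by (simp add: Pi_iff)
    then have "carleson_seq UNIV (\<Phi> \<circ> (G \<circ> l))" using car l(2) by blast
    moreover have "\<Phi> \<circ> (G \<circ> l) = l" using l(1) FG(4) by (simp add: fun_eq_iff Pi_iff)
    ultimately show "carleson_seq UNIV l" by simp
  qed
  ultimately show "pseudohyp_unif_homeo \<Phi> \<and> comparable_on unit_disc (\<lambda>z. bdry_dist (\<Phi> z)) bdry_dist"
    using hom comp unfolding pseudohyp_unif_homeo_def by blast
next
  assume asm: "pseudohyp_unif_homeo \<Phi> \<and> comparable_on unit_disc (\<lambda>z. bdry_dist (\<Phi> z)) bdry_dist"
  then obtain G where hom: "homeomorphism unit_disc unit_disc \<Phi> G"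
    and uc: "pseudohyp_unif_cont \<Phi>" "pseudohyp_unif_cont G"
    unfolding pseudohyp_unif_homeo_def by blast
  have FG: "\<And>z. norm z < 1 \<Longrightarrow> norm (\<Phi> z) < 1" "\<And>z. norm z < 1 \<Longrightarrow> norm (G z) < 1"
    "\<And>z. norm z < 1 \<Longrightarrow> G (\<Phi> z) = z" "\<And>z. norm z < 1 \<Longrightarrow> \<Phi> (G z) = z"
    using hom by (auto simp: homeomorphism_def)
  obtain A B where A: "0 < A" "\<And>z. norm z < 1 \<Longrightarrow> bdry_dist (\<Phi> z) \<le> A * bdry_dist z"
    and B: "0 < B" "\<And>z. norm z < 1 \<Longrightarrow> bdry_dist (G z) \<le> B * bdry_dist z"
    using asm comparable_bdry_dist_iff[OF FG] by blast
  obtain d where d: "step_bounded d \<Phi>" using step_bounded_of_unif_cont[OF uc(1)] FG by auto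
  obtain d' where d': "step_bounded d' G" using step_bounded_of_unif_cont[OF uc(2)] FG by auto
  have "carleson_seq I l \<longleftrightarrow> carleson_seq I (\<Phi> \<circ> l)" if l: "l \<in> I \<rightarrow> unit_disc" for I l
  proof
    show "carleson_seq I (\<Phi> \<circ> l)" if "carleson_seq I l"
      by (rule carleson_seq_image[OF FG(1,3) uc(2) d' A B that])
    show "carleson_seq I l" if "carleson_seq I (\<Phi> \<circ> l)"
    proof -
      have "carleson_seq I (G \<circ> (\<Phi> \<circ> l))" by (rule carleson_seq_image[OF FG(2,4) uc(1) d B A that])
      moreover have "(G \<circ> (\<Phi> \<circ> l)) j = l j" if "j \<in> I" for j
        using l that FG(3)[of "l j"] by (auto simp: Pi_iff)
      ultimately show ?thesis using carleson_seq_cong[of I "G \<circ> (\<Phi> \<circ> l)" l] by simp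
    qed
  qed
  then show "\<Phi> \<in> comparable_carleson_equiv_maps"
    using asm cont D
    by (auto simp: comparable_carleson_equiv_maps_def carleson_equiv_maps_def comparable_sq_iff_bdry_dist)
qed

theorem theorem3p2:
  fixes \<Phi> :: "complex \<Rightarrow> complex"
  assumes "continuous_on unit_disc \<Phi>"
    and "\<Phi> \<in> unit_disc \<rightarrow> unit_disc"
  shows "(\<Phi> \<in> comparable_carleson_equiv_maps \<longleftrightarrow>
            pseudohyp_unif_homeo \<Phi> \<and> boundary_map \<Phi> \<in> BiLip_circle) \<and>
         (pseudohyp_unif_homeo \<Phi> \<and> boundary_map \<Phi> \<in> BiLip_circle \<longleftrightarrow>
            pseudohyp_unif_homeo \<Phi> \<and>
            comparable_on unit_disc (\<lambda>z. bdry_dist (\<Phi> z)) bdry_dist)"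
  using comparable_carleson_iff_comparable_homeo[OF assms] BiLip_boundary_iff_comparable[of \<Phi>] by blast

end
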